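(* Consider $Y_{1t}^N=C_t^N+\varepsilon_t$, $\varepsilon_t=x_t'\rho+u_t$, where $x_t=(\varepsilon_{t-1},\dots,\varepsilon_{t-K})'\in\mathbb R^K$ and $\rho=(\rho_1,\dots,\rho_K)'\in\mathbb R^K$. Suppose that $\{u_t\}_{t=1}^T$ is an i.i.d. sequence with $E(u_t)=0$ and $E(u_1^4)$ uniformly bounded, and that the roots of $1-\sum_{j=1}^K\rho_jL^j=0$ are uniformly bounded away from the unit circle. Let $\hat C_t^N$ be estimators of $C_t^N$ and assume that (1) $\sum_{t=1}^T(\hat C_t^N-C_t^N)^2=o_P(T)$, and (2) $\hat C_t^N-C_t^N=o_P(1)$ for $T_0-K+1\le t\le T$. Let $\hat\varepsilon_t=Y_{1t}^N-\hat C_t^N$, $\hat x_t=(\hat\varepsilon_{t-1},\dots,\hat\varepsilon_{t-K})'$, $\hat\rho=\big(\sum_{t=K+1}^T\hat x_t\hat x_t'\big)^{-1}\big(\sum_{t=K+1}^T\hat x_t\hat\varepsilon_t\big)$, $P_t^N=C_t^N+x_t'\rho$ and $\hat P_t^N=\hat C_t^N+\hat x_t'\hat\rho$. Then, for any $T_0+1\le t\le T$, $$\hat P_t^N-P_t^N=o_P(1)\quad\text{and}\quad\sum_{t=K+1}^T(\hat P_t^N-P_t^N)^2=o_P(T).$$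
   Context: $Y_{1t}^N$ is the outcome of the treated unit in the absence of the policy in period $t$; $C_t^N$ is a panel-model proxy for it, and $P_t^N$ is the counterfactual mean proxy that also uses the autoregressive structure of $\varepsilon_t$. In this model $\{u_t\}$ is independent of $\{C_t^N\}$. $T=T_0+T_*$, where $T_0$ and $T_*$ are the numbers of pre- and post-treatment periods, and asymptotics are as $T_0\to\infty$. $L$ denotes the argument of the lag polynomial.
   Formalization: The roots of the lag polynomial are required to lie outside the unit circle, uniformly bounded away from it; with roots inside allowed the claim fails (e.g. K=1, ρ=2, ε_0=0, Ĉ=C, Gaussian u, where the first conclusion is false). *)

theory Defs
  imports "HOL-Probability.Probability"
begin

text \<open>
  Vectors in \<open>\<real>\<^sup>K\<close> have type \<open>real ^ 'k\<close> with \<open>K = CARD('k)\<close>. The linear order on the index type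
  only serves to number the components: \<open>lag\<close> is the order isomorphism from \<open>'k\<close> onto \<open>{1..K}\<close>.
\<close>

definition lag :: "'k::{finite,linorder} \<Rightarrow> nat" where
  "lag j = card {..j}"

lemma bij_betw_lag: "bij_betw lag (UNIV :: 'k::{finite,linorder} set) {1..CARD('k)}"
proof -
  have less: "lag i < lag j" if "i < j" for i j :: 'k
    unfolding lag_def using that by (intro psubset_card_mono) auto
  have inj: "inj (lag :: 'k \<Rightarrow> nat)"
    by (rule injI) (metis less less_irrefl linorder_neqE)
  have "lag j \<in> {1..CARD('k)}" for j :: 'k
  proof -
    have "card {j} \<le> card {..j}" by (intro card_mono) auto
    moreover have "card {..j} \<le> CARD('k)" by (intro card_mono) auto
    ultimately show ?thesis by (simp add: lag_def)
  qed
  then have "lag ` (UNIV :: 'k set) \<subseteq> {1..CARD('k)}" by auto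
  moreover have "card (lag ` (UNIV :: 'k set)) = CARD('k)"
    using inj by (simp add: card_image)
  ultimately have "lag ` (UNIV :: 'k set) = {1..CARD('k)}"
    by (intro card_subset_eq) auto
  with inj show ?thesis by (simp add: bij_betw_def)
qed

text \<open>\<open>(e\<^bsub>t-1\<^esub>, \<dots>, e\<^bsub>t-K\<^esub>)'\<close>. Time is integer valued, since the first \<open>K\<close> vectors of lags of a series
  that is observed from period 1 on involve pre-sample values.\<close>

definition lag_vec :: "(int \<Rightarrow> real) \<Rightarrow> int \<Rightarrow> real ^ ('k::{finite,linorder})" where
  "lag_vec e t = (\<chi> j. e (t - int (lag j)))"

definition lag_gram :: "int \<Rightarrow> (int \<Rightarrow> real) \<Rightarrow> real ^ ('k::{finite,linorder}) ^ ('k::{finite,linorder})" where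
  "lag_gram T e = (\<Sum>t = int CARD('k) + 1..T. \<chi> i j. lag_vec e t $ i * lag_vec e t $ j)"

definition lag_cross :: "int \<Rightarrow> (int \<Rightarrow> real) \<Rightarrow> real ^ ('k::{finite,linorder})" where
  "lag_cross T e = (\<Sum>t = int CARD('k) + 1..T. e t *\<^sub>R lag_vec e t)"

text \<open>
  Least squares coefficients of the autoregression of order \<open>K\<close>. On a sample whose Gram matrix is
  singular the inverse does not exist; there the estimator is any solution of the normal equations
  (one always exists, and the fitted values in the sample do not depend on the choice). The library
  leaves \<open>matrix_inv\<close> of a singular matrix unspecified, so this case needs a convention.
\<close>

definition ar_ols :: "int \<Rightarrow> (int \<Rightarrow> real) \<Rightarrow> real ^ ('k::{finite,linorder})" where
  "ar_ols T e =
     (if invertible (lag_gram T e :: real ^ ('k::{finite,linorder}) ^ ('k::{finite,linorder}))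
      then matrix_inv (lag_gram T e) *v lag_cross T e
      else (SOME r. lag_gram T e *v r = lag_cross T e))"

text \<open>
  \<open>X\<^sub>n = o\<^sub>P(a\<^sub>n)\<close> as \<open>n \<rightarrow> \<infinity>\<close>; the probability space may change with \<open>n\<close>.
  Without the measurability conjunct, \<open>measure\<close> would be 0 on a non-measurable event.
\<close>

definition small_oP :: "(nat \<Rightarrow> 'a measure) \<Rightarrow> (nat \<Rightarrow> 'a \<Rightarrow> real) \<Rightarrow> (nat \<Rightarrow> real) \<Rightarrow> bool" where
  "small_oP M X a \<longleftrightarrow>
     (\<forall>\<^sub>F n in sequentially. X n \<in> borel_measurable (M n)) \<and>
     (\<forall>e>0. (\<lambda>n. measure (M n) {\<omega> \<in> space (M n). \<bar>X n \<omega>\<bar> > e * a n}) \<longlonglongrightarrow> 0)"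

end

theory Submission
  imports Defs "HOL-Computational_Algebra.Fundamental_Theorem_Algebra"
begin

text \<open>
  Least squares projects, so the fitted error \<open>y t = (r - \<rho>) \<bullet> lag_vec \<epsilon>hat t\<close>, where \<open>r\<close> is the estimate,
  is controlled by the correlation of \<open>y\<close> with the innovations. Split the errors into the response to
  the innovations and a solution of the homogeneous recursion, which carries the initial values; no
  bound on the latter is available, but it decays geometrically.

  If the innovation variance is bounded below, applying the true autoregression to \<open>y\<close> turns it into a
  combination of lagged innovations plus a small error, so the law of large numbers gives
  consistency of \<open>r\<close>. If the variance is small, \<open>r\<close> may be far from \<open>\<rho>\<close> and even unbounded. The
  sum of squares is then small because it is at most that of the innovations. At the end of the
  sample, reflecting the unstable roots of the estimated lag polynomial at the unit circle gives
  bounded coefficients that fit almost as well as \<open>r\<close>, hence have almost the same fitted values;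
  and with bounded coefficients these are small because the errors at the end of the sample are. The
  variance may oscillate with the sample size, so the two cases are separated by a threshold that
  depends on the required accuracy and probability.
\<close>

section \<open>Lag polynomials\<close>

text \<open>A prediction error is the fitted error plus the true filter applied to the error
  \<open>d\<close> of the panel proxy, and the latter is small directly by assumption. The obstacle
  is the pre-sample values: they are arbitrary and may grow with the sample size, so the regressors
  have no moment bounds. The way out is that every filter with constant coefficients, applied to the
  homogeneous part, gives a solution of the same recursion. On the first K periods in which it can
  be observed, this solution differs from a residual or a fitted error only by controlled terms, so
  it is there at most of order sqrt T, and by period n it has shrunk to l^n sqrt T, which tends to
  0.

  Reflection of one root changes the energy of a half line by a boundary term of favourable sign. At
  the last observation a second boundary term of the wrong sign would appear; this is why the sample
  is continued to infinity. The unbounded factor gained by reflecting is also the factor by which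
  \<open>r\<close> exceeds bounded coefficients, so it cancels.

  The decay constants \<open>B\<close>, \<open>l\<close> depend on K and \<eta> only, and so does
  the coefficient bound 2^K; hence \<rho> may vary with the sample size.\<close>

definition ar_res :: "real ^ ('k::{finite,linorder}) \<Rightarrow> (int \<Rightarrow> real) \<Rightarrow> int \<Rightarrow> real" where
  "ar_res r f t = f t - r \<bullet> lag_vec f t"

lemma lag_ge_1: "1 \<le> lag (j :: 'k::{finite,linorder})"
  and lag_le_card: "lag (j :: 'k::{finite,linorder}) \<le> CARD('k)"
  using bij_betw_lag[where 'k = 'k] unfolding bij_betw_def by auto

lemma inj_lag: "inj (lag :: 'k::{finite,linorder} \<Rightarrow> nat)"
  using bij_betw_lag[where 'k = 'k] by (auto simp: bij_betw_def)

lemma inner_lag_vec: "v \<bullet> lag_vec f t = (\<Sum>j\<in>UNIV. v $ j * f (t - int (lag j)))"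
  by (simp add: inner_vec_def lag_vec_def)

lemma lag_vec_add: "lag_vec (\<lambda>t. f t + g t) t = lag_vec f t + lag_vec g t"
  and lag_vec_diff: "lag_vec (\<lambda>t. f t - g t) t = lag_vec f t - lag_vec g t"
  by (simp_all add: lag_vec_def vec_eq_iff)

lemma inner_lag_vec_cong:
  fixes v :: "real ^ ('k::{finite,linorder})"
  assumes "\<And>s. t - int CARD('k) \<le> s \<Longrightarrow> s < t \<Longrightarrow> f s = g s"
  shows "v \<bullet> lag_vec f t = v \<bullet> lag_vec g t"
proof -
  have "f (t - int (lag j)) = g (t - int (lag j))" for j :: 'k
    using assms[of "t - int (lag j)"] lag_ge_1[of j] lag_le_card[of j] by auto
  then show ?thesis by (simp add: inner_lag_vec)
qed

lemma ar_res_cong: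
  fixes r :: "real ^ ('k::{finite,linorder})"
  assumes "\<And>s. t - int CARD('k) \<le> s \<Longrightarrow> s \<le> t \<Longrightarrow> f s = g s"
  shows "ar_res r f t = ar_res r g t"
proof -
  have "r \<bullet> lag_vec f t = r \<bullet> lag_vec g t" by (rule inner_lag_vec_cong) (use assms in auto)
  then show ?thesis using assms[of t] by (simp add: ar_res_def)
qed

lemma ar_res_add: "ar_res r (\<lambda>t. f t + g t) t = ar_res r f t + ar_res r g t"
  and ar_res_diff: "ar_res r (\<lambda>t. f t - g t) t = ar_res r f t - ar_res r g t"
  by (simp_all add: ar_res_def lag_vec_add lag_vec_diff inner_add_right inner_diff_right)

lemma ar_res_sum: "ar_res r (\<lambda>t. \<Sum>s\<in>S. f s t) t = (\<Sum>s\<in>S. ar_res r (f s) t)"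
proof -
  have "(\<Sum>j\<in>UNIV. r $ j * (\<Sum>s\<in>S. f s (t - int (lag j))))
      = (\<Sum>s\<in>S. \<Sum>j\<in>UNIV. r $ j * f s (t - int (lag j)))"
    by (simp only: sum_distrib_left) (rule sum.swap)
  then show ?thesis
    by (simp add: ar_res_def inner_lag_vec sum_subtractf)
qed

text \<open>Filters with constant coefficients commute. With the true coefficients this replaces
  regressors of unknown size by lagged innovations.\<close>

lemma ar_res_inner_lag_vec:
  "ar_res r (\<lambda>t. v \<bullet> lag_vec f t) t = v \<bullet> lag_vec (ar_res r f) t"
proof -
  have "(\<Sum>j\<in>UNIV. \<Sum>i\<in>UNIV. r $ j * (v $ i * f (t - int (lag j) - int (lag i))))
      = (\<Sum>i\<in>UNIV. \<Sum>j\<in>UNIV. v $ i * (r $ j * f (t - int (lag i) - int (lag j))))"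
    by (subst sum.swap) (simp add: algebra_simps)
  then show ?thesis
    by (simp add: ar_res_def inner_lag_vec right_diff_distrib sum_subtractf sum_distrib_left)
qed

lemma ar_res_commute: "ar_res r (ar_res v f) t = ar_res v (ar_res r f) t"
proof -
  have "ar_res r (ar_res v f) t = ar_res r f t - ar_res r (\<lambda>t. v \<bullet> lag_vec f t) t"
    by (simp add: ar_res_def[of v f, abs_def] ar_res_diff)
  then show ?thesis
    by (simp only: ar_res_inner_lag_vec) (simp add: ar_res_def[of v "ar_res r f"])
qed

section \<open>Polynomials in the lag operator acting on series\<close>

text \<open>Coefficients and series are complex so that every lag polynomial splits into linear
  factors; \<open>ar_res\<close> is the real instance, by \<open>lag_filter_ar_poly\<close>.\<close>

definition lag_filter :: "complex poly \<Rightarrow> (int \<Rightarrow> complex) \<Rightarrow> int \<Rightarrow> complex" where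
  "lag_filter p f t = (\<Sum>k\<le>degree p. coeff p k * f (t - int k))"

lemma lag_filter_eq:
  assumes "degree p \<le> N"
  shows "lag_filter p f t = (\<Sum>k\<le>N. coeff p k * f (t - int k))"
  unfolding lag_filter_def using assms
  by (intro sum.mono_neutral_left) (auto simp: coeff_eq_0)

lemma lag_filter_0 [simp]: "lag_filter 0 f t = 0"
  by (simp add: lag_filter_def)

lemma lag_filter_pCons: "lag_filter (pCons a p) f t = a * f t + lag_filter p f (t - 1)"
proof -
  have "lag_filter (pCons a p) f t = (\<Sum>k\<le>Suc (degree p). coeff (pCons a p) k * f (t - int k))"
    by (rule lag_filter_eq) (simp add: degree_pCons_le)
  also have "\<dots> = a * f t + (\<Sum>k\<le>degree p. coeff p k * f (t - int (Suc k)))"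
    by (subst sum.atMost_Suc_shift) simp
  finally show ?thesis by (simp add: lag_filter_def algebra_simps)
qed

lemma lag_filter_1 [simp]: "lag_filter 1 f = f"
  by (simp add: lag_filter_def fun_eq_iff)

lemma lag_filter_add_poly: "lag_filter (p + q) f t = lag_filter p f t + lag_filter q f t"
proof -
  define N where "N = max (degree p) (degree q)"
  have "degree (p + q) \<le> N" "degree p \<le> N" "degree q \<le> N"
    by (auto simp: N_def degree_add_le_max)
  then show ?thesis by (simp add: lag_filter_eq[where N = N] algebra_simps sum.distrib)
qed

lemma lag_filter_smult: "lag_filter (smult a p) f t = a * lag_filter p f t"
  by (simp add: lag_filter_eq[where N = "degree p"] degree_smult_le sum_distrib_left mult.assoc)

text \<open>Multiplication by the polynomial variable is a shift by one period, so polynomials act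
  on series as a ring. A factorization of the lag polynomial thereby becomes a composition of
  first-order filters, in any order.\<close>

lemma lag_filter_mult: "lag_filter (p * q) f t = lag_filter p (lag_filter q f) t"
proof (induction p arbitrary: t)
  case 0 then show ?case by simp
next
  case (pCons a p)
  then show ?case
    by (simp add: mult_pCons_left lag_filter_add_poly lag_filter_smult lag_filter_pCons)
qed

lemma lag_filter_linear: "lag_filter [:1, - m:] f t = f t - m * f (t - 1)"
  by (simp add: lag_filter_pCons)

definition ar_poly :: "real ^ ('k::{finite,linorder}) \<Rightarrow> complex poly" where
  "ar_poly r = 1 - (\<Sum>j\<in>UNIV. monom (of_real (r $ j)) (lag j))"

lemma degree_ar_poly: "degree (ar_poly (r :: real ^ ('k::{finite,linorder}))) \<le> CARD('k)"
  unfolding ar_poly_def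
  by (intro degree_diff_le degree_sum_le order.trans[OF degree_monom_le])
     (auto simp: lag_le_card)

lemma coeff_ar_poly: "coeff (ar_poly r) k = (if k = 0 then 1 else 0) - (\<Sum>j | lag j = k. of_real (r $ j))"
  by (simp add: ar_poly_def coeff_sum sum.If_cases if_distrib flip: sum.inter_filter)

lemma coeff_ar_poly_lag: "coeff (ar_poly r) (lag j) = - of_real (r $ j)"
proof -
  have "{i. lag i = lag j} = {j}" using inj_lag by (auto dest: injD)
  then show ?thesis using lag_ge_1[of j] by (simp add: coeff_ar_poly)
qed

lemma coeff_ar_poly_0: "coeff (ar_poly (r :: real ^ ('k::{finite,linorder}))) 0 = 1"
proof -
  have "{i :: 'k. lag i = 0} = {}" using lag_ge_1[where 'k = 'k] by (auto simp: Suc_le_eq)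
  then show ?thesis by (simp add: coeff_ar_poly del: Collect_empty_eq)
qed

lemma poly_ar_poly: "poly (ar_poly r) z = 1 - (\<Sum>j\<in>UNIV. of_real (r $ j) * z ^ lag j)"
  by (simp add: ar_poly_def poly_sum poly_monom)

lemma sum_atMost_lag:
  fixes g :: "nat \<Rightarrow> 'b::comm_monoid_add"
  shows "(\<Sum>k\<le>CARD('k). g k) = g 0 + (\<Sum>j\<in>(UNIV::'k::{finite,linorder} set). g (lag j))"
proof -
  have "(\<Sum>j\<in>(UNIV::'k set). g (lag j)) = (\<Sum>k\<in>{1..CARD('k)}. g k)"
    by (rule sum.reindex_bij_betw[OF bij_betw_lag])
  moreover have "{..CARD('k)} = insert 0 {1..CARD('k)}" by auto
  ultimately show ?thesis by simp
qed

lemma lag_filter_ar_poly: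
  "lag_filter (ar_poly r) (\<lambda>t. of_real (f t)) t = of_real (ar_res r f t)"
  by (simp add: lag_filter_eq[OF degree_ar_poly] sum_atMost_lag coeff_ar_poly_0 coeff_ar_poly_lag
      ar_res_def inner_lag_vec sum_negf)

text \<open>On a real series the real part of a complex filter only sees the real parts of its
  coefficients. Together with the constant term 1 this makes it an autoregressive residual
  again.\<close>

lemma Re_lag_filter:
  fixes p :: "complex poly"
  assumes "degree p \<le> CARD('k)" "coeff p 0 = 1"
  shows "Re (lag_filter p (\<lambda>t. of_real (f t)) t)
    = ar_res (\<chi> j :: 'k::{finite,linorder}. - Re (coeff p (lag j))) f t"
  by (simp add: lag_filter_eq[OF assms(1)] sum_atMost_lag assms(2) ar_res_def inner_lag_vec sum_negf)

section \<open>Factorization into first-order filters\<close>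

definition linear_factors :: "complex list \<Rightarrow> complex poly" where
  "linear_factors ms = prod_list (map (\<lambda>m. [:1, - m:]) ms)"

lemma linear_factors_simps [simp]:
  "linear_factors [] = 1"
  "linear_factors (m # ms) = [:1, - m:] * linear_factors ms"
  by (simp_all add: linear_factors_def)

lemma coeff_0_linear_factors [simp]: "coeff (linear_factors ms) 0 = 1"
  by (induction ms) (simp_all add: mult_pCons_left)

lemma degree_linear_factors: "degree (linear_factors ms) \<le> length ms"
proof (induction ms)
  case (Cons m ms)
  have "degree (linear_factors (m # ms)) \<le> degree [:1, - m:] + degree (linear_factors ms)"
    unfolding linear_factors_simps by (rule degree_mult_le)
  moreover have "degree [:1, - m:] \<le> 1" by simp
  ultimately show ?case using Cons by (simp del: linear_factors_simps)
qed simp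

text \<open>The coefficients are dominated by those of the product of the 1 + |m| L, and each of the
  latter is at most their sum, the value at L = 1.\<close>

lemma norm_coeff_linear_factors:
  "norm (coeff (linear_factors ms) k) \<le> (\<Prod>m\<leftarrow>ms. 1 + norm m)"
proof (induction ms arbitrary: k)
  case Nil then show ?case by (cases k) auto
next
  case (Cons m ms)
  let ?q = "linear_factors ms" and ?B = "\<Prod>m\<leftarrow>ms. 1 + norm m"
  have "norm (coeff ?q k - m * (if k = 0 then 0 else coeff ?q (k - 1))) \<le> ?B + norm m * ?B"
  proof (rule order.trans[OF norm_triangle_ineq4 add_mono])
    show "norm (m * (if k = 0 then 0 else coeff ?q (k - 1))) \<le> norm m * ?B"
      unfolding norm_mult
      by (rule mult_left_mono) (use Cons[of "k - 1"] norm_ge_zero[of "coeff ?q 0"] order.trans[OF norm_ge_zero Cons[of 0]] in auto)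
  qed (rule Cons)
  then show ?case
    by (cases k) (simp_all add: mult_pCons_left algebra_simps)
qed

text \<open>Dividing each factor L - y by -y normalizes the constant instead of the leading
  coefficient; the constant term 1 excludes the root 0. The \<open>m\<close> are thus inverse roots,
  and stability means that they lie inside the unit disc.\<close>

lemma linear_factors_exists:
  assumes p0: "coeff p 0 = 1"
  obtains ms where "p = linear_factors ms" "length ms = degree p"
    "\<And>m. m \<in> set ms \<Longrightarrow> m \<noteq> 0 \<and> poly p (inverse m) = 0"
proof -
  have "p \<noteq> 0" using p0 by auto
  then obtain A where A: "size A = degree p" "p = smult (lead_coeff p) (\<Prod>x\<in>#A. [:-x, 1:])"
    using alg_closed_imp_factorization[of p] by blast
  obtain xs where xs: "mset xs = A" using ex_mset by blast
  define c where "c = lead_coeff p"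
  have p: "p = smult c (prod_list (map (\<lambda>x. [:-x, 1:]) xs))"
    unfolding c_def by (subst A(2)) (simp add: xs[symmetric] prod_mset_prod_list flip: mset_map)
  have root: "poly p x = 0" if "x \<in> set xs" for x
  proof -
    have "[:-x, 1:] dvd prod_list (map (\<lambda>x. [:-x, 1:]) xs)"
      using that by (intro prod_list_dvd) auto
    then show ?thesis unfolding p by (auto simp: poly_eq_0_iff_dvd dvd_smult)
  qed
  have nz: "x \<noteq> 0" if "x \<in> set xs" for x
    using root[OF that] p0 by (auto simp: poly_0_coeff_0)
  have "\<exists>d. prod_list (map (\<lambda>x. [:-x, 1:]) ys) = smult d (linear_factors (map inverse ys))"
    if "\<And>y. y \<in> set ys \<Longrightarrow> y \<noteq> 0" for ys :: "complex list"
    using that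
  proof (induction ys)
    case Nil show ?case by (rule exI[of _ 1]) simp
  next
    case (Cons y ys)
    then obtain d where d: "prod_list (map (\<lambda>x. [:-x, 1:]) ys) = smult d (linear_factors (map inverse ys))"
      by auto
    have y: "[:-y, 1:] = smult (-y) [:1, - inverse y:]" using Cons.prems by simp
    show ?case
      unfolding list.map prod_list.Cons d linear_factors_simps
      by (rule exI[of _ "-y * d"], subst y) (simp only: mult_smult_left mult_smult_right smult_smult mult.commute)
  qed
  from this[of xs] nz obtain d where d: "p = smult (c * d) (linear_factors (map inverse xs))"
    unfolding p by auto
  have "c * d = 1" using p0 by (subst (asm) d) simp
  with d have "p = linear_factors (map inverse xs)" by simp
  moreover have "length (map inverse xs) = degree p" using A(1) xs by (metis length_map size_mset)
  ultimately show ?thesis by (rule that) (use root nz in auto)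
qed

section \<open>Stable recursions\<close>

definition roots_beyond :: "real \<Rightarrow> real ^ ('k::{finite,linorder}) \<Rightarrow> bool" where
  "roots_beyond \<eta> r \<longleftrightarrow>
     (\<forall>z::complex. 1 - (\<Sum>j\<in>UNIV. of_real (r $ j) * z ^ lag j) = 0 \<longrightarrow> norm z \<ge> 1 + \<eta>)"

lemma roots_beyond_factors:
  fixes r :: "real ^ ('k::{finite,linorder})"
  assumes "\<eta> > 0" "roots_beyond \<eta> r"
  obtains ms where "ar_poly r = linear_factors ms" "length ms \<le> CARD('k)"
    "\<And>m. m \<in> set ms \<Longrightarrow> norm m \<le> inverse (1 + \<eta>)"
proof -
  obtain ms where ms: "ar_poly r = linear_factors ms" "length ms = degree (ar_poly r)"
      "\<And>m. m \<in> set ms \<Longrightarrow> m \<noteq> 0 \<and> poly (ar_poly r) (inverse m) = 0"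
    using linear_factors_exists[OF coeff_ar_poly_0[of r]] by blast
  have "norm m \<le> inverse (1 + \<eta>)" if "m \<in> set ms" for m
  proof -
    have "1 + \<eta> \<le> norm (inverse m)"
      using assms(2) ms(3)[OF that] by (auto simp: roots_beyond_def poly_ar_poly)
    then have "inverse (norm (inverse m)) \<le> inverse (1 + \<eta>)"
      using assms(1) by (intro le_imp_inverse_le) auto
    then show ?thesis by (simp add: norm_inverse)
  qed
  then show ?thesis using that ms degree_ar_poly[of r] by auto
qed

lemma prod_list_le_power:
  fixes f :: "'b \<Rightarrow> real"
  assumes "\<And>x. x \<in> set xs \<Longrightarrow> 0 \<le> f x \<and> f x \<le> c" "1 \<le> c" "length xs \<le> n"
  shows "(\<Prod>x\<leftarrow>xs. f x) \<le> c ^ n"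
proof -
  have "0 \<le> (\<Prod>x\<leftarrow>xs. f x) \<and> (\<Prod>x\<leftarrow>xs. f x) \<le> c ^ length xs"
    using assms(1)
  proof (induction xs)
    case (Cons x xs)
    then have "f x * (\<Prod>x\<leftarrow>xs. f x) \<le> c * c ^ length xs" using assms(2) by (intro mult_mono) auto
    with Cons show ?case by auto
  qed simp
  moreover have "c ^ length xs \<le> c ^ n" using assms(2,3) by (rule power_increasing[rotated])
  ultimately show ?thesis by linarith
qed

text \<open>All inverse roots have modulus at most 1, so each of the at most K factors 1 + |m| is at
  most 2. The constant \<open>R\<close> used later is K times this bound.\<close>

lemma roots_beyond_coeff_bound:
  fixes r :: "real ^ ('k::{finite,linorder})"
  assumes "\<eta> > 0" "roots_beyond \<eta> r"
  shows "\<bar>r $ j\<bar> \<le> 2 ^ CARD('k)"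
proof -
  obtain ms where ms: "ar_poly r = linear_factors ms" "length ms \<le> CARD('k)"
      "\<And>m. m \<in> set ms \<Longrightarrow> norm m \<le> inverse (1 + \<eta>)"
    using roots_beyond_factors[OF assms] by metis
  have "inverse (1 + \<eta>) \<le> 1" using assms(1) by (simp add: inverse_le_1_iff)
  then have "(\<Prod>m\<leftarrow>ms. 1 + norm m) \<le> 2 ^ CARD('k)"
    using ms(2,3) by (intro prod_list_le_power) fastforce+
  moreover have "\<bar>r $ j\<bar> = norm (coeff (ar_poly r) (lag j))"
    by (simp add: coeff_ar_poly_lag)
  ultimately show ?thesis
    using norm_coeff_linear_factors[of ms "lag j"] ms(1) by simp
qed

text \<open>One factor is removed at a time: g = (1 - m L) f is controlled by the remaining factors,
  and f is recovered from f_t = g_t + m f_(t-1). The gap l0 < l absorbs the polynomial growth that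
  repeated roots cause, and the constant 2 / (1 - l0 / l) paid per factor does not depend on where
  the roots are.\<close>

lemma linear_factors_decay:
  fixes f :: "int \<Rightarrow> complex"
  assumes "0 \<le> l0" "l0 < l" "l0 \<le> 1"
    and "\<And>m. m \<in> set ms \<Longrightarrow> norm m \<le> l0"
    and "\<And>s. t0 - int (length ms) < s \<Longrightarrow> s \<le> t0 \<Longrightarrow> norm (f s) \<le> M"
    and "\<And>s. t0 < s \<Longrightarrow> s \<le> t1 \<Longrightarrow> norm (lag_filter (linear_factors ms) f s) \<le> M * l ^ nat (s - t0)"
    and "t0 < t" "t \<le> t1"
  shows "norm (f t) \<le> (2 / (1 - l0 / l)) ^ length ms * M * l ^ nat (t - t0)"
  using assms(4-)
proof (induction ms arbitrary: f M t)
  case Nil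
  then show ?case by simp
next
  case (Cons m ms)
  define g where "g = lag_filter [:1, - m:] f"
  define D where "D = 2 / (1 - l0 / l)"
  have l: "0 < l" "l0 / l < 1" using assms(1,2) by auto
  have D: "2 \<le> D" unfolding D_def using l assms(1) by (simp add: field_simps)
  have m: "norm m \<le> l0" using Cons.prems(1) by simp
  have M0: "0 \<le> M" using order.trans[OF norm_ge_zero Cons.prems(2)[of t0]] by simp
  \<comment> \<open>\<open>g\<close> looks back one period, so its window is shorter by one; the
    bound doubles because |m| <= 1.\<close>
  have g_window: "norm (g s) \<le> 2 * M" if "t0 - int (length ms) < s" "s \<le> t0" for s
  proof -
    have "norm (g s) \<le> norm (f s) + norm m * norm (f (s - 1))"
      unfolding g_def lag_filter_linear by (metis norm_mult norm_triangle_ineq4)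
    also have "\<dots> \<le> M + 1 * M"
      using that m assms(3) M0 by (intro add_mono mult_mono Cons.prems(2)) auto
    finally show ?thesis by simp
  qed
  have g_filter: "norm (lag_filter (linear_factors ms) g s) \<le> 2 * M * l ^ nat (s - t0)"
    if "t0 < s" "s \<le> t1" for s
  proof -
    have "lag_filter (linear_factors ms) g s = lag_filter (linear_factors (m # ms)) f s"
      unfolding g_def linear_factors_simps by (metis lag_filter_mult mult.commute)
    then have "norm (lag_filter (linear_factors ms) g s) \<le> M * l ^ nat (s - t0)"
      using Cons.prems(3)[OF that] by simp
    also have "\<dots> \<le> 2 * M * l ^ nat (s - t0)"
      using M0 l by (intro mult_right_mono) auto
    finally show ?thesis .
  qed
  define B where "B = D ^ length ms * (2 * M)"
  have g_bound: "norm (g s) \<le> B * l ^ nat (s - t0)" if "t0 < s" "s \<le> t1" for s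
    unfolding B_def D_def using Cons.prems(1) g_window g_filter that by (intro Cons.IH) auto
  define B' where "B' = D ^ length (m # ms) * M"
  \<comment> \<open>\<open>B'\<close> solves x = B + x l0 / l, so the bound
    \<open>B' * l ^ i\<close> reproduces itself under f_t = g_t + m f_(t-1).\<close>
  have B': "B + B' * (l0 / l) = B'" "0 \<le> B'"
    unfolding B_def B'_def using M0 D l by (simp_all add: D_def field_simps)
  have "norm (f (t0 + int i)) \<le> B' * l ^ i" if "t0 + int i \<le> t1" for i
    using that
  proof (induction i)
    case 0
    have "1 * M \<le> B'"
      unfolding B'_def using M0 D by (intro mult_right_mono one_le_power) auto
    moreover have "norm (f t0) \<le> M" using Cons.prems(2)[of t0] by simp
    ultimately show ?case by simp
  next
    case (Suc i)
    have "f (t0 + int (Suc i)) = g (t0 + int (Suc i)) + m * f (t0 + int i)"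
      by (simp add: g_def lag_filter_linear add.commute add.left_commute)
    then have "norm (f (t0 + int (Suc i)))
        \<le> norm (g (t0 + int (Suc i))) + norm m * norm (f (t0 + int i))"
      by (metis norm_mult norm_triangle_ineq)
    also have "\<dots> \<le> B * l ^ Suc i + l0 * (B' * l ^ i)"
    proof (intro add_mono mult_mono)
      show "norm (g (t0 + int (Suc i))) \<le> B * l ^ Suc i"
        using g_bound[of "t0 + int (Suc i)"] Suc.prems by (simp add: nat_add_distrib)
    qed (use m Suc assms(1) in auto)
    also have "\<dots> = (B + B' * (l0 / l)) * l ^ Suc i"
      using l by (simp add: field_simps)
    finally show ?case unfolding B'(1) .
  qed
  from this[of "nat (t - t0)"] Cons.prems(4,5) show ?case by (simp add: B'_def D_def)
qed

text \<open>The last K values up to \<open>t0\<close> determine the solution, and the bound is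
  proportional to them. The recursion is required only up to \<open>t1\<close>, so that the estimate
  can be used inside a sample.\<close>

definition decays :: "real \<Rightarrow> real \<Rightarrow> real ^ ('k::{finite,linorder}) \<Rightarrow> bool" where
  "decays B l r \<longleftrightarrow> (\<forall>f M t0 t1 t.
     (\<forall>s. t0 - int CARD('k) < s \<longrightarrow> s \<le> t0 \<longrightarrow> \<bar>f s\<bar> \<le> M) \<longrightarrow>
     (\<forall>s. t0 < s \<longrightarrow> s \<le> t1 \<longrightarrow> ar_res r f s = 0) \<longrightarrow>
     t0 < t \<longrightarrow> t \<le> t1 \<longrightarrow> \<bar>f t\<bar> \<le> B * M * l ^ nat (t - t0))"

lemma roots_beyond_decays:
  assumes "\<eta> > 0"
  obtains B l where "1 \<le> B" "0 < l" "l < 1"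
    "\<And>r :: real ^ ('k::{finite,linorder}). roots_beyond \<eta> r \<Longrightarrow> decays B l r"
proof -
  define l0 where "l0 = inverse (1 + \<eta>)"
  \<comment> \<open>A rate strictly between \<open>l0\<close> and 1, as the removal of factors needs
    a gap.\<close>
  define l where "l = inverse (1 + \<eta> / 2)"
  define D where "D = 2 / (1 - l0 / l)"
  have l: "0 < l0" "l0 < l" "l < 1" "l0 \<le> 1"
    using assms by (auto simp: l0_def l_def field_simps)
  have D: "1 \<le> D" unfolding D_def using l by (simp add: field_simps)
  have "decays (D ^ CARD('k::{finite,linorder})) l r" if r: "roots_beyond \<eta> r" for r :: "real ^ ('k::{finite,linorder})"
    unfolding decays_def
  proof (intro allI impI)
    fix f M t0 t1 t
    assume w: "\<forall>s. t0 - int CARD('k::{finite,linorder}) < s \<longrightarrow> s \<le> t0 \<longrightarrow> \<bar>f s\<bar> \<le> M"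
      and h: "\<forall>s. t0 < s \<longrightarrow> s \<le> t1 \<longrightarrow> ar_res r f s = 0"
      and t: "t0 < t" "t \<le> t1"
    obtain ms where ms: "ar_poly r = linear_factors ms" "length ms \<le> CARD('k::{finite,linorder})"
        "\<And>m. m \<in> set ms \<Longrightarrow> norm m \<le> l0"
      unfolding l0_def using roots_beyond_factors[OF assms r] by metis
    have M0: "0 \<le> M" using order.trans[OF abs_ge_zero w[rule_format, of t0]] by simp
    have filt: "lag_filter (linear_factors ms) (\<lambda>t. of_real (f t)) s = 0" if "t0 < s" "s \<le> t1" for s
      using h that by (simp add: lag_filter_ar_poly flip: ms(1))
    have "norm (complex_of_real (f t)) \<le> D ^ length ms * M * l ^ nat (t - t0)"
      unfolding D_def
    proof (rule linear_factors_decay)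
      show "norm (lag_filter (linear_factors ms) (\<lambda>x. complex_of_real (f x)) s) \<le> M * l ^ nat (s - t0)"
        if "t0 < s" "s \<le> t1" for s
        using filt[OF that] M0 l by simp
    qed (use l ms w t in auto)
    also have "\<dots> \<le> D ^ CARD('k::{finite,linorder}) * M * l ^ nat (t - t0)"
      using D ms(2) M0 l by (intro mult_right_mono power_increasing) auto
    finally show "\<bar>f t\<bar> \<le> D ^ CARD('k::{finite,linorder}) * M * l ^ nat (t - t0)" by simp
  qed
  moreover have "1 \<le> D ^ CARD('k::{finite,linorder})" using D by (rule one_le_power)
  moreover have "0 < l" using l by linarith
  ultimately show ?thesis using l(3) by (intro that)
qed

section \<open>Impulse responses and homogeneous solutions\<close>

text \<open>The power series coefficients of 1 / \<open>ar_poly r\<close>, extended by 0 to negative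
  times: the fundamental solution started by a unit innovation at time 0.\<close>

function impulse_response :: "real ^ ('k::{finite,linorder}) \<Rightarrow> int \<Rightarrow> real" where
  "impulse_response r t =
     (if t < 0 then 0 else if t = 0 then 1
      else \<Sum>j\<in>UNIV. r $ j * impulse_response r (t - int (lag j)))"
  by auto
termination
  by (relation "Wellfounded.measure (\<lambda>(r, t). nat t)") (use lag_ge_1 in \<open>auto simp: Suc_le_eq\<close>)

declare impulse_response.simps [simp del]

lemma impulse_response_neg [simp]: "t < 0 \<Longrightarrow> impulse_response r t = 0"
  and impulse_response_0 [simp]: "impulse_response r 0 = 1"
  by (simp_all add: impulse_response.simps[of r t] impulse_response.simps[of r 0])

lemma ar_res_impulse_response:
  "ar_res r (impulse_response r) t = (if t = 0 then 1 else 0)"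
proof -
  have "r \<bullet> lag_vec (impulse_response r) t = 0" if "t \<le> 0"
    unfolding inner_lag_vec
  proof (intro sum.neutral ballI)
    fix j
    show "r $ j * impulse_response r (t - int (lag j)) = 0"
      using that lag_ge_1[of j] by simp
  qed
  moreover have "r \<bullet> lag_vec (impulse_response r) t = impulse_response r t" if "t > 0"
    using that by (simp add: inner_lag_vec impulse_response.simps[of r t])
  ultimately show ?thesis by (cases "t > 0") (auto simp: ar_res_def)
qed

lemma ar_res_impulse_response_shift:
  fixes r :: "real ^ ('k::{finite,linorder})"
  shows "ar_res r (\<lambda>s. c * impulse_response r (s - i)) s = (if s = i then c else 0)"
proof -
  have swap: "s - int (lag j) - i = s - i - int (lag j)" for j :: 'k by simp
  have "ar_res r (\<lambda>s. c * impulse_response r (s - i)) s = c * ar_res r (impulse_response r) (s - i)"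
    by (simp add: ar_res_def inner_lag_vec right_diff_distrib sum_distrib_left mult.left_commute swap)
  then show ?thesis by (simp add: ar_res_impulse_response)
qed

lemma impulse_response_bound:
  assumes "decays B l r" "1 \<le> B"
  shows "\<bar>impulse_response r (int k)\<bar> \<le> B * l ^ k"
proof (cases "k = 0")
  case False
  have "\<bar>impulse_response r s\<bar> \<le> 1" if "s \<le> 0" for s
    using that by (cases "s = 0") auto
  then have "\<bar>impulse_response r (int k)\<bar> \<le> B * 1 * l ^ nat (int k - 0)"
    using assms(1)[unfolded decays_def, rule_format, of 0 "impulse_response r" 1 "int k" "int k"] False
    by (auto simp: ar_res_impulse_response)
  then show ?thesis by simp
qed (use assms in simp)

text \<open>Cutting \<open>f\<close> off after \<open>t0\<close> leaves residuals in at most K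
  periods after \<open>t0\<close>. Subtracting impulse responses that start in those periods removes
  them and changes nothing up to \<open>t0\<close>.\<close>

lemma homogeneous_extension:
  fixes r :: "real ^ ('k::{finite,linorder})"
  obtains g where "\<And>s. s \<le> t0 \<Longrightarrow> g s = f s" "\<And>s. t0 < s \<Longrightarrow> ar_res r g s = 0"
proof -
  define F where "F s = (if s \<le> t0 then f s else 0)" for s
  define g where "g s = F s - (\<Sum>i = t0 + 1..t0 + int CARD('k). ar_res r F i * impulse_response r (s - i))" for s
  have "ar_res r g s = ar_res r F s - (\<Sum>i = t0 + 1..t0 + int CARD('k). if s = i then ar_res r F i else 0)" for s
    unfolding g_def by (simp only: ar_res_diff ar_res_sum ar_res_impulse_response_shift)
  then have g: "ar_res r g s = ar_res r F s - (if s \<in> {t0 + 1..t0 + int CARD('k)} then ar_res r F s else 0)" for s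
    by (simp add: sum.delta)
  have "ar_res r g s = 0" if "t0 < s" for s
  proof (cases "s \<le> t0 + int CARD('k)")
    case False
    have "ar_res r F s = ar_res r (\<lambda>_. 0) s" by (rule ar_res_cong) (use False in \<open>auto simp: F_def\<close>)
    also have "\<dots> = 0" by (simp add: ar_res_def inner_lag_vec)
    finally show ?thesis using False by (simp add: g)
  qed (use that g in auto)
  moreover have "g s = f s" if "s \<le> t0" for s
    using that by (auto simp: g_def F_def intro!: sum.neutral)
  ultimately show ?thesis by (intro that)
qed

section \<open>Reflection of roots\<close>

text \<open>Only the future matters. Quantifying over the starting time makes the property invariant
  under shifts, hence under filters.\<close>

definition sq_summable :: "(int \<Rightarrow> 'b::real_normed_vector) \<Rightarrow> bool" where
  "sq_summable g \<longleftrightarrow> (\<forall>t0. summable (\<lambda>k. (norm (g (t0 + int k)))\<^sup>2))"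

definition energy :: "int \<Rightarrow> (int \<Rightarrow> 'b::real_normed_vector) \<Rightarrow> real" where
  "energy t0 g = (\<Sum>k. (norm (g (t0 + int k)))\<^sup>2)"

lemma sq_summable_scale:
  fixes g :: "int \<Rightarrow> complex"
  shows "sq_summable g \<Longrightarrow> sq_summable (\<lambda>t. c * g t)"
  by (auto simp: sq_summable_def norm_mult power_mult_distrib intro!: summable_mult)

lemma sq_summable_shift:
  assumes "sq_summable g"
  shows "sq_summable (\<lambda>t. g (t - c))"
  unfolding sq_summable_def
proof
  fix t0
  have "t0 + int k - c = (t0 - c) + int k" for k by simp
  moreover have "summable (\<lambda>k. (norm (g ((t0 - c) + int k)))\<^sup>2)"
    using assms unfolding sq_summable_def by blast
  ultimately show "summable (\<lambda>k. (norm (g (t0 + int k - c)))\<^sup>2)"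
    by (simp only:)
qed

lemma sq_summable_add:
  assumes "sq_summable f" "sq_summable g"
  shows "sq_summable (\<lambda>t. f t + g t)"
  unfolding sq_summable_def
proof
  fix t0
  show "summable (\<lambda>k. (norm (f (t0 + int k) + g (t0 + int k)))\<^sup>2)"
  proof (rule summable_comparison_test)
    show "\<exists>N. \<forall>k\<ge>N. norm ((norm (f (t0 + int k) + g (t0 + int k)))\<^sup>2)
        \<le> 2 * (norm (f (t0 + int k)))\<^sup>2 + 2 * (norm (g (t0 + int k)))\<^sup>2"
    proof (intro exI allI impI)
      fix k :: nat
      have "(norm (f (t0 + int k) + g (t0 + int k)))\<^sup>2 \<le> (norm (f (t0 + int k)) + norm (g (t0 + int k)))\<^sup>2"
        by (intro power_mono norm_triangle_ineq) auto
      also have "\<dots> \<le> 2 * (norm (f (t0 + int k)))\<^sup>2 + 2 * (norm (g (t0 + int k)))\<^sup>2"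
        using sum_squares_bound[of "norm (f (t0 + int k))" "norm (g (t0 + int k))"]
        by (simp add: power2_sum)
      finally show "norm ((norm (f (t0 + int k) + g (t0 + int k)))\<^sup>2)
        \<le> 2 * (norm (f (t0 + int k)))\<^sup>2 + 2 * (norm (g (t0 + int k)))\<^sup>2" by simp
    qed
    show "summable (\<lambda>k. 2 * (norm (f (t0 + int k)))\<^sup>2 + 2 * (norm (g (t0 + int k)))\<^sup>2)"
      using assms by (intro summable_add summable_mult) (auto simp: sq_summable_def)
  qed
qed

lemma sq_summable_lag_filter:
  assumes "sq_summable f"
  shows "sq_summable (lag_filter p f)"
proof (induction p)
  case 0
  then show ?case by (simp add: sq_summable_def)
next
  case (pCons a p)
  have "lag_filter (pCons a p) f = (\<lambda>t. a * f t + lag_filter p f (t - 1))"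
    by (simp add: fun_eq_iff lag_filter_pCons)
  then show ?case using pCons assms by (auto intro!: sq_summable_add sq_summable_scale sq_summable_shift)
qed

text \<open>A factor 1 - m L with |m| > 1 has its root 1 / m inside the unit disc. The mirror image
  of this root in the unit circle is \<open>cnj m\<close>, with inverse root 1 /
  \<open>cnj m\<close>.\<close>

definition reflect_root :: "complex \<Rightarrow> complex" where
  "reflect_root m = (if norm m \<le> 1 then m else inverse (cnj m))"

lemma norm_reflect_root: "norm (reflect_root m) \<le> 1"
proof (cases "norm m \<le> 1")
  case False
  then have "norm (reflect_root m) = norm (inverse (cnj m))"
    by (simp only: reflect_root_def if_False)
  also have "\<dots> = inverse (norm m)"
    by (simp only: norm_inverse complex_mod_cnj)
  also have "\<dots> \<le> inverse 1"
    by (rule le_imp_inverse_le) (use False in linarith)+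
  finally show ?thesis by simp
qed (simp add: reflect_root_def)

text \<open>Period by period, |w - m w'|^2 - |m|^2 |w - w' / cnj m|^2 = (1 - |m|^2) (|w|^2 -
  |w'|^2), where w' is the value before w. The right-hand side telescopes, and as \<open>g\<close>
  tends to 0 only (|m|^2 - 1) |g (t0 - 1)|^2 is left, which is nonnegative.\<close>

lemma energy_reflect_root:
  assumes "sq_summable g"
  shows "(max 1 (norm m))\<^sup>2 * energy t0 (lag_filter [:1, - reflect_root m:] g)
    \<le> energy t0 (lag_filter [:1, - m:] g)"
proof (cases "norm m \<le> 1")
  case True
  then show ?thesis by (simp add: reflect_root_def max_def)
next
  case False
  let ?c = "\<lambda>k. (norm m)\<^sup>2 * (norm (lag_filter [:1, - reflect_root m:] g (t0 + int k)))\<^sup>2"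
  let ?d = "\<lambda>k. (norm (lag_filter [:1, - m:] g (t0 + int k)))\<^sup>2"
  let ?h = "\<lambda>k. (norm (g (t0 - 1 + int k)))\<^sup>2"
  have m0: "m \<noteq> 0" using False by auto
  have step: "?d k - ?c k = (1 - (norm m)\<^sup>2) * (?h (Suc k) - ?h k)" for k
  proof -
    let ?w = "g (t0 + int k)" and ?w' = "g (t0 + int k - 1)"
    have "cnj m * (?w - inverse (cnj m) * ?w') = cnj m * ?w - ?w'"
      using m0 by (simp add: right_diff_distrib)
    then have "norm (cnj m) * norm (?w - inverse (cnj m) * ?w') = norm (cnj m * ?w - ?w')"
      by (simp only: flip: norm_mult)
    then have "norm m * norm (?w - inverse (cnj m) * ?w') = norm (cnj m * ?w - ?w')"
      by (simp only: complex_mod_cnj)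
    then have "?c k = (norm (cnj m * ?w - ?w'))\<^sup>2"
      by (simp only: lag_filter_linear reflect_root_def False if_False flip: power_mult_distrib)
    moreover have "(norm (?w - m * ?w'))\<^sup>2 - (norm (cnj m * ?w - ?w'))\<^sup>2
        = (1 - (norm m)\<^sup>2) * ((norm ?w)\<^sup>2 - (norm ?w')\<^sup>2)"
      unfolding cmod_power2 by (simp add: algebra_simps power2_eq_square)
    moreover have "?h (Suc k) = (norm ?w)\<^sup>2" "?h k = (norm ?w')\<^sup>2"
      by (simp_all add: algebra_simps)
    ultimately show ?thesis by (simp only: lag_filter_linear)
  qed
  have sd: "summable ?d" and sc: "summable ?c"
    using sq_summable_lag_filter[OF assms] by (auto simp: sq_summable_def intro!: summable_mult)
  have "?h \<longlonglongrightarrow> 0"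
    using assms by (intro summable_LIMSEQ_zero) (simp add: sq_summable_def)
  then have "(\<lambda>k. ?d k - ?c k) sums ((1 - (norm m)\<^sup>2) * (0 - ?h 0))"
    unfolding step by (intro sums_mult telescope_sums)
  moreover have "(\<lambda>k. ?d k - ?c k) sums (suminf ?d - suminf ?c)"
    by (intro sums_diff summable_sums sd sc)
  ultimately have "suminf ?d - suminf ?c = (1 - (norm m)\<^sup>2) * (0 - ?h 0)"
    by (rule sums_unique2[symmetric])
  then have "suminf ?d - suminf ?c = ((norm m)\<^sup>2 - 1) * ?h 0"
    by (simp add: algebra_simps)
  moreover have "0 \<le> ((norm m)\<^sup>2 - 1) * ?h 0"
    using False by (intro mult_nonneg_nonneg) auto
  ultimately have "suminf ?c \<le> suminf ?d" by linarith
  moreover have "suminf ?c = (max 1 (norm m))\<^sup>2 * energy t0 (lag_filter [:1, - reflect_root m:] g)"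
    unfolding energy_def using False sq_summable_lag_filter[OF assms]
    by (subst suminf_mult) (auto simp: sq_summable_def max_def)
  ultimately show ?thesis by (simp add: energy_def)
qed

text \<open>Since filters commute, \<open>m\<close> can be reflected in the series already filtered
  by the other reflected factors; the induction hypothesis is then used for the series filtered by
  the unreflected 1 - m L.\<close>

lemma energy_reflect:
  assumes "sq_summable f"
  shows "(\<Prod>m\<leftarrow>ms. max 1 (norm m))\<^sup>2 * energy t0 (lag_filter (linear_factors (map reflect_root ms)) f)
    \<le> energy t0 (lag_filter (linear_factors ms) f)"
  using assms
proof (induction ms arbitrary: f)
  case (Cons m ms)
  let ?R = "linear_factors (map reflect_root ms)" and ?P = "\<Prod>m\<leftarrow>ms. max 1 (norm m)"
  have "(max 1 (norm m))\<^sup>2 * energy t0 (lag_filter [:1, - reflect_root m:] (lag_filter ?R f))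
      \<le> energy t0 (lag_filter [:1, - m:] (lag_filter ?R f))"
    by (intro energy_reflect_root sq_summable_lag_filter Cons.prems)
  then have "?P\<^sup>2 * ((max 1 (norm m))\<^sup>2 * energy t0 (lag_filter [:1, - reflect_root m:] (lag_filter ?R f)))
      \<le> ?P\<^sup>2 * energy t0 (lag_filter [:1, - m:] (lag_filter ?R f))"
    by (intro mult_left_mono) auto
  also have "lag_filter [:1, - m:] (lag_filter ?R f) = lag_filter ?R (lag_filter [:1, - m:] f)"
    unfolding fun_eq_iff by (metis lag_filter_mult mult.commute)
  also have "?P\<^sup>2 * energy t0 \<dots> \<le> energy t0 (lag_filter (linear_factors ms) (lag_filter [:1, - m:] f))"
    by (intro Cons.IH sq_summable_lag_filter Cons.prems)
  also have "lag_filter (linear_factors ms) (lag_filter [:1, - m:] f) = lag_filter (linear_factors (m # ms)) f"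
    unfolding fun_eq_iff linear_factors_simps by (metis lag_filter_mult mult.commute)
  also have "lag_filter [:1, - reflect_root m:] (lag_filter ?R f) = lag_filter (linear_factors (map reflect_root (m # ms))) f"
    by (simp only: fun_eq_iff list.map linear_factors_simps lag_filter_mult simp_thms)
  finally show ?case by (simp add: power_mult_distrib mult_ac del: linear_factors_simps)
qed simp

text \<open>The coefficients \<open>r'\<close> arise from \<open>r\<close> by reflecting the roots of \<open>ar_poly r\<close> inside the unit
  disc at the unit circle, and \<open>1 / b\<close> is the product of the moduli of these roots.\<close>

lemma bounded_ar_exists:
  fixes r :: "real ^ ('k::{finite,linorder})"
  shows "\<exists>(r' :: real ^ ('k::{finite,linorder})) b. 1 \<le> b \<and> (\<forall>j. \<bar>r' $ j\<bar> \<le> 2 ^ CARD('k)) \<and>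
    (\<forall>j. \<bar>r $ j\<bar> \<le> 2 ^ CARD('k) * b) \<and>
    (\<forall>f. sq_summable f \<longrightarrow> sq_summable (ar_res r' f) \<and>
      (\<forall>t0. b\<^sup>2 * energy t0 (ar_res r' f) \<le> energy t0 (ar_res r f)))"
proof -
  obtain ms where ms: "ar_poly r = linear_factors ms" "length ms = degree (ar_poly r)"
    using linear_factors_exists[OF coeff_ar_poly_0[of r]] by blast
  then have len: "length ms \<le> CARD('k)" using degree_ar_poly[of r] by simp
  define b where "b = (\<Prod>m\<leftarrow>ms. max 1 (norm m))"
  define p where "p = linear_factors (map reflect_root ms)"
  \<comment> \<open>Real parts spare the pairing of conjugate roots: for a real series the result is
    the real part of the reflected filter, so its energy can only be smaller.\<close>
  define r' :: "(real, 'k) vec" where "r' = (\<chi> j. - Re (coeff p (lag j)))"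
  have b1: "1 \<le> b" unfolding b_def by (induction ms) (auto intro: mult_ge1_I simp: le_max_iff_disj max_def)
  have degp: "degree p \<le> CARD('k)"
    using degree_linear_factors[of "map reflect_root ms"] len by (simp add: p_def)
  have p0: "coeff p 0 = 1" by (simp add: p_def)
  have coeffp: "norm (coeff p k) \<le> 2 ^ CARD('k)" for k
  proof -
    have "norm (coeff p k) \<le> (\<Prod>m\<leftarrow>map reflect_root ms. 1 + norm m)"
      unfolding p_def by (rule norm_coeff_linear_factors)
    also have "\<dots> \<le> 2 ^ CARD('k)"
      using len norm_reflect_root by (intro prod_list_le_power) (auto simp: add_increasing)
    finally show ?thesis .
  qed
  have r'_bound: "\<bar>r' $ j\<bar> \<le> 2 ^ CARD('k)" for j
    using order.trans[OF abs_Re_le_cmod coeffp[of "lag j"]] by (simp add: r'_def)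
  \<comment> \<open>Since 1 + |m| <= 2 max 1 |m|, the coefficients of \<open>r\<close> exceed the
    stable bound by no more than the factor \<open>b\<close> that reflection gains in the root of
    the energy.\<close>
  have r_bound: "\<bar>r $ j\<bar> \<le> 2 ^ CARD('k) * b" for j
  proof -
    have "\<bar>r $ j\<bar> = norm (coeff (ar_poly r) (lag j))"
      by (simp add: coeff_ar_poly_lag)
    also have "\<dots> \<le> (\<Prod>m\<leftarrow>ms. 1 + norm m)" unfolding ms(1) by (rule norm_coeff_linear_factors)
    also have "\<dots> \<le> 2 ^ length ms * b" unfolding b_def
    proof (induction ms)
      case (Cons m ms)
      have "(1 + norm m) * (\<Prod>m\<leftarrow>ms. 1 + norm m) \<le> (2 * max 1 (norm m)) * (2 ^ length ms * (\<Prod>m\<leftarrow>ms. max 1 (norm m)))"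
        by (rule mult_mono) (use Cons in \<open>auto intro!: prod_list_nonneg\<close>)
      then show ?case by (simp add: mult_ac)
    qed simp
    also have "\<dots> \<le> 2 ^ CARD('k) * b"
      using len b1 by (intro mult_right_mono power_increasing) auto
    finally show ?thesis .
  qed
  have Re: "ar_res r' f t = Re (lag_filter p (\<lambda>t. of_real (f t)) t)" for f t
    unfolding r'_def by (rule Re_lag_filter[OF degp p0, symmetric])
  have sum: "sq_summable (\<lambda>t. complex_of_real (f t))" if "sq_summable f" for f
    using that by (simp add: sq_summable_def)
  have le: "(norm (ar_res r' f t))\<^sup>2 \<le> (norm (lag_filter p (\<lambda>t. of_real (f t)) t))\<^sup>2" for f t
    unfolding Re real_norm_def by (intro power_mono abs_Re_le_cmod) auto
  have summ: "sq_summable (ar_res r' f)" if "sq_summable f" for f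
    unfolding sq_summable_def
  proof
    fix t0
    show "summable (\<lambda>k. (norm (ar_res r' f (t0 + int k)))\<^sup>2)"
      by (rule summable_comparison_test'[where g = "\<lambda>k. (norm (lag_filter p (\<lambda>t. of_real (f t)) (t0 + int k)))\<^sup>2"])
         (use sq_summable_lag_filter[OF sum[OF that], of p] le in \<open>auto simp: sq_summable_def\<close>)
  qed
  have "b\<^sup>2 * energy t0 (ar_res r' f) \<le> energy t0 (ar_res r f)" if "sq_summable f" for f t0
  proof -
    have "energy t0 (ar_res r' f) \<le> energy t0 (lag_filter p (\<lambda>t. of_real (f t)))"
      unfolding energy_def
      using le summ[OF that] sq_summable_lag_filter[OF sum[OF that], of p]
      by (intro suminf_le) (auto simp: sq_summable_def)
    then have "b\<^sup>2 * energy t0 (ar_res r' f) \<le> b\<^sup>2 * energy t0 (lag_filter p (\<lambda>t. of_real (f t)))"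
      by (intro mult_left_mono) auto
    also have "\<dots> \<le> energy t0 (lag_filter (linear_factors ms) (\<lambda>t. of_real (f t)))"
      unfolding b_def p_def by (rule energy_reflect[OF sum[OF that]])
    also have "\<dots> = energy t0 (ar_res r f)"
      by (simp add: energy_def lag_filter_ar_poly flip: ms(1))
    finally show ?thesis .
  qed
  with b1 r'_bound r_bound summ show ?thesis by blast
qed

section \<open>Least squares\<close>

lemma lag_gram_mult:
  fixes r :: "real ^ ('k::{finite,linorder})"
  shows "lag_gram T e *v r = (\<Sum>t = int CARD('k) + 1..T. (r \<bullet> lag_vec e t) *\<^sub>R lag_vec e t)"
proof -
  have "(lag_gram T e *v r) $ i = (\<Sum>t = int CARD('k) + 1..T. (r \<bullet> lag_vec e t) *\<^sub>R lag_vec e t) $ i" for i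
  proof -
    have "(lag_gram T e *v r) $ i
        = (\<Sum>j\<in>UNIV. \<Sum>t = int CARD('k) + 1..T. lag_vec e t $ i * lag_vec e t $ j * r $ j)"
      by (simp add: lag_gram_def matrix_vector_mult_def sum_distrib_right)
    also have "\<dots> = (\<Sum>t = int CARD('k) + 1..T. \<Sum>j\<in>UNIV. lag_vec e t $ i * lag_vec e t $ j * r $ j)"
      by (rule sum.swap)
    also have "\<dots> = (\<Sum>t = int CARD('k) + 1..T. (r \<bullet> lag_vec e t) * lag_vec e t $ i)"
      by (simp add: inner_vec_def sum_distrib_left sum_distrib_right mult_ac)
    finally show ?thesis by simp
  qed
  then show ?thesis by (simp add: vec_eq_iff)
qed

text \<open>Solvability for a singular Gram matrix G: let z be the component of the cross moments
  orthogonal to the range of G. Then z . G z = 0 is a sum of squares, so z is orthogonal to every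
  regressor vector of the sample, hence to the cross moments, and so z = 0.\<close>

lemma ar_ols_normal_equations:
  "lag_gram T e *v (ar_ols T e :: real ^ ('k::{finite,linorder})) = lag_cross T e"
proof -
  let ?G = "lag_gram T e :: ((real, 'k) vec, 'k) vec" and ?c = "lag_cross T e :: (real, 'k) vec"
  let ?I = "{int CARD('k) + 1..T}"
  have "\<exists>r. ?G *v r = ?c"
  proof -
    define S where "S = range (\<lambda>r. ?G *v r)"
    have "subspace S"
      unfolding S_def by (intro linear_subspace_image subspace_UNIV matrix_vector_mul_linear)
    then have span: "span S = S" by (simp add: span_eq_iff)
    obtain y z where yz: "y \<in> span S" "\<And>w. w \<in> span S \<Longrightarrow> orthogonal z w" "?c = y + z"
      using orthogonal_subspace_decomp_exists[of S ?c] by metis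
    have "z \<bullet> (?G *v z) = 0"
      using yz(2)[of "?G *v z"] unfolding span by (auto simp: S_def orthogonal_def)
    then have "(\<Sum>t\<in>?I. (z \<bullet> lag_vec e t)\<^sup>2) = 0"
      by (simp add: lag_gram_mult inner_sum_right power2_eq_square)
    then have "z \<bullet> lag_vec e t = 0" if "t \<in> ?I" for t
      using that by (subst (asm) sum_nonneg_eq_0_iff) auto
    then have "z \<bullet> ?c = 0" by (simp add: lag_cross_def inner_sum_right)
    moreover have "z \<bullet> y = 0" using yz(1,2) by (simp add: orthogonal_def)
    ultimately have "z \<bullet> z = 0" unfolding yz(3) by (simp add: inner_add_right)
    then show ?thesis using yz(1,3) unfolding span by (auto simp: S_def)
  qed
  then have "?G *v (SOME r. ?G *v r = ?c) = ?c" by (rule someI_ex)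
  moreover have "?G *v (matrix_inv ?G *v ?c) = ?c" if "invertible ?G"
  proof -
    have "?G ** matrix_inv ?G = mat 1"
      using that unfolding invertible_def matrix_inv_def by (rule someI2_ex) simp
    then show ?thesis by (simp add: matrix_vector_mul_assoc)
  qed
  ultimately show ?thesis by (simp add: ar_ols_def)
qed

text \<open>The normal equations tested against every direction. The arguments about the estimator
  use only this property, so they cover whichever solution is chosen when the Gram matrix is
  singular.\<close>

definition normal_solution :: "int \<Rightarrow> (int \<Rightarrow> real) \<Rightarrow> real ^ ('k::{finite,linorder}) \<Rightarrow> bool" where
  "normal_solution T e r \<longleftrightarrow>
     (\<forall>v :: real ^ ('k::{finite,linorder}). (\<Sum>t = int CARD('k) + 1..T. ar_res r e t * (v \<bullet> lag_vec e t)) = 0)"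

lemma normal_solution_ar_ols: "normal_solution T e (ar_ols T e :: real ^ ('k::{finite,linorder}))"
  unfolding normal_solution_def
proof
  fix v :: "(real, 'k) vec"
  let ?r = "ar_ols T e :: (real, 'k) vec" and ?I = "{int CARD('k) + 1..T}"
  have "(\<Sum>t\<in>?I. ar_res ?r e t * (v \<bullet> lag_vec e t)) = v \<bullet> (lag_cross T e - lag_gram T e *v ?r)"
    by (simp add: ar_res_def lag_gram_mult lag_cross_def inner_diff_right inner_sum_right
        left_diff_distrib sum_subtractf)
  then show "(\<Sum>t\<in>?I. ar_res ?r e t * (v \<bullet> lag_vec e t)) = 0"
    by (simp add: ar_ols_normal_equations)
qed

definition rss :: "int \<Rightarrow> (int \<Rightarrow> real) \<Rightarrow> real ^ ('k::{finite,linorder}) \<Rightarrow> real" where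
  "rss T e r = (\<Sum>t = int CARD('k) + 1..T. (ar_res r e t)\<^sup>2)"

lemma rss_pythagoras:
  fixes r v :: "real ^ ('k::{finite,linorder})"
  assumes "normal_solution T e r"
  shows "rss T e v = rss T e r + (\<Sum>t = int CARD('k) + 1..T. ((r - v) \<bullet> lag_vec e t)\<^sup>2)"
proof -
  have "(ar_res v e t)\<^sup>2 = (ar_res r e t)\<^sup>2 + ((r - v) \<bullet> lag_vec e t)\<^sup>2
      + 2 * (ar_res r e t * ((r - v) \<bullet> lag_vec e t))" for t
    by (simp add: ar_res_def inner_diff_left power2_eq_square algebra_simps)
  then show ?thesis
    using assms unfolding rss_def normal_solution_def
    by (simp add: sum.distrib flip: sum_distrib_left)
qed

lemma rss_minimal:
  fixes r v :: "real ^ ('k::{finite,linorder})"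
  assumes "normal_solution T e r"
  shows "rss T e r \<le> rss T e v"
  using rss_pythagoras[OF assms, of v] by (simp add: sum_nonneg)

text \<open>Coefficients that fit almost as well as the minimizer have almost the same fitted value
  in every single period. Unlike a comparison of coefficients, this needs no lower bound on the Gram
  matrix.\<close>

lemma rss_gap:
  fixes r v :: "real ^ ('k::{finite,linorder})"
  assumes "normal_solution T e r" "t \<in> {int CARD('k) + 1..T}"
  shows "((r - v) \<bullet> lag_vec e t)\<^sup>2 \<le> rss T e v - rss T e r"
  using rss_pythagoras[OF assms(1), of v] assms(2)
    member_le_sum[of t "{int CARD('k) + 1..T}" "\<lambda>t. ((r - v) \<bullet> lag_vec e t)\<^sup>2"]
  by simp

lemma rss_nonneg: "0 \<le> rss T e r"
  by (simp add: rss_def sum_nonneg)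

lemma abs_ar_res_le_sqrt_rss:
  fixes r :: "real ^ ('k::{finite,linorder})"
  assumes "t \<in> {int CARD('k) + 1..T}"
  shows "\<bar>ar_res r e t\<bar> \<le> sqrt (rss T e r)"
  unfolding rss_def
  by (rule real_le_rsqrt) (use assms in \<open>auto intro: member_le_sum[where f = "\<lambda>t. (ar_res r e t)\<^sup>2"]\<close>)

section \<open>Size of filtered series\<close>

lemma abs_le_L2_set: "finite A \<Longrightarrow> t \<in> A \<Longrightarrow> \<bar>f t\<bar> \<le> L2_set f A"
  unfolding L2_set_def by (rule real_le_rsqrt) (auto intro: member_le_sum[where f = "\<lambda>t. (f t)\<^sup>2"])

lemma L2_set_subset: "finite B \<Longrightarrow> A \<subseteq> B \<Longrightarrow> L2_set f A \<le> L2_set f B"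
  unfolding L2_set_def by (intro real_sqrt_le_mono sum_mono2) auto

lemma L2_set_sum_le: "L2_set (\<lambda>t. \<Sum>j\<in>J. g j t) A \<le> (\<Sum>j\<in>J. L2_set (g j) A)"
proof (induction J rule: infinite_finite_induct)
  case (insert j J)
  then show ?case
    using L2_set_triangle_ineq[of "g j" "\<lambda>t. \<Sum>j\<in>J. g j t" A] by simp
qed (simp_all add: L2_set_def)

lemma L2_set_diff_le: "L2_set (\<lambda>t. f t - g t) A \<le> L2_set f A + L2_set g A"
  using L2_set_triangle_ineq[of f "\<lambda>t. - g t" A] by (simp add: L2_set_def)

lemma L2_set_shift: "L2_set (\<lambda>t. f (t - d)) {a..b::int} = L2_set f {a - d..b - d}"
proof -
  have "(\<Sum>t\<in>{a..b}. (f (t - d))\<^sup>2) = (\<Sum>t\<in>{a - d..b - d}. (f t)\<^sup>2)"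
    by (rule sum.reindex_bij_witness[of _ "\<lambda>t. t + d" "\<lambda>t. t - d"]) auto
  then show ?thesis by (simp add: L2_set_def)
qed

lemma inner_lag_vec_le:
  fixes v :: "real ^ ('k::{finite,linorder})"
  assumes v: "\<And>j. \<bar>v $ j\<bar> \<le> c"
    and f: "\<And>s. t - int CARD('k) \<le> s \<Longrightarrow> s < t \<Longrightarrow> \<bar>f s\<bar> \<le> q"
  shows "\<bar>v \<bullet> lag_vec f t\<bar> \<le> real CARD('k) * c * q"
proof -
  have "\<bar>v $ j * f (t - int (lag j))\<bar> \<le> c * q" for j
    unfolding abs_mult
  proof (rule mult_mono[OF v f])
    show "0 \<le> c" using order.trans[OF abs_ge_zero v] .
  qed (use lag_ge_1[of j] lag_le_card[of j] in auto)
  then have "(\<Sum>j\<in>UNIV. \<bar>v $ j * f (t - int (lag j))\<bar>) \<le> (\<Sum>j\<in>(UNIV :: 'k set). c * q)"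
    by (intro sum_mono)
  then show ?thesis
    unfolding inner_lag_vec by (intro order.trans[OF sum_abs]) (simp add: mult.assoc)
qed

lemma L2_set_inner_lag_vec:
  fixes v :: "real ^ ('k::{finite,linorder})"
  assumes v: "\<And>j. \<bar>v $ j\<bar> \<le> c"
  shows "L2_set (\<lambda>t. v \<bullet> lag_vec f t) {a..b} \<le> real CARD('k) * c * L2_set f {a - int CARD('k)..b}"
proof -
  have c: "0 \<le> c" using order.trans[OF abs_ge_zero v] .
  have "L2_set (\<lambda>t. v $ j * f (t - int (lag j))) {a..b} \<le> c * L2_set f {a - int CARD('k)..b}" for j
  proof -
    have "L2_set (\<lambda>t. v $ j * f (t - int (lag j))) {a..b} = \<bar>v $ j\<bar> * L2_set (\<lambda>t. f (t - int (lag j))) {a..b}"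
      by (simp add: L2_set_def power_mult_distrib real_sqrt_mult flip: sum_distrib_left)
    also have "\<dots> \<le> c * L2_set f {a - int CARD('k)..b}"
      unfolding L2_set_shift using v c lag_ge_1[of j] lag_le_card[of j]
      by (intro mult_mono L2_set_subset) auto
    finally show ?thesis .
  qed
  then have "(\<Sum>j\<in>UNIV. L2_set (\<lambda>t. v $ j * f (t - int (lag j))) {a..b})
      \<le> (\<Sum>j\<in>(UNIV :: 'k set). c * L2_set f {a - int CARD('k)..b})"
    by (intro sum_mono)
  then show ?thesis
    unfolding inner_lag_vec by (intro order.trans[OF L2_set_sum_le]) simp
qed

lemma ar_res_le:
  fixes r :: "real ^ ('k::{finite,linorder})"
  assumes "\<And>j. \<bar>r $ j\<bar> \<le> c"
    and "\<And>s. t - int CARD('k) \<le> s \<Longrightarrow> s \<le> t \<Longrightarrow> \<bar>f s\<bar> \<le> q"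
  shows "\<bar>ar_res r f t\<bar> \<le> (1 + real CARD('k) * c) * q"
proof -
  have "\<bar>r \<bullet> lag_vec f t\<bar> \<le> real CARD('k) * c * q"
    using assms by (intro inner_lag_vec_le) auto
  moreover have "\<bar>f t\<bar> \<le> q" using assms(2)[of t] by simp
  ultimately show ?thesis by (simp add: ar_res_def algebra_simps)
qed

lemma L2_set_ar_res:
  fixes r :: "real ^ ('k::{finite,linorder})"
  assumes "\<And>j. \<bar>r $ j\<bar> \<le> c"
  shows "L2_set (ar_res r f) {a..b} \<le> (1 + real CARD('k) * c) * L2_set f {a - int CARD('k)..b}"
proof -
  have "L2_set (ar_res r f) {a..b} \<le> L2_set f {a..b} + L2_set (\<lambda>t. r \<bullet> lag_vec f t) {a..b}"
    unfolding ar_res_def by (rule L2_set_diff_le)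
  also have "\<dots> \<le> L2_set f {a - int CARD('k)..b} + real CARD('k) * c * L2_set f {a - int CARD('k)..b}"
    using assms by (intro add_mono L2_set_inner_lag_vec L2_set_subset) auto
  finally show ?thesis by (simp add: algebra_simps)
qed

lemma sq_summable_geometric:
  fixes g :: "int \<Rightarrow> real"
  assumes "\<And>t. t1 < t \<Longrightarrow> \<bar>g t\<bar> \<le> M * l ^ nat (t - t1)" "0 < l" "l < 1"
  shows "sq_summable g"
  unfolding sq_summable_def
proof
  fix t0
  define N where "N = nat (t1 + 1 - t0)"
  have "summable (\<lambda>k. M\<^sup>2 * (l\<^sup>2) ^ k)"
    using assms(2,3) by (intro summable_mult summable_geometric) (simp add: power_less_one_iff)
  then have "summable (\<lambda>k. (norm (g (t0 + int (k + N))))\<^sup>2)"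
  proof (rule summable_comparison_test'[where N = 0])
    fix k :: nat
    have t: "t1 < t0 + int (k + N)" by (simp add: N_def)
    have "0 < l ^ nat (t0 + int (k + N) - t1)" using assms(2) by simp
    then have M: "0 \<le> M" using order.trans[OF abs_ge_zero assms(1)[OF t]] by (meson zero_le_mult_iff not_le)
    have "\<bar>g (t0 + int (k + N))\<bar> \<le> M * l ^ nat (t0 + int (k + N) - t1)" by (rule assms(1)[OF t])
    also have "\<dots> \<le> M * l ^ k"
      using M assms(2,3) by (intro mult_left_mono power_decreasing) (auto simp: N_def)
    finally have "\<bar>g (t0 + int (k + N))\<bar>\<^sup>2 \<le> (M * l ^ k)\<^sup>2" by (intro power_mono) auto
    then show "norm ((norm (g (t0 + int (k + N))))\<^sup>2) \<le> M\<^sup>2 * (l\<^sup>2) ^ k"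
      by (simp add: power_mult_distrib mult.commute[of k 2] flip: power_mult)
  qed
  then show "summable (\<lambda>k. (norm (g (t0 + int k)))\<^sup>2)"
    by (subst (asm) summable_iff_shift[where f = "\<lambda>k. (norm (g (t0 + int k)))\<^sup>2"])
qed

lemma energy_geometric_le:
  fixes g :: "int \<Rightarrow> real"
  assumes "\<And>k. \<bar>g (t0 + int k)\<bar> \<le> M * l ^ k" "0 < l" "l < 1"
  shows "energy t0 g \<le> (M / (1 - l))\<^sup>2"
proof -
  have l2: "l\<^sup>2 < 1" using assms(2,3) by (simp add: power_less_one_iff)
  have sums: "(\<lambda>k. M\<^sup>2 * (l\<^sup>2) ^ k) sums (M\<^sup>2 * (1 / (1 - l\<^sup>2)))"
    using l2 by (intro sums_mult geometric_sums) simp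
  have le: "(norm (g (t0 + int k)))\<^sup>2 \<le> M\<^sup>2 * (l\<^sup>2) ^ k" for k
    using power_mono[OF assms(1)[of k], of 2]
    by (simp add: power_mult_distrib mult.commute[of k 2] flip: power_mult)
  have "energy t0 g \<le> M\<^sup>2 * (1 / (1 - l\<^sup>2))"
    unfolding energy_def sums_unique[OF sums]
    by (intro suminf_le le summable_comparison_test'[OF sums_summable[OF sums], of 0] sums_summable[OF sums])
       (use le in simp)
  \<comment> \<open>Weakening 1 - l^2 to (1 - l)^2 makes the bound a perfect square.\<close>
  also have "\<dots> \<le> M\<^sup>2 * (1 / (1 - l)\<^sup>2)"
  proof (intro mult_left_mono divide_left_mono)
    show "(1 - l)\<^sup>2 \<le> 1 - l\<^sup>2"
      using assms(2,3) mult_right_mono[of l 1 l] by (simp add: power2_eq_square algebra_simps)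
  qed (use assms l2 in auto)
  finally show ?thesis by (simp add: power_divide)
qed

lemma energy_split:
  fixes g :: "int \<Rightarrow> real"
  assumes "sq_summable g" "t0 \<le> t1 + 1"
  shows "energy t0 g = (\<Sum>t = t0..t1. (g t)\<^sup>2) + energy (t1 + 1) g"
proof -
  define N where "N = nat (t1 + 1 - t0)"
  have N: "t0 + int N = t1 + 1" using assms(2) by (simp add: N_def)
  have "energy t0 g = (\<Sum>k. (norm (g (t0 + int (k + N))))\<^sup>2) + (\<Sum>k<N. (norm (g (t0 + int k)))\<^sup>2)"
    unfolding energy_def using assms(1) by (intro suminf_split_initial_segment) (simp add: sq_summable_def)
  moreover have "t0 + int (k + N) = t1 + 1 + int k" for k using N by simp
  moreover have "(\<Sum>k<N. (norm (g (t0 + int k)))\<^sup>2) = (\<Sum>t = t0..t1. (g t)\<^sup>2)"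
    by (rule sum.reindex_bij_witness[of _ "\<lambda>t. nat (t - t0)" "\<lambda>k. t0 + int k"]) (use N in auto)
  ultimately show ?thesis by (simp only: energy_def add.commute)
qed

section \<open>Fitted values at the end of the sample\<close>

text \<open>However large the fitted coefficients are, reflecting their unstable roots yields
  bounded coefficients that fit almost as well: the residual energy of the sample extended beyond \<open>T\<close>
  by the homogeneous solution does not increase, and the extension itself has little energy.\<close>

lemma fitted_error_end:
  fixes r \<rho> :: "real ^ ('k::{finite,linorder})" and n T :: int
  assumes decays: "decays B l \<rho>" and B: "1 \<le> B" and l: "0 < l" "l < 1"
    and \<rho>: "\<And>j. \<bar>\<rho> $ j\<bar> \<le> 2 ^ CARD('k)"
    and n: "2 * int CARD('k) \<le> n" "n \<le> T"
    and homog: "\<And>t. 1 \<le> t \<Longrightarrow> t \<le> T \<Longrightarrow> ar_res \<rho> \<zeta> t = 0"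
    and s: "\<And>t. 1 \<le> t \<Longrightarrow> t \<le> T \<Longrightarrow> s t = \<zeta> t + e t"
    and q: "\<And>t. n + 1 - int CARD('k) \<le> t \<Longrightarrow> t \<le> T \<Longrightarrow> \<bar>e t\<bar> \<le> q" "0 \<le> q"
    and r: "normal_solution T s r"
    and t: "n < t" "t \<le> T"
    and R: "R = real CARD('k) * 2 ^ CARD('k)"
    and c: "c = (B * (1 + R) + R / l ^ CARD('k)) / (1 - l)"
    and Q: "Q = q + l ^ nat (n - 2 * int CARD('k)) *
      (L2_set (ar_res \<rho> s) {int CARD('k) + 1..T} + L2_set e {1..T})"
  shows "\<bar>(r - \<rho>) \<bullet> lag_vec s t\<bar> \<le> (c + 2 * R + B * (1 + R + c)) * Q"
proof -
  let ?K = "int CARD('k)"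
  define a where "a = L2_set (ar_res \<rho> s) {?K + 1..T}"
  define E where "E = L2_set e {1..T}"
  define ln where "ln = l ^ nat (n - 2 * ?K)"
  have K: "1 \<le> ?K" by (simp add: Suc_leI)
  have nonneg: "0 \<le> a" "0 \<le> E" "0 < ln" "0 \<le> R" "ln \<le> 1"
    using l by (auto simp: a_def E_def R ln_def L2_set_nonneg intro: power_le_one)
  have Q_eq: "Q = q + ln * (a + E)" by (simp add: Q a_def E_def ln_def)
  have Q0: "0 \<le> Q" using nonneg q(2) by (simp add: Q_eq)
  obtain r' :: "(real, 'k) vec" and b where b: "1 \<le> b" and r': "\<And>j. \<bar>r' $ j\<bar> \<le> 2 ^ CARD('k)"
    and rb: "\<And>j. \<bar>r $ j\<bar> \<le> 2 ^ CARD('k) * b"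
    and sq_r': "\<And>f. sq_summable f \<Longrightarrow> sq_summable (ar_res r' f)"
    and energy_r': "\<And>f t0. sq_summable f \<Longrightarrow> b\<^sup>2 * energy t0 (ar_res r' f) \<le> energy t0 (ar_res r f)"
    using bounded_ar_exists[of r] by blast
  obtain \<zeta>' where \<zeta>': "\<And>t. t \<le> T \<Longrightarrow> \<zeta>' t = \<zeta> t" "\<And>t. T < t \<Longrightarrow> ar_res \<rho> \<zeta>' t = 0"
    using homogeneous_extension[of T \<zeta> \<rho>] by metis
  have homog': "ar_res \<rho> \<zeta>' t = 0" if "1 \<le> t" for t
  proof (cases "t \<le> T")
    case True
    then have "ar_res \<rho> \<zeta>' t = ar_res \<rho> \<zeta> t" by (intro ar_res_cong \<zeta>'(1)) auto
    then show ?thesis using homog that True by simp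
  qed (use \<zeta>'(2) in simp)
  \<comment> \<open>After \<open>T\<close> only the homogeneous part runs on. Residuals of the
    continuation then come from this part, which is geometrically small, and from the last K values
    of \<open>e\<close>, which are at most \<open>q\<close>.\<close>
  define e' where "e' t = (if t \<le> T then e t else 0)" for t
  define s' where "s' t = \<zeta>' t + e' t" for t
  have s': "s' t = s t" if "1 \<le> t" "t \<le> T" for t
    using that s \<zeta>'(1) by (simp add: s'_def e'_def)
  have ar_s': "ar_res x s' t = ar_res x s t" if "t \<in> {?K + 1..T}" for x :: "(real, 'k) vec" and t
    using that by (intro ar_res_cong s') auto
  \<comment> \<open>Mere summability is at stake, so the maximum over the first K periods serves as
    constant although nothing bounds it.\<close>
  have "sq_summable \<zeta>'"
  proof (rule sq_summable_geometric[where ?t1.0 = ?K and l = l])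
    fix t assume "?K < t"
    then show "\<bar>\<zeta>' t\<bar> \<le> (B * Max ((\<lambda>t. \<bar>\<zeta>' t\<bar>) ` {1..?K})) * l ^ nat (t - ?K)"
      by (intro decays[unfolded decays_def, rule_format, where ?t0.0 = ?K and ?t1.0 = t]) (auto intro: homog')
  qed (use l in auto)
  moreover have "sq_summable e'"
    by (rule sq_summable_geometric[where ?t1.0 = T and l = l and M = 1]) (use l in \<open>auto simp: e'_def\<close>)
  ultimately have sq_s': "sq_summable s'"
    unfolding s'_def by (rule sq_summable_add)

  have e_le: "\<bar>ar_res x e t\<bar> \<le> (1 + real CARD('k) * c) * E"
    if "\<And>j. \<bar>x $ j\<bar> \<le> c" "t \<in> {?K + 1..T}" for x :: "(real, 'k) vec" and t c
    using that unfolding E_def by (intro ar_res_le abs_le_L2_set) auto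
  have \<zeta>_split: "ar_res x \<zeta>' t = ar_res x s t - ar_res x e t" if "t \<in> {?K + 1..T}" for x :: "(real, 'k) vec" and t
  proof -
    have "ar_res x \<zeta>' t = ar_res x (\<lambda>t. s t - e t) t"
      using that by (intro ar_res_cong) (auto simp: s \<zeta>'(1))
    then show ?thesis by (simp add: ar_res_diff)
  qed
  \<comment> \<open>A filtered homogeneous solution is homogeneous. Its values need K lags, so the
    recursion for them is used after 2K with initial window K + 1 to 2K. In that window they are
    differences of a residual of \<open>s\<close>, at most the root of the residual sum of squares,
    and a residual of \<open>e\<close>.\<close>
  have tail_\<zeta>: "\<bar>ar_res x \<zeta>' t\<bar> \<le> B * M * l ^ nat (t - 2 * ?K)"
    if M: "\<And>s. s \<in> {?K + 1..2 * ?K} \<Longrightarrow> \<bar>ar_res x \<zeta>' s\<bar> \<le> M" and t: "2 * ?K < t"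
    for x :: "(real, 'k) vec" and t M
  proof -
    have "ar_res \<rho> (ar_res x \<zeta>') u = 0" if "2 * ?K < u" for u
    proof -
      have "ar_res \<rho> (ar_res x \<zeta>') u = ar_res x (ar_res \<rho> \<zeta>') u"
        by (rule ar_res_commute)
      also have "\<dots> = ar_res x (\<lambda>_. 0) u"
        using that by (intro ar_res_cong homog') auto
      finally show ?thesis by (simp add: ar_res_def inner_lag_vec)
    qed
    then show ?thesis
      using t M by (intro decays[unfolded decays_def, rule_format, where ?t0.0 = "2 * ?K" and ?t1.0 = t]) auto
  qed

  have rss_r: "sqrt (rss T s r) \<le> a"
  proof -
    have "rss T s r \<le> rss T s \<rho>" by (rule rss_minimal[OF r])
    moreover have "a = sqrt (rss T s \<rho>)" by (simp add: a_def L2_set_def rss_def)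
    ultimately show ?thesis by simp
  qed

  \<comment> \<open>\<open>b * W\<close> bounds the first residual beyond \<open>T\<close>: one term
    is the homogeneous part decayed from period 2K, the other the last values of \<open>e\<close> as
    seen by the filter \<open>r\<close>.\<close>
  define W where "W = B * (a + (1 + R) * E) * ln + R / l ^ CARD('k) * q"
  have W_le: "W \<le> (1 - l) * c * Q"
  proof -
    have "B * (a + (1 + R) * E) * ln \<le> B * (1 + R) * (ln * (a + E))"
      using B nonneg by (simp add: algebra_simps mult_mono)
    moreover have "(1 - l) * c * Q = B * (1 + R) * Q + R / l ^ CARD('k) * Q"
      using l by (simp add: c distrib_right)
    moreover have "B * (1 + R) * (ln * (a + E)) \<le> B * (1 + R) * Q" "R / l ^ CARD('k) * q \<le> R / l ^ CARD('k) * Q"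
      using B nonneg l q(2) unfolding Q_eq by (intro mult_left_mono; simp)+
    ultimately show ?thesis unfolding W_def by linarith
  qed
  have W0: "0 \<le> W" using B nonneg l q(2) by (simp add: W_def)

  have tail: "\<bar>ar_res r s' (T + 1 + int k)\<bar> \<le> b * W * l ^ k" for k
  proof -
    let ?t = "T + 1 + int k"
    have "\<bar>ar_res r \<zeta>' u\<bar> \<le> b * (a + (1 + R) * E)" if "u \<in> {?K + 1..2 * ?K}" for u
    proof -
      have u: "u \<in> {?K + 1..T}" using that n by auto
      have "\<bar>ar_res r s u\<bar> \<le> a" using abs_ar_res_le_sqrt_rss[OF u] rss_r by (rule order.trans)
      also have "a \<le> b * a" using b nonneg mult_right_mono[of 1 b a] by simp
      moreover have "\<bar>ar_res r e u\<bar> \<le> (1 + R * b) * E" using e_le[OF rb u] by (simp add: R mult.assoc)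
      moreover have "(1 + R * b) * E \<le> b * (1 + R) * E"
        using b nonneg by (intro mult_right_mono) (auto simp: algebra_simps)
      ultimately show ?thesis unfolding \<zeta>_split[OF u] by (simp add: algebra_simps)
    qed
    then have "\<bar>ar_res r \<zeta>' ?t\<bar> \<le> B * (b * (a + (1 + R) * E)) * l ^ nat (?t - 2 * ?K)"
      using n by (intro tail_\<zeta>) auto
    also have "\<dots> \<le> B * (b * (a + (1 + R) * E)) * (ln * l ^ k)"
    proof (rule mult_left_mono)
      show "l ^ nat (?t - 2 * ?K) \<le> ln * l ^ k"
        unfolding ln_def power_add[symmetric] using l n by (intro power_decreasing) auto
    qed (use B b nonneg in auto)
    finally have 1: "\<bar>ar_res r \<zeta>' ?t\<bar> \<le> b * (B * (a + (1 + R) * E) * ln) * l ^ k"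
      by (simp add: mult_ac)
    \<comment> \<open>The filter reaches values up to \<open>T\<close> only while k < K, and then
      l^k >= l^K; this is the origin of the division by l^K.\<close>
    have 2: "\<bar>ar_res r e' ?t\<bar> \<le> b * (R / l ^ CARD('k) * q) * l ^ k"
    proof -
      have "ar_res r e' ?t = - (r \<bullet> lag_vec e' ?t)" by (simp add: ar_res_def e'_def)
      then have "\<bar>ar_res r e' ?t\<bar> = \<bar>r \<bullet> lag_vec e' ?t\<bar>" by simp
      also have "\<dots> \<le> real CARD('k) * (2 ^ CARD('k) * b) * (q * (l ^ k / l ^ CARD('k)))"
      proof (rule inner_lag_vec_le[OF rb])
        fix u assume u: "?t - ?K \<le> u" "u < ?t"
        show "\<bar>e' u\<bar> \<le> q * (l ^ k / l ^ CARD('k))"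
        proof (cases "u \<le> T")
          case True
          then have "l ^ CARD('k) \<le> l ^ k" using u l by (intro power_decreasing) auto
          then have "q * 1 \<le> q * (l ^ k / l ^ CARD('k))" using l q(2) by (intro mult_left_mono) auto
          moreover have "\<bar>e' u\<bar> \<le> q" using True u n q(1)[of u] by (auto simp: e'_def)
          ultimately show ?thesis by linarith
        qed (use l q(2) in \<open>auto simp: e'_def\<close>)
      qed
      finally show ?thesis by (simp add: R field_simps)
    qed
    have "ar_res r s' ?t = ar_res r \<zeta>' ?t + ar_res r e' ?t"
      unfolding s'_def by (rule ar_res_add)
    then show ?thesis using 1 2 by (simp add: W_def algebra_simps)
  qed

  \<comment> \<open>Reflection gives b^2 rss(r') <= rss(r) + (b W / (1 - l))^2. As b >= 1, the first
    term on the right may be multiplied by b^2 too, and the uncontrolled factor b^2 cancels.\<close>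
  have gap: "rss T s r' \<le> rss T s r + (W / (1 - l))\<^sup>2"
  proof -
    have T1: "?K + 1 \<le> T + 1" using n K by linarith
    have "rss T s x = (\<Sum>t = ?K + 1..T. (ar_res x s' t)\<^sup>2)" for x :: "(real, 'k) vec"
      unfolding rss_def by (intro sum.cong) (auto simp: ar_s')
    then have split: "energy (?K + 1) (ar_res x s') = rss T s x + energy (T + 1) (ar_res x s')"
      if "sq_summable (ar_res x s')" for x :: "(real, 'k) vec"
      using energy_split[OF that T1] by simp
    have pos: "0 \<le> energy (T + 1) (ar_res r' s')"
      unfolding energy_def using sq_r'[OF sq_s'] by (intro suminf_nonneg) (auto simp: sq_summable_def)
    have sq_r: "sq_summable (ar_res r s')"
    proof (rule sq_summable_geometric[OF _ l])
      fix t assume "T < t"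
      then have "t = T + 1 + int (nat (t - T - 1))" "nat (t - T) = Suc (nat (t - T - 1))" by auto
      then show "\<bar>ar_res r s' t\<bar> \<le> (b * W / l) * l ^ nat (t - T)"
        using tail[of "nat (t - T - 1)"] l by simp
    qed
    have "b\<^sup>2 * rss T s r' \<le> b\<^sup>2 * energy (?K + 1) (ar_res r' s')"
      using split[OF sq_r'[OF sq_s']] pos by (intro mult_left_mono) auto
    also have "\<dots> \<le> energy (?K + 1) (ar_res r s')" by (rule energy_r'[OF sq_s'])
    also have "\<dots> \<le> rss T s r + (b * W / (1 - l))\<^sup>2"
      unfolding split[OF sq_r] using tail l by (intro add_left_mono energy_geometric_le)
    also have "\<dots> \<le> b\<^sup>2 * rss T s r + b\<^sup>2 * (W / (1 - l))\<^sup>2"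
    proof (intro add_mono)
      have "1 * rss T s r \<le> b\<^sup>2 * rss T s r"
        using b by (intro mult_right_mono rss_nonneg) (simp add: one_le_power)
      then show "rss T s r \<le> b\<^sup>2 * rss T s r" by simp
    qed (simp add: power_divide power_mult_distrib)
    finally have "b\<^sup>2 * rss T s r' \<le> b\<^sup>2 * (rss T s r + (W / (1 - l))\<^sup>2)" by (simp add: distrib_left)
    then show ?thesis using b by (simp add: mult_le_cancel_left)
  qed
  define D where "D = W / (1 - l)"
  have D: "0 \<le> D" "D \<le> c * Q"
    using W0 W_le l by (auto simp: D_def field_simps)
  have tK: "t \<in> {?K + 1..T}" using t n K by auto
  have part1: "\<bar>(r - r') \<bullet> lag_vec s t\<bar> \<le> D"
  proof -
    have "((r - r') \<bullet> lag_vec s t)\<^sup>2 \<le> D\<^sup>2"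
      using rss_gap[OF r tK, of r'] gap by (simp add: D_def)
    then show ?thesis using D(1) by (simp add: power2_le_iff_abs_le)
  qed
  have part2: "\<bar>(r' - \<rho>) \<bullet> lag_vec e t\<bar> \<le> 2 * R * q"
  proof -
    have "\<bar>(r' - \<rho>) $ j\<bar> \<le> 2 * 2 ^ CARD('k)" for j using r'[of j] \<rho>[of j] by simp
    then have "\<bar>(r' - \<rho>) \<bullet> lag_vec e t\<bar> \<le> real CARD('k) * (2 * 2 ^ CARD('k)) * q"
      using t by (intro inner_lag_vec_le q(1)) auto
    then show ?thesis by (simp add: R mult_ac)
  qed
  \<comment> \<open>The decay argument again, now for \<open>r'\<close>: by \<open>gap\<close> the
    root of its residual sum of squares is at most \<open>a + D\<close>.\<close>
  have part3: "\<bar>ar_res r' \<zeta>' t\<bar> \<le> B * (a + D + (1 + R) * E) * ln"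
  proof -
    have "\<bar>ar_res r' \<zeta>' u\<bar> \<le> a + D + (1 + R) * E" if "u \<in> {?K + 1..2 * ?K}" for u
    proof -
      have u: "u \<in> {?K + 1..T}" using that n by auto
      have "\<bar>ar_res r' s u\<bar> \<le> sqrt (rss T s r')" by (rule abs_ar_res_le_sqrt_rss[OF u])
      also have "\<dots> \<le> sqrt (rss T s r + D\<^sup>2)" using gap by (simp add: D_def)
      also have "\<dots> \<le> sqrt (rss T s r) + D"
        using sqrt_add_le_add_sqrt[OF rss_nonneg zero_le_power2] D(1) by (metis real_sqrt_abs abs_of_nonneg)
      also have "\<dots> \<le> a + D" using rss_r by simp
      finally have "\<bar>ar_res r' s u\<bar> \<le> a + D" .
      moreover have "\<bar>ar_res r' e u\<bar> \<le> (1 + R) * E" using e_le[OF r' u] by (simp add: R)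
      ultimately show ?thesis unfolding \<zeta>_split[OF u] by simp
    qed
    then have "\<bar>ar_res r' \<zeta>' t\<bar> \<le> B * (a + D + (1 + R) * E) * l ^ nat (t - 2 * ?K)"
      using n t by (intro tail_\<zeta>) auto
    also have "\<dots> \<le> B * (a + D + (1 + R) * E) * ln"
      unfolding ln_def using B nonneg D l t by (intro mult_left_mono power_decreasing) auto
    finally show ?thesis .
  qed
  \<comment> \<open>Three errors: between two nearly equal fits, of bounded coefficients on small
    values, and on the homogeneous part. The last is a residual of \<open>r'\<close> up to sign,
    because \<rho> predicts the homogeneous part exactly.\<close>
  have "(r - \<rho>) \<bullet> lag_vec s t
      = (r - r') \<bullet> lag_vec s t + (r' - \<rho>) \<bullet> lag_vec e t + (r' - \<rho>) \<bullet> lag_vec \<zeta>' t"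
  proof -
    have "(r' - \<rho>) \<bullet> lag_vec s t = (r' - \<rho>) \<bullet> lag_vec (\<lambda>t. e t + \<zeta>' t) t"
      using tK by (intro inner_lag_vec_cong) (auto simp: s \<zeta>'(1))
    then show ?thesis by (simp add: lag_vec_add inner_add_right inner_diff_left)
  qed
  moreover have "(r' - \<rho>) \<bullet> lag_vec \<zeta>' t = - ar_res r' \<zeta>' t"
    using homog'[of t] tK K by (simp add: ar_res_def inner_diff_left)
  ultimately have "\<bar>(r - \<rho>) \<bullet> lag_vec s t\<bar> \<le> D + 2 * R * q + B * (a + D + (1 + R) * E) * ln"
    using part1 part2 part3 by linarith
  also have "\<dots> \<le> c * Q + 2 * R * Q + B * (1 + R + c) * Q"
  proof (intro add_mono D)
    show "2 * R * q \<le> 2 * R * Q" using nonneg by (intro mult_left_mono) (auto simp: Q_eq)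
    have "ln * (a + E) \<le> Q" using q(2) by (simp add: Q_eq)
    moreover have "ln * (a + (1 + R) * E) \<le> (1 + R) * (ln * (a + E))"
      using nonneg by (simp add: algebra_simps)
    ultimately have "ln * (a + (1 + R) * E) \<le> (1 + R) * Q"
      using nonneg mult_left_mono[of "ln * (a + E)" Q "1 + R"] by linarith
    moreover have "ln * D \<le> 1 * (c * Q)" using nonneg D by (intro mult_mono) auto
    ultimately have "ln * (a + D + (1 + R) * E) \<le> (1 + R + c) * Q" by (simp add: algebra_simps)
    then have "B * (ln * (a + D + (1 + R) * E)) \<le> B * ((1 + R + c) * Q)"
      using B by (intro mult_left_mono) auto
    then show "B * (a + D + (1 + R) * E) * ln \<le> B * (1 + R + c) * Q" by (simp add: mult_ac)
  qed
  finally show ?thesis by (simp add: algebra_simps)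
qed

section \<open>Consistency of the coefficients when innovations are not small\<close>

text \<open>Near-diagonal quadratic form: of the diagonal only the term of the largest coefficient
  is kept. The off-diagonal terms cost at most K^2 \<theta> times its square times \<open>N\<close>,
  which uses up no more than half of that term.\<close>

lemma L2_set_inner_lag_vec_ge:
  fixes v :: "real ^ ('k::{finite,linorder})"
  assumes v: "\<And>j. \<bar>v $ j\<bar> \<le> \<bar>v $ i\<bar>"
    and diag: "2 * g\<^sup>2 * N \<le> (\<Sum>t\<in>A. (f (t - int (lag i)))\<^sup>2)"
    and off: "\<And>i j :: 'k. i \<noteq> j \<Longrightarrow> \<bar>\<Sum>t\<in>A. f (t - int (lag i)) * f (t - int (lag j))\<bar> \<le> \<theta> * N"
    and \<theta>: "(real CARD('k))\<^sup>2 * \<theta> \<le> g\<^sup>2" "0 \<le> \<theta>" and g: "0 \<le> g" and N: "0 \<le> N"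
  shows "g * \<bar>v $ i\<bar> * sqrt N \<le> L2_set (\<lambda>t. v \<bullet> lag_vec f t) A"
proof -
  define U where "U i j = (\<Sum>t\<in>A. f (t - int (lag i)) * f (t - int (lag j)))" for i j :: 'k
  let ?m = "\<bar>v $ i\<bar>"
  have "(\<Sum>t\<in>A. (v \<bullet> lag_vec f t)\<^sup>2)
      = (\<Sum>t\<in>A. \<Sum>a\<in>UNIV. \<Sum>b\<in>UNIV. v $ a * v $ b * (f (t - int (lag a)) * f (t - int (lag b))))"
    by (simp add: inner_lag_vec power2_eq_square sum_product mult_ac)
  also have "\<dots> = (\<Sum>a\<in>UNIV. \<Sum>b\<in>UNIV. v $ a * v $ b * U a b)"
    unfolding U_def sum_distrib_left
    by (subst sum.swap, rule sum.cong[OF refl], rule sum.swap)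
  also have "\<dots> \<ge> (\<Sum>a\<in>UNIV. \<Sum>b\<in>UNIV. (if a = b \<and> a = i then ?m\<^sup>2 * (2 * g\<^sup>2 * N) else 0) - ?m\<^sup>2 * (\<theta> * N))"
  proof (intro sum_mono)
    fix a b
    show "(if a = b \<and> a = i then ?m\<^sup>2 * (2 * g\<^sup>2 * N) else 0) - ?m\<^sup>2 * (\<theta> * N) \<le> v $ a * v $ b * U a b"
    proof (cases "a = b")
      case True
      have "0 \<le> v $ a * v $ b * U a b"
        using True by (auto simp: U_def sum_nonneg simp flip: power2_eq_square)
      moreover have "?m\<^sup>2 * (2 * g\<^sup>2 * N) \<le> v $ i * v $ i * U i i"
        using mult_left_mono[OF diag, of "?m\<^sup>2"] by (simp add: U_def power2_eq_square)
      moreover have "0 \<le> ?m\<^sup>2 * (\<theta> * N)" using \<theta> N by simp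
      ultimately show ?thesis using True by (smt (verit))
    next
      case False
      have "\<bar>v $ a * v $ b * U a b\<bar> \<le> (?m * ?m) * (\<theta> * N)"
        unfolding abs_mult using v off[OF False] \<theta> N by (intro mult_mono) (auto simp: U_def)
      then show ?thesis using False by (simp add: power2_eq_square)
    qed
  qed
  also have "(\<Sum>a\<in>UNIV. \<Sum>b\<in>UNIV. (if a = b \<and> a = i then ?m\<^sup>2 * (2 * g\<^sup>2 * N) else 0) - ?m\<^sup>2 * (\<theta> * N))
      = ?m\<^sup>2 * (2 * g\<^sup>2 * N) - (real CARD('k))\<^sup>2 * (?m\<^sup>2 * (\<theta> * N))"
  proof -
    have "(\<Sum>b\<in>UNIV. if a = b \<and> a = i then x else 0) = (if a = i then x else 0)" for a and x :: real
      by (cases "a = i") (auto simp: sum.delta')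
    then show ?thesis by (simp add: sum_subtractf sum.delta' power2_eq_square)
  qed
  finally have "?m\<^sup>2 * (2 * g\<^sup>2 * N) - (real CARD('k))\<^sup>2 * (?m\<^sup>2 * (\<theta> * N)) \<le> (\<Sum>t\<in>A. (v \<bullet> lag_vec f t)\<^sup>2)" .
  moreover have "(?m\<^sup>2 * N) * ((real CARD('k))\<^sup>2 * \<theta>) \<le> (?m\<^sup>2 * N) * g\<^sup>2"
    using \<theta>(1) N by (intro mult_left_mono) auto
  ultimately have "?m\<^sup>2 * N * g\<^sup>2 \<le> (\<Sum>t\<in>A. (v \<bullet> lag_vec f t)\<^sup>2)"
    by (simp add: algebra_simps)
  moreover have "(g * ?m * sqrt N)\<^sup>2 = ?m\<^sup>2 * N * g\<^sup>2"
    using N by (simp add: power_mult_distrib)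
  ultimately have "(g * ?m * sqrt N)\<^sup>2 \<le> (\<Sum>t\<in>A. (v \<bullet> lag_vec f t)\<^sup>2)"
    by (simp only:)
  then show ?thesis unfolding L2_set_def by (rule real_le_rsqrt)
qed

lemma abs_sum_mult_le: "\<bar>\<Sum>t\<in>A. f t * g t\<bar> \<le> L2_set f A * L2_set g A"
proof -
  have "\<bar>\<Sum>t\<in>A. f t * g t\<bar> \<le> (\<Sum>t\<in>A. \<bar>f t\<bar> * \<bar>g t\<bar>)"
    unfolding abs_mult[symmetric] by (rule sum_abs)
  also have "\<dots> \<le> L2_set f A * L2_set g A" by (rule L2_set_mult_ineq)
  finally show ?thesis .
qed

text \<open>The coefficient error is controlled through the innovations: filtering the fitted error by
  the true autoregression gives a combination of lagged innovations, whatever the initial values.\<close>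

lemma fitted_error_noisy:
  fixes r \<rho> :: "real ^ ('k::{finite,linorder})" and n T :: int
  assumes decays: "decays B l \<rho>" and B: "1 \<le> B" and l: "0 < l" "l < 1"
    and \<rho>: "\<And>j. \<bar>\<rho> $ j\<bar> \<le> 2 ^ CARD('k)"
    and n: "2 * int CARD('k) \<le> n" "n \<le> T"
    and homog: "\<And>t. 1 \<le> t \<Longrightarrow> t \<le> T \<Longrightarrow> ar_res \<rho> \<zeta> t = 0"
    and ar: "\<And>t. 1 \<le> t \<Longrightarrow> t \<le> T \<Longrightarrow> ar_res \<rho> e0 t = u t"
    and s: "\<And>t. 1 \<le> t \<Longrightarrow> t \<le> T \<Longrightarrow> s t = \<zeta> t + (e0 t - d t)"
    and r: "normal_solution T s r"
    and R: "R = real CARD('k) * 2 ^ CARD('k)"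
    and g: "0 < g" and \<theta>0: "0 \<le> \<theta>" and \<theta>1: "\<theta> \<le> 1" and H: "0 \<le> H"
    and \<theta>: "(real CARD('k))\<^sup>2 * \<theta> \<le> g\<^sup>2" "2 * (real CARD('k) * (1 + R) * \<theta>) \<le> g"
    and u_L2: "L2_set u {1..T} \<le> H * sqrt T"
    and e0_L2: "L2_set e0 {1..T} \<le> H * sqrt T"
    and d_L2: "L2_set d {1..T} \<le> \<theta> * sqrt T"
    and diag: "\<And>j :: 'k. 2 * g\<^sup>2 * T \<le> (\<Sum>t = 2 * int CARD('k) + 1..T. (u (t - int (lag j)))\<^sup>2)"
    and off: "\<And>i j :: 'k. i \<noteq> j \<Longrightarrow>
      \<bar>\<Sum>t = 2 * int CARD('k) + 1..T. u (t - int (lag i)) * u (t - int (lag j))\<bar> \<le> \<theta> * T"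
    and cross: "\<And>j :: 'k. \<bar>\<Sum>t = int CARD('k) + 1..T. u t * e0 (t - int (lag j))\<bar> \<le> \<theta> * T"
    and start: "(\<Sum>t = 1..T. l ^ nat t * \<bar>u t\<bar>) \<le> \<theta> * sqrt T"
    and e0_end: "\<And>t. n + 1 - int CARD('k) \<le> t \<Longrightarrow> t \<le> T \<Longrightarrow> \<bar>e0 t\<bar> \<le> H"
    and d_end: "\<And>t. n + 1 - int CARD('k) \<le> t \<Longrightarrow> t \<le> T \<Longrightarrow> \<bar>d t\<bar> \<le> \<theta>"
    and c1: "c1 = 2 * (1 + R) / g"
    and c3: "c3 = B * (1 + real CARD('k) * c1 * (H + 1)) / l ^ (2 * CARD('k))"
    and c4: "c4 = 1 + R + real CARD('k) * c1 + H * (real CARD('k) * c1) + c3"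
  shows "L2_set (\<lambda>t. (r - \<rho>) \<bullet> lag_vec s t) {int CARD('k) + 1..T} \<le> c4 * \<theta> * sqrt T"
    and "\<And>t. n < t \<Longrightarrow> t \<le> T \<Longrightarrow> \<bar>(r - \<rho>) \<bullet> lag_vec s t\<bar>
      \<le> real CARD('k) * c1 * (H + 1) * (c4 * \<theta>) + c3 * (c4 * \<theta> * sqrt T) * l ^ nat n"
proof -
  let ?k = "real CARD('k)" and ?K = "int CARD('k)" and ?I = "{int CARD('k) + 1..T}"
  define v where "v = r - \<rho>"
  define y where "y t = v \<bullet> lag_vec s t" for t
  define A where "A = L2_set y ?I"
  have K: "1 \<le> ?K" by (simp add: Suc_leI)
  have A0: "0 \<le> A" by (simp add: A_def L2_set_nonneg)
  have T: "0 < T" using n K by linarith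
  have R0: "0 \<le> R" by (simp add: R)
  have c0: "0 \<le> c1" using R0 g by (simp add: c1)
  then have c3_0: "0 \<le> c3" using B H l by (simp add: c3)
  obtain i where i: "\<And>j. \<bar>v $ j\<bar> \<le> \<bar>v $ i\<bar>"
  proof -
    have "Max (range (\<lambda>j. \<bar>v $ j\<bar>)) \<in> range (\<lambda>j. \<bar>v $ j\<bar>)" by (intro Max_in) auto
    then obtain i where "Max (range (\<lambda>j. \<bar>v $ j\<bar>)) = \<bar>v $ i\<bar>" by (rule imageE)
    then have "\<bar>v $ j\<bar> \<le> \<bar>v $ i\<bar>" for j by (metis Max_ge finite finite_imageI rangeI)
    then show ?thesis by (rule that)
  qed
  define m where "m = \<bar>v $ i\<bar>"
  have v: "\<bar>v $ j\<bar> \<le> m" for j unfolding m_def by (rule i)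
  have m0: "0 \<le> m" by (simp add: m_def)
  have ar_s: "ar_res \<rho> s t = u t - ar_res \<rho> d t" if "t \<in> ?I" for t
  proof -
    have "ar_res \<rho> s t = ar_res \<rho> (\<lambda>t. \<zeta> t + (e0 t - d t)) t"
      using that by (intro ar_res_cong s) auto
    then show ?thesis using that K homog[of t] ar[of t] by (simp add: ar_res_add ar_res_diff)
  qed
  have d_ar: "L2_set (ar_res \<rho> d) ?I \<le> (1 + R) * (\<theta> * sqrt T)"
  proof -
    have "L2_set (ar_res \<rho> d) ?I \<le> (1 + R) * L2_set d {1..T}"
      using L2_set_ar_res[OF \<rho>, of d "?K + 1" T] by (simp add: R)
    also have "\<dots> \<le> (1 + R) * (\<theta> * sqrt T)" using d_L2 R0 by (intro mult_left_mono) auto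
    finally show ?thesis .
  qed
  have d_lag: "L2_set (\<lambda>t. v \<bullet> lag_vec d t) ?I \<le> ?k * m * (\<theta> * sqrt T)"
  proof -
    have "L2_set (\<lambda>t. v \<bullet> lag_vec d t) ?I \<le> ?k * m * L2_set d {1..T}"
      using L2_set_inner_lag_vec[OF v, of d "?K + 1" T] by simp
    also have "\<dots> \<le> ?k * m * (\<theta> * sqrt T)" using d_L2 m0 by (intro mult_left_mono) auto
    finally show ?thesis .
  qed

  \<comment> \<open>The true filter maps the fitted error \<open>y\<close> to \<open>v\<close>
    applied to lagged innovations, up to the filtered \<open>d\<close>. The sum starts at 2K + 1
    since it takes K lags of residuals that exist from K + 1 on. The term with \<open>d\<close>
    carries the factor K (1 + R) \<theta> <= g / 2 and is absorbed on the left, whence the 2 in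
    \<open>c1\<close>.\<close>
  have m_le: "m * sqrt T \<le> c1 * A"
  proof -
    let ?J = "{2 * ?K + 1..T}"
    have "g * m * sqrt T \<le> L2_set (\<lambda>t. v \<bullet> lag_vec u t) ?J"
      unfolding m_def by (rule L2_set_inner_lag_vec_ge[OF i diag off]) (use \<theta> \<theta>0 g T in auto)
    also have "\<dots> = L2_set (\<lambda>t. ar_res \<rho> y t + v \<bullet> lag_vec (ar_res \<rho> d) t) ?J"
    proof (intro L2_set_cong refl)
      fix t assume t: "t \<in> ?J"
      have "v \<bullet> lag_vec u t = v \<bullet> lag_vec (\<lambda>t. ar_res \<rho> s t + ar_res \<rho> d t) t"
        using t by (intro inner_lag_vec_cong) (auto simp: ar_s)
      then show "v \<bullet> lag_vec u t = ar_res \<rho> y t + v \<bullet> lag_vec (ar_res \<rho> d) t"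
        by (simp add: y_def[abs_def] ar_res_inner_lag_vec lag_vec_add inner_add_right)
    qed
    also have "\<dots> \<le> L2_set (ar_res \<rho> y) ?J + L2_set (\<lambda>t. v \<bullet> lag_vec (ar_res \<rho> d) t) ?J"
      by (rule L2_set_triangle_ineq)
    also have "\<dots> \<le> (1 + R) * A + ?k * m * ((1 + R) * (\<theta> * sqrt T))"
    proof (intro add_mono)
      show "L2_set (ar_res \<rho> y) ?J \<le> (1 + R) * A"
        using L2_set_ar_res[OF \<rho>, of y "2 * ?K + 1" T] by (simp add: R A_def)
      have "L2_set (\<lambda>t. v \<bullet> lag_vec (ar_res \<rho> d) t) ?J \<le> ?k * m * L2_set (ar_res \<rho> d) ?I"
        using L2_set_inner_lag_vec[OF v, of "ar_res \<rho> d" "2 * ?K + 1" T] by simp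
      also have "\<dots> \<le> ?k * m * ((1 + R) * (\<theta> * sqrt T))"
        using d_ar m0 by (intro mult_left_mono) auto
      finally show "L2_set (\<lambda>t. v \<bullet> lag_vec (ar_res \<rho> d) t) ?J \<le> ?k * m * ((1 + R) * (\<theta> * sqrt T))" .
    qed
    also have "?k * m * ((1 + R) * (\<theta> * sqrt T)) = (?k * (1 + R) * \<theta>) * (m * sqrt T)" by simp
    also have "\<dots> \<le> g / 2 * (m * sqrt T)" using \<theta>(2) m0 T by (intro mult_right_mono) auto
    finally have "(m * sqrt T) * g \<le> 2 * (1 + R) * A" by (simp add: algebra_simps)
    then have "m * sqrt T \<le> 2 * (1 + R) * A / g" using g by (simp only: pos_le_divide_eq)
    then show ?thesis by (simp add: c1)
  qed

  define q where "q t = v \<bullet> lag_vec \<zeta> t" for t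
  have y_split: "y t = v \<bullet> lag_vec e0 t - v \<bullet> lag_vec d t + q t" if "t \<in> ?I" for t
  proof -
    have "y t = v \<bullet> lag_vec (\<lambda>t. \<zeta> t + (e0 t - d t)) t"
      unfolding y_def using that by (intro inner_lag_vec_cong s) auto
    then show ?thesis by (simp add: lag_vec_add lag_vec_diff inner_add_right inner_diff_right q_def)
  qed
  \<comment> \<open>The homogeneous contribution is what remains of the observable fitted error, at
    most \<open>A\<close>, after subtracting terms with coefficients at most \<open>m\<close>. It is
    thus bounded through \<open>A\<close> alone, without reference to the initial values.\<close>
  have q_start: "\<bar>q t\<bar> \<le> (1 + ?k * c1 * (H + 1)) * A" if "t \<in> {?K + 1..2 * ?K}" for t
  proof -
    have t: "t \<in> ?I" using that n by auto
    have "\<bar>v \<bullet> lag_vec (\<lambda>t. e0 t - d t) t\<bar> \<le> ?k * m * ((H + 1) * sqrt T)"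
    proof (rule inner_lag_vec_le[OF v])
      fix a assume a: "t - ?K \<le> a" "a < t"
      then have "a \<in> {1..T}" using t by auto
      then have "\<bar>e0 a\<bar> \<le> H * sqrt T" "\<bar>d a\<bar> \<le> \<theta> * sqrt T"
        using e0_L2 d_L2 abs_le_L2_set[of "{1..T}" a] by (meson finite_atLeastAtMost_int order.trans)+
      moreover have "\<theta> * sqrt T \<le> 1 * sqrt T" using \<theta>1 T by (intro mult_right_mono) auto
      ultimately show "\<bar>e0 a - d a\<bar> \<le> (H + 1) * sqrt T" by (simp add: algebra_simps)
    qed
    also have "\<dots> = ?k * (H + 1) * (m * sqrt T)" by simp
    also have "\<dots> \<le> ?k * (H + 1) * (c1 * A)" using m_le H by (intro mult_left_mono) auto
    finally have "\<bar>v \<bullet> lag_vec e0 t - v \<bullet> lag_vec d t\<bar> \<le> ?k * (H + 1) * (c1 * A)"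
      by (simp add: lag_vec_diff inner_diff_right)
    moreover have "\<bar>y t\<bar> \<le> A" unfolding A_def using t by (intro abs_le_L2_set) auto
    ultimately show ?thesis using y_split[OF t] by (simp add: algebra_simps)
  qed
  have q_le: "\<bar>q t\<bar> \<le> c3 * A * l ^ nat t" if "t \<in> ?I" for t
  proof -
    let ?M = "(1 + ?k * c1 * (H + 1)) * A"
    have M0: "0 \<le> ?M" using c0 H A0 by (intro mult_nonneg_nonneg add_nonneg_nonneg) auto
    have l_eq: "c3 * A * l ^ nat t = B * ?M * (l ^ nat t / l ^ (2 * CARD('k)))" by (simp add: c3)
    show ?thesis
    proof (cases "t \<le> 2 * ?K")
      case True
      then have "l ^ (2 * CARD('k)) \<le> l ^ nat t" using l by (intro power_decreasing) auto
      then have "1 * 1 \<le> B * (l ^ nat t / l ^ (2 * CARD('k)))" using B l by (intro mult_mono) auto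
      then have "?M * 1 \<le> ?M * (B * (l ^ nat t / l ^ (2 * CARD('k))))" using M0 by (intro mult_left_mono) auto
      then show ?thesis using q_start[of t] that True unfolding l_eq by (simp add: mult_ac)
    next
      case False
      have "ar_res \<rho> q a = 0" if "2 * ?K < a" "a \<le> t" for a
      proof -
        have "ar_res \<rho> q a = v \<bullet> lag_vec (ar_res \<rho> \<zeta>) a"
          unfolding q_def[abs_def] by (rule ar_res_inner_lag_vec)
        also have "\<dots> = v \<bullet> lag_vec (\<lambda>_. 0) a"
          using that \<open>t \<in> ?I\<close> by (intro inner_lag_vec_cong homog) auto
        finally show ?thesis by (simp add: inner_lag_vec)
      qed
      then have "\<bar>q t\<bar> \<le> B * ?M * l ^ nat (t - 2 * ?K)"
        using False q_start
        by (intro decays[unfolded decays_def, rule_format, where ?t0.0 = "2 * ?K" and ?t1.0 = t]) auto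
      also have "l ^ nat (t - 2 * ?K) = l ^ nat t / l ^ (2 * CARD('k))"
      proof -
        have "nat t = nat (t - 2 * ?K) + 2 * CARD('k)" using False by auto
        then show ?thesis using l by (simp add: power_add)
      qed
      finally show ?thesis unfolding l_eq .
    qed
  qed

  have A_le: "A \<le> c4 * \<theta> * sqrt T"
  proof -
    \<comment> \<open>Orthogonality of the residuals to the fitted error \<open>y\<close> expresses
      \<open>A\<close> squared by inner products of \<open>y\<close> with the innovations and the
      filtered \<open>d\<close>. Each piece turns out to be a constant times \<theta> sqrt T times
      \<open>A\<close>, so one factor \<open>A\<close> cancels; \<open>c4\<close> is the sum of the
      constants.\<close>
    have "0 = (\<Sum>t\<in>?I. ar_res r s t * y t)"
      using r unfolding normal_solution_def y_def by metis
    also have "\<dots> = (\<Sum>t\<in>?I. u t * y t - ar_res \<rho> d t * y t - (y t)\<^sup>2)"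
    proof (intro sum.cong refl)
      fix t assume "t \<in> ?I"
      have "ar_res r s t = ar_res \<rho> s t - y t"
        by (simp add: ar_res_def y_def v_def inner_diff_left)
      then have "ar_res r s t = u t - ar_res \<rho> d t - y t" using ar_s[OF \<open>t \<in> ?I\<close>] by simp
      then show "ar_res r s t * y t = u t * y t - ar_res \<rho> d t * y t - (y t)\<^sup>2"
        by (simp only: left_diff_distrib power2_eq_square)
    qed
    also have "\<dots> = (\<Sum>t\<in>?I. u t * y t) - (\<Sum>t\<in>?I. ar_res \<rho> d t * y t) - A\<^sup>2"
      by (simp add: sum_subtractf A_def L2_set_def sum_nonneg)
    finally have A_sq: "A\<^sup>2 = (\<Sum>t\<in>?I. u t * y t) - (\<Sum>t\<in>?I. ar_res \<rho> d t * y t)" by simp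
    have "\<bar>\<Sum>t\<in>?I. ar_res \<rho> d t * y t\<bar> \<le> (1 + R) * (\<theta> * sqrt T) * A"
      using abs_sum_mult_le[of "ar_res \<rho> d" y ?I] mult_right_mono[OF d_ar A0] by (simp add: A_def)
    moreover have "(\<Sum>t\<in>?I. u t * y t) = (\<Sum>t\<in>?I. u t * (v \<bullet> lag_vec e0 t))
        - (\<Sum>t\<in>?I. u t * (v \<bullet> lag_vec d t)) + (\<Sum>t\<in>?I. u t * q t)"
      unfolding sum.distrib[symmetric] sum_subtractf[symmetric]
      by (intro sum.cong refl) (simp only: y_split algebra_simps)
    moreover have "\<bar>\<Sum>t\<in>?I. u t * (v \<bullet> lag_vec e0 t)\<bar> \<le> ?k * c1 * (\<theta> * sqrt T) * A"
    proof -
      have "(\<Sum>t\<in>?I. u t * (v \<bullet> lag_vec e0 t)) = (\<Sum>j\<in>UNIV. v $ j * (\<Sum>t\<in>?I. u t * e0 (t - int (lag j))))"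
        unfolding inner_lag_vec sum_distrib_left by (subst sum.swap) (simp add: mult_ac)
      also have "\<bar>\<dots>\<bar> \<le> (\<Sum>j\<in>(UNIV :: 'k set). m * (\<theta> * T))"
        using v cross m0 by (intro order.trans[OF sum_abs] sum_mono) (auto simp: abs_mult intro!: mult_mono)
      also have "\<dots> = ?k * (\<theta> * sqrt T) * (m * sqrt T)" using T by (simp add: mult_ac)
      also have "\<dots> \<le> ?k * (\<theta> * sqrt T) * (c1 * A)"
        using \<theta>0 T by (intro mult_left_mono m_le) auto
      finally show ?thesis by (simp add: mult_ac)
    qed
    moreover have "\<bar>\<Sum>t\<in>?I. u t * (v \<bullet> lag_vec d t)\<bar> \<le> H * (?k * c1) * (\<theta> * sqrt T) * A"
    proof -
      have "L2_set u ?I \<le> H * sqrt T"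
        using K by (intro order.trans[OF L2_set_subset u_L2]) auto
      then have "\<bar>\<Sum>t\<in>?I. u t * (v \<bullet> lag_vec d t)\<bar> \<le> (H * sqrt T) * (?k * m * (\<theta> * sqrt T))"
        using H T d_lag by (intro order.trans[OF abs_sum_mult_le] mult_mono) (auto simp: L2_set_nonneg)
      also have "\<dots> = H * ?k * (\<theta> * sqrt T) * (m * sqrt T)" by simp
      also have "\<dots> \<le> H * ?k * (\<theta> * sqrt T) * (c1 * A)"
        using H \<theta>0 T by (intro mult_left_mono m_le) auto
      finally show ?thesis by (simp add: mult_ac)
    qed
    \<comment> \<open>\<open>q\<close> decays like l^t times a multiple of \<open>A\<close>, so
      innovations meet it only through the weighted sum in \<open>start\<close>.\<close>
    moreover have "\<bar>\<Sum>t\<in>?I. u t * q t\<bar> \<le> c3 * (\<theta> * sqrt T) * A"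
    proof -
      have "\<bar>\<Sum>t\<in>?I. u t * q t\<bar> \<le> (\<Sum>t\<in>?I. c3 * A * (l ^ nat t * \<bar>u t\<bar>))"
      proof (intro order.trans[OF sum_abs] sum_mono)
        fix t assume "t \<in> ?I"
        from mult_left_mono[OF q_le[OF this], of "\<bar>u t\<bar>"]
        show "\<bar>u t * q t\<bar> \<le> c3 * A * (l ^ nat t * \<bar>u t\<bar>)" by (simp add: abs_mult mult_ac)
      qed
      also have "\<dots> \<le> c3 * A * (\<Sum>t = 1..T. l ^ nat t * \<bar>u t\<bar>)"
        unfolding sum_distrib_left[symmetric] using c3_0 A0 l K
        by (intro mult_left_mono sum_mono2) auto
      also have "\<dots> \<le> c3 * A * (\<theta> * sqrt T)" using c3_0 A0 by (intro mult_left_mono start) auto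
      finally show ?thesis by (simp add: mult_ac)
    qed
    ultimately have "A * A \<le> (1 + R) * (\<theta> * sqrt T) * A + ?k * c1 * (\<theta> * sqrt T) * A
        + H * (?k * c1) * (\<theta> * sqrt T) * A + c3 * (\<theta> * sqrt T) * A"
      using A_sq unfolding power2_eq_square by linarith
    also have "\<dots> = (c4 * \<theta> * sqrt T) * A" by (simp add: c4 algebra_simps)
    finally have *: "A * A \<le> (c4 * \<theta> * sqrt T) * A" .
    have "0 \<le> c4 * \<theta> * sqrt T" using c0 c3_0 R0 H \<theta>0 T by (simp add: c4)
    with * A0 show ?thesis by (cases "A = 0") (auto simp: mult_le_cancel_right)
  qed
  then show "L2_set (\<lambda>t. (r - \<rho>) \<bullet> lag_vec s t) ?I \<le> c4 * \<theta> * sqrt T"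
    by (simp add: A_def y_def[abs_def] v_def)
  fix t assume t: "n < t" "t \<le> T"
  have tI: "t \<in> ?I" using t n K by auto
  have "c1 * A \<le> c1 * (c4 * \<theta> * sqrt T)" using A_le c0 by (rule mult_left_mono)
  with m_le have "m * sqrt T \<le> (c1 * (c4 * \<theta>)) * sqrt T" by simp
  then have m_small: "m \<le> c1 * (c4 * \<theta>)" using T by (simp add: mult_le_cancel_right)
  have "\<bar>v \<bullet> lag_vec (\<lambda>t. e0 t - d t) t\<bar> \<le> ?k * m * (H + 1)"
  proof (rule inner_lag_vec_le[OF v])
    fix a assume "t - ?K \<le> a" "a < t"
    then show "\<bar>e0 a - d a\<bar> \<le> H + 1" using e0_end[of a] d_end[of a] t \<theta>1 by auto
  qed
  also have "\<dots> \<le> ?k * (c1 * (c4 * \<theta>)) * (H + 1)"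
    using m_small H by (intro mult_right_mono mult_left_mono) auto
  finally have "\<bar>v \<bullet> lag_vec e0 t - v \<bullet> lag_vec d t\<bar> \<le> ?k * c1 * (H + 1) * (c4 * \<theta>)"
    by (simp add: lag_vec_diff inner_diff_right mult_ac)
  moreover have "\<bar>q t\<bar> \<le> c3 * (c4 * \<theta> * sqrt T) * l ^ nat n"
  proof -
    have "\<bar>q t\<bar> \<le> c3 * A * l ^ nat t" by (rule q_le[OF tI])
    also have "\<dots> \<le> c3 * (c4 * \<theta> * sqrt T) * l ^ nat n"
      using A_le A0 c3_0 l t n by (intro mult_mono mult_left_mono power_decreasing) auto
    finally show ?thesis .
  qed
  ultimately have "\<bar>y t\<bar> \<le> ?k * c1 * (H + 1) * (c4 * \<theta>) + c3 * (c4 * \<theta> * sqrt T) * l ^ nat n"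
    unfolding y_split[OF tI] by linarith
  then show "\<bar>(r - \<rho>) \<bullet> lag_vec s t\<bar>
      \<le> ?k * c1 * (H + 1) * (c4 * \<theta>) + c3 * (c4 * \<theta> * sqrt T) * l ^ nat n"
    by (simp add: y_def v_def)
qed

section \<open>Moments of the innovations\<close>

lemma sum_geometric_int_le:
  fixes l :: real
  assumes "finite A" "0 < l" "l < 1"
  shows "(\<Sum>s\<in>A. if 0 \<le> s then l ^ nat s else 0) \<le> 1 / (1 - l)"
proof -
  have "(\<Sum>s\<in>A. if 0 \<le> s then l ^ nat s else 0) = (\<Sum>s\<in>{s \<in> A. 0 \<le> s}. l ^ nat s)"
    using assms(1) by (simp add: sum.inter_filter)
  also have "\<dots> = (\<Sum>k\<in>nat ` {s \<in> A. 0 \<le> s}. l ^ k)"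
    by (subst sum.reindex) (auto intro!: inj_onI)
  also have "\<dots> \<le> (\<Sum>k. l ^ k)"
    using assms by (intro sum_le_suminf summable_geometric) auto
  finally show ?thesis using assms by (simp add: suminf_geometric)
qed

text \<open>The injective \<open>h\<close> allows one bound for the rows and the columns of the
  convolution matrix \<open>\<psi> (t - s)\<close>, and for shifts of the index.\<close>

lemma sum_decaying_le:
  fixes l :: real and \<psi> :: "int \<Rightarrow> real"
  assumes "0 < l" "l < 1" "0 \<le> B" "finite A" "inj_on h A"
    and "\<And>k. k < 0 \<Longrightarrow> \<psi> k = 0" "\<And>k. \<bar>\<psi> (int k)\<bar> \<le> B * l ^ k"
  shows "(\<Sum>s\<in>A. \<bar>\<psi> (h s)\<bar>) \<le> B / (1 - l)"
proof -
  have "\<bar>\<psi> k\<bar> \<le> B * (if 0 \<le> k then l ^ nat k else 0)" for k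
    using assms(6)[of k] assms(7)[of "nat k"] by auto
  then have "(\<Sum>s\<in>A. \<bar>\<psi> (h s)\<bar>) \<le> (\<Sum>s\<in>A. B * (if 0 \<le> h s then l ^ nat (h s) else 0))"
    by (intro sum_mono)
  also have "\<dots> = B * (\<Sum>k\<in>h ` A. if 0 \<le> k then l ^ nat k else 0)"
    using assms(5) by (simp add: sum.reindex sum_distrib_left)
  also have "\<dots> \<le> B * (1 / (1 - l))"
    using assms by (intro mult_left_mono sum_geometric_int_le) auto
  finally show ?thesis by simp
qed

text \<open>Writes a single factor as a product over the whole index set. Mixed moments then become
  products over all periods, to which independence of the entire family applies directly.\<close>

lemma prod_power_of_bool:
  fixes f :: "'b \<Rightarrow> 'c::comm_monoid_mult"
  assumes "finite A" "s \<in> A"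
  shows "(\<Prod>i\<in>A. f i ^ of_bool (i = s)) = f s"
proof -
  have "(\<Prod>i\<in>A. f i ^ of_bool (i = s)) = (\<Prod>i\<in>A. if i = s then f i else 1)"
    by (intro prod.cong) auto
  with assms show ?thesis by simp
qed

context prob_space
begin

lemma markov_prob:
  assumes "integrable M X" "\<And>w. 0 \<le> X w" "expectation X \<le> b" "0 < c"
  shows "prob {w \<in> space M. c < X w} \<le> b / c"
proof -
  have [measurable]: "random_variable borel X" using assms(1) by simp
  have "prob {w \<in> space M. c < X w} \<le> prob {w \<in> space M. c \<le> X w}"
    by (intro finite_measure_mono) auto
  also have "\<dots> \<le> expectation X / c"
    using assms by (intro integral_Markov_inequality_measure[where A = "{}"]) auto
  also have "\<dots> \<le> b / c" using assms by (intro divide_right_mono) auto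
  finally show ?thesis .
qed

text \<open>Orthogonality bounds the second moment of the sum by N c. The passage to the first
  moment uses |x| <= (x^2 / sqrt N + sqrt N) / 2, whose weights balance both terms at order sqrt
  N.\<close>

lemma orthogonal_sum:
  fixes W :: "'b \<Rightarrow> 'a \<Rightarrow> real"
  assumes int: "\<And>s t. s \<in> J \<Longrightarrow> t \<in> J \<Longrightarrow> integrable M (\<lambda>w. W s w * W t w)"
    and orth: "\<And>s t. s \<in> J \<Longrightarrow> t \<in> J \<Longrightarrow> s \<noteq> t \<Longrightarrow> expectation (\<lambda>w. W s w * W t w) = 0"
    and sq: "\<And>t. t \<in> J \<Longrightarrow> expectation (\<lambda>w. W t w * W t w) \<le> c"
    and rv: "\<And>t. t \<in> J \<Longrightarrow> random_variable borel (W t)"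
    and J: "finite J" "real (card J) \<le> N" and c: "0 \<le> c" and N: "0 < N"
  shows "integrable M (\<lambda>w. \<bar>\<Sum>t\<in>J. W t w\<bar>)"
    and "expectation (\<lambda>w. \<bar>\<Sum>t\<in>J. W t w\<bar>) \<le> sqrt N * ((c + 1) / 2)"
proof -
  let ?S = "\<lambda>w. \<Sum>t\<in>J. W t w"
  have sq_eq: "(?S w)\<^sup>2 = (\<Sum>s\<in>J. \<Sum>t\<in>J. W s w * W t w)" for w
    by (simp add: power2_eq_square sum_product)
  have int_sq: "integrable M (\<lambda>w. (?S w)\<^sup>2)"
    unfolding sq_eq using int by (intro Bochner_Integration.integrable_sum)
  have "expectation (\<lambda>w. (?S w)\<^sup>2) = (\<Sum>s\<in>J. \<Sum>t\<in>J. expectation (\<lambda>w. W s w * W t w))"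
    unfolding sq_eq using int by (simp add: Bochner_Integration.integral_sum)
  also have "\<dots> \<le> (\<Sum>s\<in>J. \<Sum>t\<in>J. if s = t then c else 0)"
    using orth sq by (intro sum_mono) auto
  also have "\<dots> = card J * c" using J(1) by simp
  also have "\<dots> \<le> N * c" using J(2) c by (intro mult_right_mono) auto
  finally have le: "expectation (\<lambda>w. (?S w)\<^sup>2) \<le> N * c" .
  have abs_le: "\<bar>x\<bar> \<le> (x\<^sup>2 / sqrt N + sqrt N) / 2" for x :: real
  proof -
    have "0 \<le> (\<bar>x\<bar> - sqrt N)\<^sup>2" by simp
    then have "2 * \<bar>x\<bar> * sqrt N \<le> x\<^sup>2 + N" using N by (simp add: power2_diff)
    then show ?thesis using N by (simp add: field_simps)
  qed
  have int_bound: "integrable M (\<lambda>w. ((?S w)\<^sup>2 / sqrt N + sqrt N) / 2)"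
    using int_sq by (intro integrable_divide Bochner_Integration.integrable_add) auto
  have [measurable]: "random_variable borel ?S" using rv by (intro borel_measurable_sum)
  show *: "integrable M (\<lambda>w. \<bar>?S w\<bar>)"
    by (rule Bochner_Integration.integrable_bound[OF int_bound])
       (use abs_le in \<open>auto intro: order.trans[OF _ abs_ge_self]\<close>)
  have "expectation (\<lambda>w. \<bar>?S w\<bar>) \<le> expectation (\<lambda>w. ((?S w)\<^sup>2 / sqrt N + sqrt N) / 2)"
    by (intro integral_mono * int_bound abs_le)
  also have "\<dots> = (expectation (\<lambda>w. (?S w)\<^sup>2) / sqrt N + sqrt N) / 2"
    using int_sq by (simp add: prob_space)
  also have "\<dots> \<le> (N * c / sqrt N + sqrt N) / 2"
    using le N by (intro divide_right_mono add_right_mono) auto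
  also have "\<dots> = (c * (N / sqrt N) + sqrt N) / 2" by simp
  also have "\<dots> = sqrt N * ((c + 1) / 2)"
    using N by (simp only: real_div_sqrt[OF less_imp_le]) (simp add: algebra_simps)
  finally show "expectation (\<lambda>w. \<bar>?S w\<bar>) \<le> sqrt N * ((c + 1) / 2)" .
qed

end

section \<open>Mixed moments of an i.i.d. sample\<close>

text \<open>A single sample size with its own probability space. The bounds below involve the
  distribution only through the variance and \<open>B4\<close>, hence become uniform in the sample
  size.\<close>

locale iid_innovations = prob_space +
  fixes u :: "int \<Rightarrow> 'a \<Rightarrow> real" and T :: int and B4 :: real
  assumes T: "1 \<le> T"
    and indep: "indep_vars (\<lambda>_. borel) u {1..T}"
    and ident: "\<And>t. t \<in> {1..T} \<Longrightarrow> distr M borel (u t) = distr M borel (u 1)"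
    and mean: "\<And>t. t \<in> {1..T} \<Longrightarrow> expectation (u t) = 0"
    and fourth: "integrable M (\<lambda>w. u 1 w ^ 4)" "expectation (\<lambda>w. u 1 w ^ 4) \<le> B4"
begin

definition var :: real where "var = expectation (\<lambda>w. (u 1 w)\<^sup>2)"

lemma rv_u [measurable (raw)]: "t \<in> {1..T} \<Longrightarrow> random_variable borel (u t)"
  using indep unfolding indep_vars_def2 by auto

lemma ident_moment:
  fixes f :: "real \<Rightarrow> real"
  assumes t: "t \<in> {1..T}" and [measurable]: "f \<in> borel_measurable borel"
  shows "integrable M (\<lambda>w. f (u t w)) \<longleftrightarrow> integrable M (\<lambda>w. f (u 1 w))"
    and "expectation (\<lambda>w. f (u t w)) = expectation (\<lambda>w. f (u 1 w))"
proof -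
  have 1: "1 \<in> {1..T}" using T by simp
  note [measurable] = rv_u[OF t] rv_u[OF 1]
  show "integrable M (\<lambda>w. f (u t w)) \<longleftrightarrow> integrable M (\<lambda>w. f (u 1 w))"
    using integrable_distr_eq[of "u t" M borel f] integrable_distr_eq[of "u 1" M borel f]
    by (simp add: ident[OF t])
  show "expectation (\<lambda>w. f (u t w)) = expectation (\<lambda>w. f (u 1 w))"
    using integral_distr[of "u t" M borel f] integral_distr[of "u 1" M borel f]
    by (simp add: ident[OF t])
qed

lemma integrable_u_power:
  assumes t: "t \<in> {1..T}" and k: "k \<le> 4"
  shows "integrable M (\<lambda>w. u t w ^ k)"
proof (rule Bochner_Integration.integrable_bound)
  note [measurable] = rv_u[OF t]
  show "integrable M (\<lambda>w. 1 + u t w ^ 4)"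
    using ident_moment(1)[OF t, of "\<lambda>x. x ^ 4"] fourth(1) by simp
  show "random_variable borel (\<lambda>w. u t w ^ k)" by measurable
  have "\<bar>x\<bar> ^ k \<le> 1 + x ^ 4" for x :: real
  proof (cases "\<bar>x\<bar> \<le> 1")
    case True
    then have "\<bar>x\<bar> ^ k \<le> 1" by (intro power_le_one) auto
    moreover have "0 \<le> x ^ 4" by simp
    ultimately show ?thesis by linarith
  next
    case False
    then have "\<bar>x\<bar> ^ k \<le> \<bar>x\<bar> ^ 4" using k by (intro power_increasing) auto
    then show ?thesis by simp
  qed
  then show "AE w in M. norm (u t w ^ k) \<le> norm (1 + u t w ^ 4)"
    by (auto simp: power_abs intro: order.trans[OF _ abs_ge_self])
qed

lemma expectation_u_sq: "t \<in> {1..T} \<Longrightarrow> expectation (\<lambda>w. (u t w)\<^sup>2) = var"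
  unfolding var_def by (rule ident_moment(2)) auto

lemma var_nonneg: "0 \<le> var"
  unfolding var_def by simp

lemma expectation_u_fourth: "t \<in> {1..T} \<Longrightarrow> expectation (\<lambda>w. u t w ^ 4) \<le> B4"
  using ident_moment(2)[of t "\<lambda>x. x ^ 4"] fourth(2) by simp

lemma var_le: "var \<le> 1 + B4"
proof -
  have 1: "1 \<in> {1..T}" using T by simp
  have "x\<^sup>2 \<le> 1 + x ^ 4" for x :: real
  proof -
    have "0 \<le> (x\<^sup>2 - 1)\<^sup>2" by simp
    then have "2 * x\<^sup>2 \<le> 1 + x ^ 4" by (simp add: power2_diff flip: power_mult)
    then show ?thesis using zero_le_power2[of x] by linarith
  qed
  then have "var \<le> expectation (\<lambda>w. 1 + u 1 w ^ 4)"
    unfolding var_def using integrable_u_power[OF 1] by (intro integral_mono) auto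
  also have "\<dots> \<le> 1 + B4" using integrable_u_power[OF 1, of 4] fourth(2) by (simp add: prob_space)
  finally show ?thesis .
qed

text \<open>The free parameter \<open>a\<close> stands in for the standard deviation, which may be
  0. It is set to 1 when any bound will do, and to a small value when the variance is below
  \<open>a\<close> squared.\<close>

lemma expectation_abs_u:
  assumes t: "t \<in> {1..T}" and a: "0 < a"
  shows "integrable M (\<lambda>w. \<bar>u t w\<bar>)" "expectation (\<lambda>w. \<bar>u t w\<bar>) \<le> (var / a + a) / 2"
proof -
  show *: "integrable M (\<lambda>w. \<bar>u t w\<bar>)" using integrable_u_power[OF t, of 1] by simp
  have abs_le: "\<bar>x\<bar> \<le> (x\<^sup>2 / a + a) / 2" for x :: real
  proof -
    have "0 \<le> (\<bar>x\<bar> - a)\<^sup>2" by simp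
    then have "2 * \<bar>x\<bar> * a \<le> x\<^sup>2 + a\<^sup>2" by (simp add: power2_diff)
    then show ?thesis using a by (simp add: field_simps power2_eq_square)
  qed
  have "expectation (\<lambda>w. \<bar>u t w\<bar>) \<le> expectation (\<lambda>w. ((u t w)\<^sup>2 / a + a) / 2)"
    using integrable_u_power[OF t, of 2] by (intro integral_mono * abs_le) auto
  also have "\<dots> = (var / a + a) / 2"
    using integrable_u_power[OF t, of 2] expectation_u_sq[OF t] by (simp add: prob_space)
  finally show "expectation (\<lambda>w. \<bar>u t w\<bar>) \<le> (var / a + a) / 2" .
qed

lemma expectation_product:
  fixes F :: "int \<Rightarrow> real \<Rightarrow> real"
  assumes "\<And>i. i \<in> {1..T} \<Longrightarrow> F i \<in> borel_measurable borel"
    and "\<And>i. i \<in> {1..T} \<Longrightarrow> integrable M (\<lambda>w. F i (u i w))"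
  shows "integrable M (\<lambda>w. \<Prod>i = 1..T. F i (u i w))"
    and "expectation (\<lambda>w. \<Prod>i = 1..T. F i (u i w)) = (\<Prod>i = 1..T. expectation (\<lambda>w. F i (u i w)))"
proof -
  have "indep_vars (\<lambda>_. borel) (\<lambda>i w. F i (u i w)) {1..T}"
    using indep assms(1) by (rule indep_vars_compose2)
  then show "integrable M (\<lambda>w. \<Prod>i = 1..T. F i (u i w))"
    and "expectation (\<lambda>w. \<Prod>i = 1..T. F i (u i w)) = (\<Prod>i = 1..T. expectation (\<lambda>w. F i (u i w)))"
    using assms(2) by (auto intro: indep_vars_integrable indep_vars_lebesgue_integral)
qed

text \<open>\<open>c i\<close> counts how often period i occurs among the four factors. If s < t,
  the latest period \<open>t\<close> occurs exactly once, so its mean 0 makes the product of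
  expectations vanish.\<close>

lemma lagged_products:
  assumes m: "1 \<le> m" and s: "m < s" "s \<le> T" and t: "m < t" "t \<le> T"
  shows "integrable M (\<lambda>w. u s w * u (s - m) w * (u t w * u (t - m) w))"
    and "s < t \<Longrightarrow> expectation (\<lambda>w. u s w * u (s - m) w * (u t w * u (t - m) w)) = 0"
proof -
  define c :: "int \<Rightarrow> nat" where
    "c i = of_bool (i = s) + of_bool (i = s - m) + (of_bool (i = t) + of_bool (i = t - m))" for i
  have prod: "u s w * u (s - m) w * (u t w * u (t - m) w) = (\<Prod>i = 1..T. u i w ^ c i)" for w
    using m s t unfolding c_def power_add prod.distrib by (simp add: prod_power_of_bool)
  have int: "integrable M (\<lambda>w. u i w ^ c i)" if "i \<in> {1..T}" for i
    using that by (intro integrable_u_power) (auto simp: c_def)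
  note * = expectation_product[of "\<lambda>i x. x ^ c i", OF _ int]
  show "integrable M (\<lambda>w. u s w * u (s - m) w * (u t w * u (t - m) w))"
    unfolding prod by (rule *(1)) auto
  assume "s < t"
  then have "c t = 1" using m by (simp add: c_def)
  then have "expectation (\<lambda>w. u t w ^ c t) = 0" using mean[of t] m t by simp
  then have "(\<Prod>i = 1..T. expectation (\<lambda>w. u i w ^ c i)) = 0"
    using m t by (intro prod_zero) auto
  then show "expectation (\<lambda>w. u s w * u (s - m) w * (u t w * u (t - m) w)) = 0"
    unfolding prod by (subst *(2)) auto
qed

lemma lagged_product_sq:
  assumes m: "1 \<le> m" and t: "m < t" "t \<le> T"
  shows "expectation (\<lambda>w. u t w * u (t - m) w * (u t w * u (t - m) w)) = var\<^sup>2"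
proof -
  let ?F = "\<lambda>i x. (x\<^sup>2) ^ of_bool (i = t) * (x\<^sup>2) ^ of_bool (i = t - m) :: real"
  have prod: "u t w * u (t - m) w * (u t w * u (t - m) w) = (\<Prod>i = 1..T. ?F i (u i w))" for w
    using m t unfolding prod.distrib by (simp add: prod_power_of_bool power2_eq_square mult_ac)
  have F: "?F i x = (if i = t \<or> i = t - m then x\<^sup>2 else 1)" for i x
    using m by auto
  have int: "integrable M (\<lambda>w. ?F i (u i w))" if "i \<in> {1..T}" for i
    unfolding F using integrable_u_power[OF that, of 2] by (cases "i = t \<or> i = t - m") simp_all
  have "expectation (\<lambda>w. ?F i (u i w)) = var ^ of_bool (i = t) * var ^ of_bool (i = t - m)" if "i \<in> {1..T}" for i
    using expectation_u_sq[OF that] m unfolding F by (auto simp: prob_space)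
  then have "expectation (\<lambda>w. \<Prod>i = 1..T. ?F i (u i w))
      = (\<Prod>i = 1..T. var ^ of_bool (i = t) * var ^ of_bool (i = t - m))"
    by (subst expectation_product[of ?F, OF _ int]) auto
  also have "\<dots> = var\<^sup>2"
    using m t prod_power_of_bool[of "{1..T}" t "\<lambda>_. var"] prod_power_of_bool[of "{1..T}" "t - m" "\<lambda>_. var"]
    unfolding prod.distrib by (simp add: power2_eq_square)
  finally show ?thesis unfolding prod .
qed

lemma autocovariance:
  assumes m: "1 \<le> m" and J: "J \<subseteq> {m + 1..T}"
  shows "integrable M (\<lambda>w. \<bar>\<Sum>t\<in>J. u t w * u (t - m) w\<bar>)"
    and "expectation (\<lambda>w. \<bar>\<Sum>t\<in>J. u t w * u (t - m) w\<bar>) \<le> sqrt T * ((var\<^sup>2 + 1) / 2)"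
proof -
  have fin: "finite J" using J finite_subset by blast
  have "card J \<le> card {1..T}" using J m by (intro card_mono) auto
  then have card: "real (card J) \<le> T" using T by simp
  have in_J: "m < t \<and> t \<le> T" if "t \<in> J" for t using that J by auto
  have rv: "random_variable borel (\<lambda>w. u t w * u (t - m) w)" if "t \<in> J" for t
    using in_J[OF that] m by (intro borel_measurable_times rv_u) auto
  have orth: "expectation (\<lambda>w. u s w * u (s - m) w * (u t w * u (t - m) w)) = 0"
    if "s \<in> J" "t \<in> J" "s \<noteq> t" for s t
    using lagged_products(2)[OF m, of s t] lagged_products(2)[OF m, of t s] in_J that
    by (cases "s < t") (auto simp: mult_ac)
  show "integrable M (\<lambda>w. \<bar>\<Sum>t\<in>J. u t w * u (t - m) w\<bar>)"
    and "expectation (\<lambda>w. \<bar>\<Sum>t\<in>J. u t w * u (t - m) w\<bar>) \<le> sqrt T * ((var\<^sup>2 + 1) / 2)"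
    by (rule orthogonal_sum[where W = "\<lambda>t w. u t w * u (t - m) w" and c = "var\<^sup>2", OF _ orth _ rv fin card];
        use in_J m T in \<open>auto simp: lagged_product_sq intro!: lagged_products(1)\<close>)+
qed

text \<open>Centred squares of distinct periods are orthogonal, and their second moment is the
  fourth moment minus the squared variance; here \<open>B4\<close> gives the rate sqrt T.\<close>

lemma sq_deviation:
  assumes J: "J \<subseteq> {1..T}"
  shows "integrable M (\<lambda>w. \<bar>\<Sum>t\<in>J. (u t w)\<^sup>2 - var\<bar>)"
    and "expectation (\<lambda>w. \<bar>\<Sum>t\<in>J. (u t w)\<^sup>2 - var\<bar>) \<le> sqrt T * ((B4 + 1) / 2)"
proof -
  let ?W = "\<lambda>t w. (u t w)\<^sup>2 - var"
  have fin: "finite J" using J finite_subset by blast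
  have "card J \<le> card {1..T}" using J by (intro card_mono) auto
  then have card: "real (card J) \<le> T" using T by simp
  have rv: "random_variable borel (?W t)" if "t \<in> J" for t
    using rv_u[of t] that J by auto
  have W_sq: "?W t w * ?W t w = u t w ^ 4 - 2 * var * (u t w)\<^sup>2 + var\<^sup>2" for t w
    by (simp add: algebra_simps power2_eq_square power4_eq_xxxx)
  have int_sq: "integrable M (\<lambda>w. ?W t w * ?W t w)" if "t \<in> {1..T}" for t
    unfolding W_sq using integrable_u_power[OF that] by simp
  have W: "integrable M (?W t)" "expectation (?W t) = 0" if "t \<in> {1..T}" for t
    using integrable_u_power[OF that, of 2] expectation_u_sq[OF that] by (auto simp: prob_space)
  have pair: "integrable M (\<lambda>w. ?W s w * ?W t w) \<and> expectation (\<lambda>w. ?W s w * ?W t w) = 0"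
    if s: "s \<in> {1..T}" and t: "t \<in> {1..T}" and "s \<noteq> t" for s t
  proof -
    let ?F = "\<lambda>i x. (x\<^sup>2 - var) ^ of_bool (i = s) * (x\<^sup>2 - var) ^ of_bool (i = t)"
    have prod: "?W s w * ?W t w = (\<Prod>i = 1..T. ?F i (u i w))" for w
      using s t unfolding prod.distrib by (simp add: prod_power_of_bool)
    have F: "?F i x = (if i = s \<or> i = t then x\<^sup>2 - var else 1)" for i x
      using that by auto
    have int: "integrable M (\<lambda>w. ?F i (u i w))" if "i \<in> {1..T}" for i
      unfolding F using W(1)[OF that] by (cases "i = s \<or> i = t") (simp_all only: if_True if_False integrable_const)
    note * = expectation_product[of ?F, OF _ int]
    have zero: "expectation (\<lambda>w. ?F s (u s w)) = 0" unfolding F using W(2)[OF s] by simp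
    have "(\<Prod>i = 1..T. expectation (\<lambda>w. ?F i (u i w))) = 0"
    proof (rule prod_zero)
      show "\<exists>i\<in>{1..T}. expectation (\<lambda>w. ?F i (u i w)) = 0" using s by (rule bexI[rotated]) (rule zero)
    qed simp
    then show ?thesis unfolding prod using * by simp
  qed
  have sq: "expectation (\<lambda>w. ?W t w * ?W t w) \<le> B4" if "t \<in> {1..T}" for t
  proof -
    have "expectation (\<lambda>w. ?W t w * ?W t w)
        = expectation (\<lambda>w. u t w ^ 4) - 2 * var * expectation (\<lambda>w. (u t w)\<^sup>2) + var\<^sup>2"
      unfolding W_sq using integrable_u_power[OF that] by (simp add: prob_space)
    also have "\<dots> = expectation (\<lambda>w. u t w ^ 4) - var\<^sup>2"
      unfolding expectation_u_sq[OF that] by (simp add: power2_eq_square)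
    finally have "expectation (\<lambda>w. ?W t w * ?W t w) = expectation (\<lambda>w. u t w ^ 4) - var\<^sup>2" .
    then show ?thesis using expectation_u_fourth[OF that] zero_le_power2[of var] by linarith
  qed
  have int: "integrable M (\<lambda>w. ?W s w * ?W t w)" if "s \<in> J" "t \<in> J" for s t
    using that int_sq[OF subsetD[OF J]] pair[OF subsetD[OF J] subsetD[OF J]] by (cases "s = t") auto
  have orth: "expectation (\<lambda>w. ?W s w * ?W t w) = 0" if "s \<in> J" "t \<in> J" "s \<noteq> t" for s t
    using that pair[OF subsetD[OF J] subsetD[OF J]] by auto
  have "0 \<le> expectation (\<lambda>w. u 1 w ^ 4)" by simp
  then have B4: "0 \<le> B4" using fourth(2) by linarith
  show "integrable M (\<lambda>w. \<bar>\<Sum>t\<in>J. (u t w)\<^sup>2 - var\<bar>)"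
    and "expectation (\<lambda>w. \<bar>\<Sum>t\<in>J. (u t w)\<^sup>2 - var\<bar>) \<le> sqrt T * ((B4 + 1) / 2)"
    by (rule orthogonal_sum[where W = ?W and c = B4, OF int orth _ rv fin card]; use sq J B4 T in auto)+
qed

lemma expectation_sum_sq:
  "integrable M (\<lambda>w. \<Sum>t = 1..T. (u t w)\<^sup>2)"
  "expectation (\<lambda>w. \<Sum>t = 1..T. (u t w)\<^sup>2) = T * var"
proof -
  have int: "integrable M (\<lambda>w. (u t w)\<^sup>2)" if "t \<in> {1..T}" for t
    using integrable_u_power[OF that, of 2] by simp
  then show "integrable M (\<lambda>w. \<Sum>t = 1..T. (u t w)\<^sup>2)"
    by (intro Bochner_Integration.integrable_sum)
  have "expectation (\<lambda>w. \<Sum>t = 1..T. (u t w)\<^sup>2) = (\<Sum>t = 1..T. expectation (\<lambda>w. (u t w)\<^sup>2))"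
    using int by (intro Bochner_Integration.integral_sum)
  also have "\<dots> = (\<Sum>t = 1..T. var)" by (intro sum.cong refl expectation_u_sq)
  finally show "expectation (\<lambda>w. \<Sum>t = 1..T. (u t w)\<^sup>2) = T * var" using T by simp
qed

lemma weighted_abs_sum:
  assumes "\<And>t. t \<in> {1..T} \<Longrightarrow> 0 \<le> y t" "(\<Sum>t = 1..T. y t) \<le> b" and a: "0 < a"
  shows "integrable M (\<lambda>w. \<Sum>t = 1..T. y t * \<bar>u t w\<bar>)"
    and "expectation (\<lambda>w. \<Sum>t = 1..T. y t * \<bar>u t w\<bar>) \<le> b * ((var / a + a) / 2)"
proof -
  have int: "integrable M (\<lambda>w. y t * \<bar>u t w\<bar>)" if "t \<in> {1..T}" for t
    using expectation_abs_u(1)[OF that a] by simp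
  then show "integrable M (\<lambda>w. \<Sum>t = 1..T. y t * \<bar>u t w\<bar>)"
    by (intro Bochner_Integration.integrable_sum)
  have "expectation (\<lambda>w. \<Sum>t = 1..T. y t * \<bar>u t w\<bar>) = (\<Sum>t = 1..T. y t * expectation (\<lambda>w. \<bar>u t w\<bar>))"
    using int by (subst Bochner_Integration.integral_sum) auto
  also have "\<dots> \<le> (\<Sum>t = 1..T. y t * ((var / a + a) / 2))"
    using assms(1) expectation_abs_u(2)[OF _ a] by (intro sum_mono mult_left_mono) auto
  also have "\<dots> \<le> b * ((var / a + a) / 2)"
    unfolding sum_distrib_right[symmetric] using assms(2) var_nonneg a by (intro mult_right_mono) auto
  finally show "expectation (\<lambda>w. \<Sum>t = 1..T. y t * \<bar>u t w\<bar>) \<le> b * ((var / a + a) / 2)" .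
qed

section \<open>Moving averages of the innovations\<close>

text \<open>The sum runs over the whole sample; for causal \<psi> future terms vanish. With the
  impulse response as \<psi> this is the autoregression with zero initial values.\<close>

definition moving_avg :: "(int \<Rightarrow> real) \<Rightarrow> int \<Rightarrow> 'a \<Rightarrow> real" where
  "moving_avg \<psi> t w = (\<Sum>s = 1..T. \<psi> (t - s) * u s w)"

lemma rv_moving_avg [measurable]: "random_variable borel (moving_avg \<psi> t)"
  unfolding moving_avg_def by (intro borel_measurable_sum borel_measurable_times borel_measurable_const rv_u)

context
  fixes \<psi> :: "int \<Rightarrow> real" and B l :: real
  assumes \<psi>_neg: "\<And>k. k < 0 \<Longrightarrow> \<psi> k = 0" and \<psi>: "\<And>k. \<bar>\<psi> (int k)\<bar> \<le> B * l ^ k"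
    and l: "0 < l" "l < 1" and B: "0 \<le> B"
begin

lemma moving_avg_abs:
  assumes a: "0 < a"
  shows "integrable M (\<lambda>w. \<bar>moving_avg \<psi> t w\<bar>)"
    and "expectation (\<lambda>w. \<bar>moving_avg \<psi> t w\<bar>) \<le> B / (1 - l) * ((var / a + a) / 2)"
proof -
  have y: "(\<Sum>s = 1..T. \<bar>\<psi> (t - s)\<bar>) \<le> B / (1 - l)"
    by (rule sum_decaying_le[OF l B _ _ \<psi>_neg \<psi>]) (auto intro: inj_onI)
  have int: "integrable M (\<lambda>w. \<Sum>s = 1..T. \<bar>\<psi> (t - s)\<bar> * \<bar>u s w\<bar>)"
    and le: "expectation (\<lambda>w. \<Sum>s = 1..T. \<bar>\<psi> (t - s)\<bar> * \<bar>u s w\<bar>) \<le> B / (1 - l) * ((var / a + a) / 2)"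
    using weighted_abs_sum[OF _ y a] by auto
  have abs: "\<bar>moving_avg \<psi> t w\<bar> \<le> (\<Sum>s = 1..T. \<bar>\<psi> (t - s)\<bar> * \<bar>u s w\<bar>)" for w
    unfolding moving_avg_def by (intro order.trans[OF sum_abs] sum_mono) (simp add: abs_mult)
  show "integrable M (\<lambda>w. \<bar>moving_avg \<psi> t w\<bar>)"
    by (rule Bochner_Integration.integrable_bound[OF int])
       (use abs in \<open>auto intro: order.trans[OF _ abs_ge_self]\<close>)
  then have "expectation (\<lambda>w. \<bar>moving_avg \<psi> t w\<bar>)
      \<le> expectation (\<lambda>w. \<Sum>s = 1..T. \<bar>\<psi> (t - s)\<bar> * \<bar>u s w\<bar>)"
    by (intro integral_mono int abs)
  with le show "expectation (\<lambda>w. \<bar>moving_avg \<psi> t w\<bar>) \<le> B / (1 - l) * ((var / a + a) / 2)" by linarith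
qed

text \<open>Young's convolution inequality by the Schur test: Cauchy-Schwarz with weights |\<psi>(t
  - s)|, whose row and column sums are both at most B / (1 - l).\<close>

lemma moving_avg_L2: "L2_set (\<lambda>t. moving_avg \<psi> t w) {1..T} \<le> B / (1 - l) * L2_set (\<lambda>t. u t w) {1..T}"
proof -
  define b where "b = B / (1 - l)"
  have b: "0 \<le> b" using B l by (simp add: b_def)
  note \<psi>_sum = sum_decaying_le[OF l B _ _ \<psi>_neg \<psi>, folded b_def]
  have "(moving_avg \<psi> t w)\<^sup>2 \<le> b * (\<Sum>s = 1..T. \<bar>\<psi> (t - s)\<bar> * (u s w)\<^sup>2)" for t
  proof -
    let ?f = "\<lambda>s. sqrt \<bar>\<psi> (t - s)\<bar>" and ?g = "\<lambda>s. sqrt \<bar>\<psi> (t - s)\<bar> * \<bar>u s w\<bar>"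
    have "\<bar>moving_avg \<psi> t w\<bar> \<le> (\<Sum>s = 1..T. \<bar>?f s\<bar> * \<bar>?g s\<bar>)"
      unfolding moving_avg_def
      by (intro order.trans[OF sum_abs] sum_mono) (simp add: abs_mult flip: mult.assoc)
    also have "\<dots> \<le> L2_set ?f {1..T} * L2_set ?g {1..T}" by (rule L2_set_mult_ineq)
    finally have "(moving_avg \<psi> t w)\<^sup>2 \<le> (L2_set ?f {1..T} * L2_set ?g {1..T})\<^sup>2"
      by (rule power2_le_iff_abs_le[THEN iffD2, rotated]) (simp add: L2_set_nonneg)
    also have "\<dots> = (\<Sum>s = 1..T. \<bar>\<psi> (t - s)\<bar>) * (\<Sum>s = 1..T. \<bar>\<psi> (t - s)\<bar> * (u s w)\<^sup>2)"
      by (simp add: power_mult_distrib L2_set_def sum_nonneg)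
    also have "\<dots> \<le> b * (\<Sum>s = 1..T. \<bar>\<psi> (t - s)\<bar> * (u s w)\<^sup>2)"
      by (intro mult_right_mono \<psi>_sum) (auto intro: inj_onI sum_nonneg)
    finally show ?thesis .
  qed
  then have "(\<Sum>t = 1..T. (moving_avg \<psi> t w)\<^sup>2) \<le> (\<Sum>t = 1..T. b * (\<Sum>s = 1..T. \<bar>\<psi> (t - s)\<bar> * (u s w)\<^sup>2))"
    by (intro sum_mono)
  also have "\<dots> = b * (\<Sum>s = 1..T. (\<Sum>t = 1..T. \<bar>\<psi> (t - s)\<bar>) * (u s w)\<^sup>2)"
    unfolding sum_distrib_left[symmetric] sum_distrib_right by (subst sum.swap) simp
  also have "\<dots> \<le> b * (\<Sum>s = 1..T. b * (u s w)\<^sup>2)"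
    using b by (intro mult_left_mono sum_mono mult_right_mono \<psi>_sum)
      (auto intro: inj_onI)
  also have "\<dots> = (b * L2_set (\<lambda>t. u t w) {1..T})\<^sup>2"
    by (simp add: L2_set_def power_mult_distrib sum_nonneg power2_eq_square[of b] mult.assoc flip: sum_distrib_left)
  finally have "L2_set (\<lambda>t. moving_avg \<psi> t w) {1..T} \<le> sqrt ((b * L2_set (\<lambda>t. u t w) {1..T})\<^sup>2)"
    unfolding L2_set_def[of "\<lambda>t. moving_avg \<psi> t w"] by (rule real_sqrt_le_mono)
  also have "\<dots> = b * L2_set (\<lambda>t. u t w) {1..T}"
    using b by (simp add: L2_set_nonneg)
  finally show ?thesis by (simp add: b_def)
qed

text \<open>Regrouping by the distance m between the two innovations gives the sum of \<psi>(m - j)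
  times the empirical autocovariance at lag m. Since j >= 1, causality of \<psi> leaves only m >= 1,
  where autocovariances are of order sqrt T, and the weights are summable.\<close>

lemma moving_avg_cross:
  assumes j: "1 \<le> j" and k: "0 \<le> k"
  shows "integrable M (\<lambda>w. \<bar>\<Sum>t = k + 1..T. u t w * moving_avg \<psi> (t - j) w\<bar>)"
    and "expectation (\<lambda>w. \<bar>\<Sum>t = k + 1..T. u t w * moving_avg \<psi> (t - j) w\<bar>)
      \<le> B / (1 - l) * (sqrt T * ((var\<^sup>2 + 1) / 2))"
proof -
  let ?c = "sqrt T * ((var\<^sup>2 + 1) / 2)"
  let ?J = "\<lambda>m. {t \<in> {k + 1..T}. m < t}"
  let ?S = "\<lambda>m w. \<Sum>t\<in>?J m. u t w * u (t - m) w"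
  have "moving_avg \<psi> (t - j) w = (\<Sum>m = 1..T. \<psi> (m - j) * (if m < t then u (t - m) w else 0))"
    if t: "t \<in> {k + 1..T}" for t w
  proof -
    have "moving_avg \<psi> (t - j) w = (\<Sum>s\<in>{1..t - 1}. \<psi> (t - j - s) * u s w)"
      unfolding moving_avg_def using t j by (intro sum.mono_neutral_right) (auto intro: \<psi>_neg)
    also have "\<dots> = (\<Sum>m\<in>{1..t - 1}. \<psi> (m - j) * u (t - m) w)"
      by (rule sum.reindex_bij_witness[of _ "\<lambda>m. t - m" "\<lambda>s. t - s"]) (auto simp: diff_diff_eq add.commute)
    also have "\<dots> = (\<Sum>m = 1..T. \<psi> (m - j) * (if m < t then u (t - m) w else 0))"
      using t by (intro sum.mono_neutral_cong_left) auto
    finally show ?thesis .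
  qed
  then have "(\<Sum>t = k + 1..T. u t w * moving_avg \<psi> (t - j) w)
      = (\<Sum>t = k + 1..T. \<Sum>m = 1..T. \<psi> (m - j) * (if m < t then u t w * u (t - m) w else 0))" for w
    by (intro sum.cong refl) (auto simp: sum_distrib_left intro!: sum.cong)
  then have eq: "(\<Sum>t = k + 1..T. u t w * moving_avg \<psi> (t - j) w) = (\<Sum>m = 1..T. \<psi> (m - j) * ?S m w)" for w
    by (subst (asm) sum.swap) (simp only: sum.inter_filter finite_atLeastAtMost_int sum_distrib_left)
  have S: "integrable M (\<lambda>w. \<bar>?S m w\<bar>)" "expectation (\<lambda>w. \<bar>?S m w\<bar>) \<le> ?c" if "m \<in> {1..T}" for m
  proof -
    have "1 \<le> m" "?J m \<subseteq> {m + 1..T}" using that by auto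
    then show "integrable M (\<lambda>w. \<bar>?S m w\<bar>)" "expectation (\<lambda>w. \<bar>?S m w\<bar>) \<le> ?c"
      by (rule autocovariance)+
  qed
  have int: "integrable M (\<lambda>w. \<Sum>m = 1..T. \<bar>\<psi> (m - j)\<bar> * \<bar>?S m w\<bar>)"
    using S(1) by (intro Bochner_Integration.integrable_sum integrable_mult_right)
  have abs: "\<bar>\<Sum>t = k + 1..T. u t w * moving_avg \<psi> (t - j) w\<bar> \<le> (\<Sum>m = 1..T. \<bar>\<psi> (m - j)\<bar> * \<bar>?S m w\<bar>)" for w
    unfolding eq by (intro order.trans[OF sum_abs] sum_mono) (simp add: abs_mult)
  have rv: "random_variable borel (\<lambda>w. \<bar>\<Sum>t = k + 1..T. u t w * moving_avg \<psi> (t - j) w\<bar>)"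
    using k by (intro borel_measurable_abs borel_measurable_sum borel_measurable_times rv_u rv_moving_avg) auto
  show *: "integrable M (\<lambda>w. \<bar>\<Sum>t = k + 1..T. u t w * moving_avg \<psi> (t - j) w\<bar>)"
    by (rule Bochner_Integration.integrable_bound[OF int rv])
       (use abs in \<open>auto intro: order.trans[OF _ abs_ge_self]\<close>)
  have "expectation (\<lambda>w. \<bar>\<Sum>t = k + 1..T. u t w * moving_avg \<psi> (t - j) w\<bar>)
      \<le> expectation (\<lambda>w. \<Sum>m = 1..T. \<bar>\<psi> (m - j)\<bar> * \<bar>?S m w\<bar>)"
    by (intro integral_mono * int abs)
  also have "\<dots> = (\<Sum>m = 1..T. \<bar>\<psi> (m - j)\<bar> * expectation (\<lambda>w. \<bar>?S m w\<bar>))"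
    using S(1) by (subst Bochner_Integration.integral_sum) (auto intro!: integrable_mult_right)
  also have "\<dots> \<le> (\<Sum>m = 1..T. \<bar>\<psi> (m - j)\<bar> * ?c)"
    using S(2) by (intro sum_mono mult_left_mono) auto
  also have "\<dots> \<le> B / (1 - l) * ?c"
    unfolding sum_distrib_right[symmetric] using T
    by (intro mult_right_mono sum_decaying_le[OF l B _ _ \<psi>_neg \<psi>]) (auto intro: inj_onI)
  finally show "expectation (\<lambda>w. \<bar>\<Sum>t = k + 1..T. u t w * moving_avg \<psi> (t - j) w\<bar>) \<le> B / (1 - l) * ?c" .
qed

end

end

section \<open>Measurability of fitted values\<close>

lemma continuous_on_rss: "continuous_on UNIV (\<lambda>v :: real ^ ('k::{finite,linorder}). rss T e v)"
  unfolding rss_def ar_res_def by (intro continuous_intros)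

text \<open>The coefficients need not depend measurably on the sample where the Gram matrix is singular,
  but fitted values do: they are the limits of \<open>v \<bullet> lag_vec e t\<close> along any
  minimizing sequence \<open>v\<close> of the residual sum of squares, which may be taken from a countable dense set.\<close>

lemma fitted_value_less_iff:
  fixes r :: "real ^ ('k::{finite,linorder})"
  assumes r: "normal_solution T e r" and t: "t \<in> {int CARD('k) + 1..T}"
    and D: "\<And>U :: (real, 'k) vec set. open U \<Longrightarrow> U \<noteq> {} \<Longrightarrow> \<exists>v\<in>D. v \<in> U"
  shows "r \<bullet> lag_vec e t < c \<longleftrightarrow> (\<exists>c'\<in>\<rat>. c' < c \<and> (\<forall>m::nat. \<exists>v\<in>D.
    v \<bullet> lag_vec e t < c' \<and> (\<forall>w\<in>D. rss T e v \<le> rss T e w + inverse (real (Suc m)))))"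
    (is "_ \<longleftrightarrow> ?R")
proof
  have near: "\<exists>v\<in>D. v \<in> S \<and> rss T e v < rss T e r + \<epsilon>" if "open S" "r \<in> S" "0 < \<epsilon>" for S \<epsilon>
  proof -
    have "open ((\<lambda>v. rss T e v) -` {..<rss T e r + \<epsilon>} \<inter> S)"
      using continuous_on_rss that(1) by (intro open_Int open_vimage) auto
    moreover have "r \<in> (\<lambda>v. rss T e v) -` {..<rss T e r + \<epsilon>} \<inter> S" using that by simp
    ultimately show ?thesis using D by blast
  qed
  {
    assume "r \<bullet> lag_vec e t < c"
    \<comment> \<open>The rational number leaves a margin, so that strict inequality survives the
      passage to the limit in the converse direction.\<close>
    then obtain c' where c': "c' \<in> \<rat>" "r \<bullet> lag_vec e t < c'" "c' < c"
      using Rats_dense_in_real by blast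
    have "\<exists>v\<in>D. v \<bullet> lag_vec e t < c' \<and> (\<forall>w\<in>D. rss T e v \<le> rss T e w + inverse (real (Suc m)))" for m
    proof -
      have "open {v. v \<bullet> lag_vec e t < c'}"
        by (intro open_Collect_less continuous_intros)
      then obtain v where v: "v \<in> D" "v \<bullet> lag_vec e t < c'" "rss T e v < rss T e r + inverse (real (Suc m))"
        using near[of "{v. v \<bullet> lag_vec e t < c'}" "inverse (real (Suc m))"] c'(2) by auto
      have "rss T e v \<le> rss T e w + inverse (real (Suc m))" for w :: "(real, 'k) vec"
        using v(3) rss_minimal[OF r, of w] by linarith
      with v show ?thesis by blast
    qed
    with c' show ?R by blast
  }
  {
    assume ?R
    then obtain c' where c': "c' < c" and v: "\<And>m::nat. \<exists>v\<in>D. v \<bullet> lag_vec e t < c' \<and>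
        (\<forall>w\<in>D. rss T e v \<le> rss T e w + inverse (real (Suc m)))"
      by blast
    have "r \<bullet> lag_vec e t \<le> c' + sqrt (2 * inverse (real (Suc m)))" for m
    proof -
      obtain v :: "(real, 'k) vec" where v: "v \<bullet> lag_vec e t < c'" "\<And>w. w \<in> D \<Longrightarrow> rss T e v \<le> rss T e w + inverse (real (Suc m))"
        using v[of m] by blast
      obtain w where w: "w \<in> D" "rss T e w < rss T e r + inverse (real (Suc m))"
        using near[of UNIV "inverse (real (Suc m))"] by auto
      have "((r - v) \<bullet> lag_vec e t)\<^sup>2 \<le> 2 * inverse (real (Suc m))"
        using rss_gap[OF r t, of v] v(2)[OF w(1)] w(2) by linarith
      then have "(r - v) \<bullet> lag_vec e t \<le> sqrt (2 * inverse (real (Suc m)))"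
        by (rule real_le_rsqrt)
      with v(1) show ?thesis by (simp add: inner_diff_left)
    qed
    moreover have "(\<lambda>m. c' + sqrt (2 * inverse (real (Suc m)))) \<longlonglongrightarrow> c' + sqrt (2 * 0)"
      by (intro tendsto_intros LIMSEQ_inverse_real_of_nat)
    ultimately have "r \<bullet> lag_vec e t \<le> c' + sqrt (2 * 0)"
      by (intro LIMSEQ_le_const) auto
    with c' show "r \<bullet> lag_vec e t < c" by simp
  }
qed

lemma borel_measurable_fitted_value:
  fixes r :: "'a \<Rightarrow> real ^ ('k::{finite,linorder})"
  assumes e: "\<And>t. t \<in> {1..T} \<Longrightarrow> (\<lambda>\<omega>. e \<omega> t) \<in> borel_measurable M"
    and r: "\<And>\<omega>. normal_solution T (e \<omega>) (r \<omega>)" and t: "t \<in> {int CARD('k) + 1..T}"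
  shows "(\<lambda>\<omega>. r \<omega> \<bullet> lag_vec (e \<omega>) t) \<in> borel_measurable M"
proof -
  have inner: "(\<lambda>\<omega>. v \<bullet> lag_vec (e \<omega>) t) \<in> borel_measurable M"
    if "t \<in> {int CARD('k) + 1..T}" for v :: "(real, 'k) vec" and t
  proof -
    have "t - int (lag j) \<in> {1..T}" for j :: 'k
      using that lag_ge_1[of j] lag_le_card[of j] by auto
    then show ?thesis
      unfolding inner_lag_vec by (intro borel_measurable_sum borel_measurable_times borel_measurable_const e)
  qed
  have rss: "(\<lambda>\<omega>. rss T (e \<omega>) v) \<in> borel_measurable M" for v :: "(real, 'k) vec"
    unfolding rss_def ar_res_def
    by (intro borel_measurable_sum borel_measurable_power borel_measurable_diff e inner) auto
  obtain D :: "(real, 'k) vec set" where D: "countable D" "\<And>U. open U \<Longrightarrow> U \<noteq> {} \<Longrightarrow> \<exists>v\<in>D. v \<in> U"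
    by (rule countable_dense_setE) auto
  have "{\<omega> \<in> space M. r \<omega> \<bullet> lag_vec (e \<omega>) t < c} \<in> sets M" for c
  proof -
    have rss_le: "{\<omega> \<in> space M. rss T (e \<omega>) v \<le> rss T (e \<omega>) w + inverse (real (Suc m))} \<in> sets M"
      for v w :: "(real, 'k) vec" and m
      by (rule borel_measurable_le[OF rss borel_measurable_add[OF rss borel_measurable_const]])
    have less: "{\<omega> \<in> space M. v \<bullet> lag_vec (e \<omega>) t < c'} \<in> sets M" for v :: "(real, 'k) vec" and c'
      by (rule borel_measurable_less[OF inner[OF t] borel_measurable_const])
    have iff: "r \<omega> \<bullet> lag_vec (e \<omega>) t < c \<longleftrightarrow> (\<exists>c'\<in>\<rat>. c' < c \<and> (\<forall>m::nat. \<exists>v\<in>D.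
        v \<bullet> lag_vec (e \<omega>) t < c' \<and> (\<forall>w\<in>D. rss T (e \<omega>) v \<le> rss T (e \<omega>) w + inverse (real (Suc m)))))" for \<omega>
      by (rule fitted_value_less_iff[OF r t D(2)])
    show ?thesis
      unfolding iff
      by (intro sets.sets_Collect_countable_Ex' sets.sets_Collect_countable_All'
          sets.sets_Collect_countable_All sets.sets_Collect_conj sets.sets_Collect_const
          countable_rat D(1) rss_le less)
  qed
  then show ?thesis by (simp add: borel_measurable_iff_less)
qed

section \<open>Events of high probability\<close>

text \<open>The exceptional event is measurable but \<open>Q\<close> need not be, so conditions can
  be combined without proving them measurable.\<close>

definition likely :: "(nat \<Rightarrow> 'a measure) \<Rightarrow> real \<Rightarrow> (nat \<Rightarrow> 'a \<Rightarrow> bool) \<Rightarrow> bool" where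
  "likely M d Q \<longleftrightarrow> (\<forall>\<^sub>F n in sequentially.
     \<exists>S\<in>sets (M n). measure (M n) S \<le> d \<and> (\<forall>w\<in>space (M n) - S. Q n w))"

lemma likely_conj:
  assumes "\<And>n. prob_space (M n)" "likely M d Q" "likely M d' Q'"
  shows "likely M (d + d') (\<lambda>n w. Q n w \<and> Q' n w)"
  using assms(2,3) unfolding likely_def
proof eventually_elim
  case (elim n)
  interpret prob_space "M n" by (rule assms(1))
  obtain S S' where S: "S \<in> sets (M n)" "prob S \<le> d" "\<forall>w\<in>space (M n) - S. Q n w"
    and S': "S' \<in> sets (M n)" "prob S' \<le> d'" "\<forall>w\<in>space (M n) - S'. Q' n w"
    using elim by blast
  have "prob (S \<union> S') \<le> d + d'" using measure_Un_le[of S "M n" S'] S S' by auto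
  with S S' show ?case by (intro bexI[of _ "S \<union> S'"]) auto
qed

lemma likely_ball:
  assumes "\<And>n. prob_space (M n)" "finite I" "\<And>i. i \<in> I \<Longrightarrow> likely M (d / real (card I)) (Q i)" "0 \<le> d"
  shows "likely M d (\<lambda>n w. \<forall>i\<in>I. Q i n w)"
proof -
  have "likely M (real (card J) * c) (\<lambda>n w. \<forall>i\<in>J. Q i n w)"
    if "finite J" "\<And>i. i \<in> J \<Longrightarrow> likely M c (Q i)" for J c
    using that
  proof (induction J)
    case empty
    then show ?case by (auto simp: likely_def intro!: always_eventually bexI[of _ "{}"])
  next
    case (insert j J)
    then have "likely M (c + real (card J) * c) (\<lambda>n w. Q j n w \<and> (\<forall>i\<in>J. Q i n w))"
      by (intro likely_conj assms(1)) auto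
    then show ?case using insert.hyps by (simp add: algebra_simps)
  qed
  from this[OF assms(2,3)] show ?thesis
    using assms(2,4) by (cases "I = {}") (auto simp: likely_def intro!: always_eventually bexI[of _ "{}"])
qed

lemma likely_mono:
  assumes "likely M d Q" "\<forall>\<^sub>F n in sequentially. \<forall>w\<in>space (M n). Q n w \<longrightarrow> Q' n w"
  shows "likely M d Q'"
  using assms unfolding likely_def
proof eventually_elim
  case (elim n)
  then obtain S where "S \<in> sets (M n)" "measure (M n) S \<le> d" "\<forall>w\<in>space (M n) - S. Q n w" by blast
  with elim(2) show ?case by (intro bexI[of _ S]) auto
qed

text \<open>\<open>G n\<close> is a condition on the sample size alone, in use a bound on the
  variance or \<open>True\<close>. The moment bound is only asked for where it holds, which is how
  an oscillating variance is handled.\<close>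

lemma likely_markov:
  assumes "\<And>n. prob_space (M n)" "0 \<le> d"
    and ev: "\<forall>\<^sub>F n in sequentially. G n \<longrightarrow> integrable (M n) (X n) \<and> (\<forall>w. 0 \<le> X n w) \<and>
      integral\<^sup>L (M n) (X n) \<le> d * c n \<and> 0 < c n"
  shows "likely M d (\<lambda>n w. G n \<longrightarrow> X n w \<le> c n)"
  unfolding likely_def using ev
proof eventually_elim
  case (elim n)
  interpret prob_space "M n" by (rule assms(1))
  show ?case
  proof (cases "G n")
    case True
    then have X: "integrable (M n) (X n)" "\<And>w. 0 \<le> X n w" "expectation (X n) \<le> d * c n" "0 < c n"
      using elim by auto
    then have [measurable]: "X n \<in> borel_measurable (M n)" by simp
    have "prob {w \<in> space (M n). c n < X n w} \<le> d * c n / c n"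
      using X by (rule markov_prob)
    then show ?thesis
      using X(4) by (intro bexI[of _ "{w \<in> space (M n). c n < X n w}"]) auto
  next
    case False
    then show ?thesis using assms(2) by (intro bexI[of _ "{}"]) auto
  qed
qed

lemma likely_small_oP:
  assumes "small_oP M X a" "0 < e" "0 < d"
  shows "likely M d (\<lambda>n w. \<bar>X n w\<bar> \<le> e * a n)"
proof -
  have rv: "\<forall>\<^sub>F n in sequentially. X n \<in> borel_measurable (M n)"
    and lim: "(\<lambda>n. measure (M n) {w \<in> space (M n). \<bar>X n w\<bar> > e * a n}) \<longlonglongrightarrow> 0"
    using assms by (auto simp: small_oP_def)
  show ?thesis unfolding likely_def using rv order_tendstoD(2)[OF lim assms(3)]
  proof eventually_elim
    case (elim n)
    from elim(1) have [measurable]: "X n \<in> borel_measurable (M n)" .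
    show ?case
      using elim(2) by (intro bexI[of _ "{w \<in> space (M n). \<bar>X n w\<bar> > e * a n}"]) (auto simp: not_le[symmetric])
  qed
qed

lemma small_oP_likely:
  assumes "\<And>n. prob_space (M n)" "\<forall>\<^sub>F n in sequentially. X n \<in> borel_measurable (M n)"
    and likely: "\<And>e d. 0 < e \<Longrightarrow> 0 < d \<Longrightarrow> likely M d (\<lambda>n w. \<bar>X n w\<bar> \<le> e * a n)"
  shows "small_oP M X a"
  unfolding small_oP_def
proof (intro conjI allI impI)
  fix e :: real assume e: "0 < e"
  show "(\<lambda>n. measure (M n) {w \<in> space (M n). \<bar>X n w\<bar> > e * a n}) \<longlonglongrightarrow> 0"
  proof (rule order_tendstoI)
    fix d :: real assume d: "0 < d"
    have "\<forall>\<^sub>F n in sequentially. \<exists>S\<in>sets (M n). measure (M n) S \<le> d / 2 \<and> (\<forall>w\<in>space (M n) - S. \<bar>X n w\<bar> \<le> e * a n)"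
      using likely[OF e, of "d / 2"] d by (simp add: likely_def)
    then show "\<forall>\<^sub>F n in sequentially. measure (M n) {w \<in> space (M n). \<bar>X n w\<bar> > e * a n} < d"
    proof eventually_elim
      case (elim n)
      interpret prob_space "M n" by (rule assms(1))
      obtain S where S: "S \<in> events" "prob S \<le> d / 2" "\<forall>w\<in>space (M n) - S. \<bar>X n w\<bar> \<le> e * a n"
        using elim by blast
      have "prob {w \<in> space (M n). \<bar>X n w\<bar> > e * a n} \<le> prob S"
        using S by (intro finite_measure_mono) (auto simp: not_le[symmetric])
      with S(2) d show ?case by linarith
    qed
  qed (auto intro: always_eventually less_le_trans[OF _ measure_nonneg])
qed (use assms in auto)

section \<open>Prediction errors in the panel model\<close>

lemma L2_set_le_sqrt:
  assumes "(\<Sum>t\<in>A. (f t)\<^sup>2) \<le> \<theta>\<^sup>2 * N" "0 \<le> \<theta>"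
  shows "L2_set f A \<le> \<theta> * sqrt N"
  using real_sqrt_le_mono[OF assms(1)] assms(2) by (simp add: L2_set_def real_sqrt_mult)

lemma geometric_beats_sqrt:
  assumes l: "0 < l" "l < 1" and c: "0 < c"
  shows "\<forall>\<^sub>F n :: nat in sequentially. a * (l ^ n * sqrt (real n + real m)) \<le> c"
proof -
  have "(\<lambda>n. real n * l ^ n + real m * l ^ n) \<longlonglongrightarrow> 0 + real m * 0"
    using l by (intro tendsto_intros powser_times_n_limit_0 LIMSEQ_power_zero) auto
  then have "(\<lambda>n. \<bar>a\<bar> * (real n * l ^ n + real m * l ^ n)) \<longlonglongrightarrow> \<bar>a\<bar> * 0"
    by (intro tendsto_intros) simp
  then have "\<forall>\<^sub>F n in sequentially. \<bar>a\<bar> * (real n * l ^ n + real m * l ^ n) < c"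
    using c by (intro order_tendstoD) auto
  with eventually_ge_at_top[of 1] show ?thesis
  proof eventually_elim
    case (elim n)
    have "1 \<le> real n + real m" using elim(1) by simp
    then have "sqrt (real n + real m) \<le> real n + real m"
      by (intro real_le_lsqrt) (auto simp: power2_eq_square mult_le_cancel_left1)
    then have "l ^ n * sqrt (real n + real m) \<le> real n * l ^ n + real m * l ^ n"
      using l mult_left_mono[of "sqrt (real n + real m)" "real n + real m" "l ^ n"]
      by (simp add: algebra_simps)
    then have "\<bar>a\<bar> * (l ^ n * sqrt (real n + real m)) \<le> c"
      using elim(2) mult_left_mono[of _ _ "\<bar>a\<bar>"] by fastforce
    moreover have "a * (l ^ n * sqrt (real n + real m)) \<le> \<bar>a\<bar> * (l ^ n * sqrt (real n + real m))"
      using l by (intro mult_right_mono) auto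
    ultimately show ?case by linarith
  qed
qed

text \<open>Meets finitely many smallness requirements \<open>c * \<theta> \<le> x\<close> at once,
  where \<open>c\<close> may have either sign.\<close>

lemma small_parameter_exists:
  fixes C :: "(real \<times> real) list"
  assumes "\<And>c x. (c, x) \<in> set C \<Longrightarrow> 0 < x"
  obtains \<theta> :: real where "0 < \<theta>" "\<theta> \<le> 1" "\<And>c x. (c, x) \<in> set C \<Longrightarrow> c * \<theta> \<le> x"
proof -
  have "\<forall>\<^sub>F \<theta> in at_right 0. \<forall>p\<in>set C. fst p * \<theta> < snd p"
  proof (intro eventually_ball_finite ballI)
    fix p assume "p \<in> set C"
    then have "0 < snd p" using assms[of "fst p" "snd p"] by simp
    moreover have "((\<lambda>\<theta>. fst p * \<theta>) \<longlongrightarrow> fst p * 0) (at_right 0)" by (intro tendsto_intros)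
    ultimately show "\<forall>\<^sub>F \<theta> in at_right 0. fst p * \<theta> < snd p" by (intro order_tendstoD(2)[where y = "fst p * 0"]) auto
  qed simp
  moreover have "\<forall>\<^sub>F \<theta> :: real in at_right 0. \<theta> < 1" by (intro eventually_at_right_less order_tendstoD) auto
  moreover have "\<forall>\<^sub>F \<theta> :: real in at_right 0. 0 < \<theta>" by (simp add: eventually_at_right_less)
  ultimately have "\<forall>\<^sub>F \<theta> in at_right (0 :: real). 0 < \<theta> \<and> \<theta> < 1 \<and> (\<forall>p\<in>set C. fst p * \<theta> < snd p)"
    by eventually_elim auto
  then obtain \<theta> :: real where "0 < \<theta>" "\<theta> < 1" "\<forall>p\<in>set C. fst p * \<theta> < snd p"
    using eventually_happens trivial_limit_at_right_real by blast
  then show ?thesis by (intro that[of \<theta>]) fastforce+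
qed

text \<open>\<open>s\<close> plays the part of the estimated errors and \<open>d\<close> that of the
  error of the estimated panel proxy. The root condition appears as the uniform constants
  \<open>B\<close>, \<open>l\<close> and the coefficient bound 2^K.\<close>

locale ar_panel =
  fixes M :: "nat \<Rightarrow> 'a measure" and T :: "nat \<Rightarrow> int" and Tstar :: nat
    and u \<epsilon> d s :: "nat \<Rightarrow> int \<Rightarrow> 'a \<Rightarrow> real"
    and \<rho> :: "nat \<Rightarrow> real ^ ('k::{finite,linorder})" and B4 B l R c_end :: real
  assumes prob: "\<And>n. prob_space (M n)"
    and T: "\<And>n. T n = int n + int Tstar"
    and innovations: "\<And>n. 1 \<le> T n \<Longrightarrow> iid_innovations (M n) (u n) (T n) B4"
    and ar: "\<And>n t w. t \<in> {1..T n} \<Longrightarrow> w \<in> space (M n) \<Longrightarrow> ar_res (\<rho> n) (\<lambda>s. \<epsilon> n s w) t = u n t w"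
    and s: "\<And>n t w. t \<in> {1..T n} \<Longrightarrow> w \<in> space (M n) \<Longrightarrow> s n t w = \<epsilon> n t w - d n t w"
    and decays: "\<And>n. decays B l (\<rho> n)" and B: "1 \<le> B" and l: "0 < l" "l < 1"
    and \<rho>: "\<And>n j. \<bar>\<rho> n $ j\<bar> \<le> 2 ^ CARD('k)"
    and d_sum: "small_oP M (\<lambda>n w. \<Sum>t = 1..T n. (d n t w)\<^sup>2) (\<lambda>n. of_int (T n))"
    and d_end: "\<And>i. i \<in> {1 - int CARD('k)..int Tstar} \<Longrightarrow>
      small_oP M (\<lambda>n w. d n (int n + i) w) (\<lambda>n. 1)"
    and R_def: "R = real CARD('k) * 2 ^ CARD('k)"
    and c_end_def: "c_end = (B * (1 + R) + R / l ^ CARD('k)) / (1 - l)"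
begin

definition b :: real where "b = B / (1 - l)"

definition e0 :: "nat \<Rightarrow> int \<Rightarrow> 'a \<Rightarrow> real" where
  "e0 n = iid_innovations.moving_avg (u n) (T n) (impulse_response (\<rho> n))"

abbreviation r :: "nat \<Rightarrow> 'a \<Rightarrow> (real, 'k) vec" where
  "r n w \<equiv> ar_ols (T n) (\<lambda>t. s n t w)"

definition fit_err :: "nat \<Rightarrow> int \<Rightarrow> 'a \<Rightarrow> real" where
  "fit_err n t w = (r n w - \<rho> n) \<bullet> lag_vec (\<lambda>t. s n t w) t"

text \<open>With \<epsilon> = s + d, the difference d + r . lag_vec s - \<rho> . lag_vec \<epsilon>
  of the two predictors rearranges to this sum.\<close>

definition pred_err :: "nat \<Rightarrow> int \<Rightarrow> 'a \<Rightarrow> real" where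
  "pred_err n t w = fit_err n t w + ar_res (\<rho> n) (\<lambda>t. d n t w) t"

definition accurate :: "real \<Rightarrow> nat \<Rightarrow> 'a \<Rightarrow> bool" where
  "accurate e n w \<longleftrightarrow> (\<forall>i\<in>{1..int Tstar}. \<bar>pred_err n (int n + i) w\<bar> \<le> e) \<and>
     (\<Sum>t = int CARD('k) + 1..T n. (pred_err n t w)\<^sup>2) \<le> e * T n"

definition v :: "nat \<Rightarrow> real" where "v n = iid_innovations.var (M n) (u n)"

lemma card_ge_1: "1 \<le> int CARD('k)" by (simp add: Suc_leI)

lemma R: "0 \<le> R" by (simp add: R_def)

lemma b: "0 < b" using B l by (simp add: b_def)

lemma card_ends: "0 < card {1 - int CARD('k)..int Tstar}"
  unfolding card_atLeastAtMost_int zero_less_nat_eq using card_ge_1 by linarith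

lemma impulse_response_le: "\<bar>impulse_response (\<rho> n) (int k)\<bar> \<le> B * l ^ k"
  by (rule impulse_response_bound[OF decays B])

lemma e0_ar:
  assumes "1 \<le> t" "t \<le> T n"
  shows "ar_res (\<rho> n) (\<lambda>t. e0 n t w) t = u n t w"
proof -
  interpret iid_innovations "M n" "u n" "T n" B4 using assms by (intro innovations) auto
  have "ar_res (\<rho> n) (\<lambda>t. e0 n t w) t
      = (\<Sum>s = 1..T n. ar_res (\<rho> n) (\<lambda>t. u n s w * impulse_response (\<rho> n) (t - s)) t)"
    unfolding e0_def moving_avg_def by (subst ar_res_sum) (simp add: mult.commute)
  also have "\<dots> = u n t w" using assms by (simp add: ar_res_impulse_response_shift)
  finally show ?thesis .
qed

lemma e0_L2:
  assumes "1 \<le> T n"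
  shows "L2_set (\<lambda>t. e0 n t w) {1..T n} \<le> b * L2_set (\<lambda>t. u n t w) {1..T n}"
proof -
  interpret iid_innovations "M n" "u n" "T n" B4 using assms by (rule innovations)
  show ?thesis
    unfolding e0_def b_def using B by (intro moving_avg_L2 impulse_response_le l) auto
qed

lemma s_ar:
  assumes "t \<in> {int CARD('k) + 1..T n}" "w \<in> space (M n)"
  shows "ar_res (\<rho> n) (\<lambda>t. s n t w) t = u n t w - ar_res (\<rho> n) (\<lambda>t. d n t w) t"
proof -
  have "ar_res (\<rho> n) (\<lambda>t. s n t w) t = ar_res (\<rho> n) (\<lambda>t. \<epsilon> n t w - d n t w) t"
    using assms by (intro ar_res_cong s) auto
  then show ?thesis using assms card_ge_1 ar[of t n w] by (simp add: ar_res_diff)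
qed

lemma d_ar_L2: "L2_set (ar_res (\<rho> n) (\<lambda>t. d n t w)) {int CARD('k) + 1..T n} \<le> (1 + R) * L2_set (\<lambda>t. d n t w) {1..T n}"
  using L2_set_ar_res[OF \<rho>, of n "\<lambda>t. d n t w" "int CARD('k) + 1" "T n"] by (simp add: R_def)

section \<open>Deterministic criteria for accurate prediction\<close>

lemma accurateI:
  assumes fit_L2: "L2_set (\<lambda>t. fit_err n t w) {int CARD('k) + 1..T n} \<le> c * \<theta> * sqrt (T n)"
    and fit_end: "\<And>t. int n < t \<Longrightarrow> t \<le> T n \<Longrightarrow> \<bar>fit_err n t w\<bar> \<le> c' * \<theta>"
    and d_L2: "L2_set (\<lambda>t. d n t w) {1..T n} \<le> \<theta> * sqrt (T n)"
    and d_end: "\<And>i. i \<in> {1 - int CARD('k)..int Tstar} \<Longrightarrow> \<bar>d n (int n + i) w\<bar> \<le> \<theta>"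
    and \<theta>: "0 \<le> \<theta>" "\<theta> \<le> 1" "(c' + 1 + R) * \<theta> \<le> e" "(c + 1 + R)\<^sup>2 * \<theta> \<le> e"
    and T0: "0 \<le> T n" and c: "0 \<le> c"
  shows "accurate e n w"
  unfolding accurate_def
proof (intro conjI ballI)
  fix i assume i: "i \<in> {1..int Tstar}"
  have "\<bar>ar_res (\<rho> n) (\<lambda>t. d n t w) (int n + i)\<bar> \<le> (1 + R) * \<theta>"
    unfolding R_def
  proof (rule ar_res_le[OF \<rho>])
    fix t assume "int n + i - int CARD('k) \<le> t" "t \<le> int n + i"
    then show "\<bar>d n t w\<bar> \<le> \<theta>" using d_end[of "t - int n"] i by auto
  qed
  moreover have "\<bar>fit_err n (int n + i) w\<bar> \<le> c' * \<theta>" using i by (intro fit_end) (auto simp: T)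
  ultimately show "\<bar>pred_err n (int n + i) w\<bar> \<le> e"
    using \<theta>(3) by (simp add: pred_err_def algebra_simps)
next
  have "L2_set (\<lambda>t. pred_err n t w) {int CARD('k) + 1..T n}
      \<le> L2_set (\<lambda>t. fit_err n t w) {int CARD('k) + 1..T n} + L2_set (ar_res (\<rho> n) (\<lambda>t. d n t w)) {int CARD('k) + 1..T n}"
    unfolding pred_err_def by (rule L2_set_triangle_ineq)
  also have "\<dots> \<le> c * \<theta> * sqrt (T n) + (1 + R) * (\<theta> * sqrt (T n))"
    using R by (intro add_mono fit_L2 order.trans[OF d_ar_L2] mult_left_mono d_L2) auto
  finally have "L2_set (\<lambda>t. pred_err n t w) {int CARD('k) + 1..T n} \<le> (c + 1 + R) * \<theta> * sqrt (T n)"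
    by (simp add: algebra_simps)
  then have "(L2_set (\<lambda>t. pred_err n t w) {int CARD('k) + 1..T n})\<^sup>2 \<le> ((c + 1 + R) * \<theta> * sqrt (T n))\<^sup>2"
    by (intro power_mono L2_set_nonneg)
  also have "\<dots> = ((c + 1 + R)\<^sup>2 * \<theta>) * \<theta> * T n"
    using T0 by (simp add: power_mult_distrib power2_eq_square)
  \<comment> \<open>\<theta> <= 1 reduces the square of \<theta> to \<theta>, so that all
    requirements on it are linear.\<close>
  also have "\<dots> \<le> ((c + 1 + R)\<^sup>2 * \<theta>) * 1 * T n"
    using \<theta> T0 by (intro mult_right_mono mult_left_mono) auto
  also have "\<dots> \<le> e * T n" using \<theta>(4) T0 by (intro mult_right_mono) auto
  finally show "(\<Sum>t = int CARD('k) + 1..T n. (pred_err n t w)\<^sup>2) \<le> e * T n"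
    by (simp add: L2_set_def sum_nonneg)
qed

text \<open>By Pythagoras the sum of squared fitted errors is the excess of the residual sum of
  squares at \<rho> over the minimum.\<close>

lemma fit_err_L2:
  "L2_set (\<lambda>t. fit_err n t w) {int CARD('k) + 1..T n} \<le> L2_set (ar_res (\<rho> n) (\<lambda>t. s n t w)) {int CARD('k) + 1..T n}"
  unfolding L2_set_def
proof (rule real_sqrt_le_mono)
  show "(\<Sum>t = int CARD('k) + 1..T n. (fit_err n t w)\<^sup>2) \<le> (\<Sum>t = int CARD('k) + 1..T n. (ar_res (\<rho> n) (\<lambda>t. s n t w) t)\<^sup>2)"
    using rss_pythagoras[OF normal_solution_ar_ols, of "T n" "\<lambda>t. s n t w" "\<rho> n"]
      rss_nonneg[of "T n" "\<lambda>t. s n t w" "r n w"]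
    by (simp add: fit_err_def rss_def)
qed

text \<open>\<epsilon> and \<open>e0\<close> have the same innovations in the sample, so their
  difference is the homogeneous part; it carries all pre-sample values.\<close>

lemma decomposition:
  assumes "w \<in> space (M n)" "1 \<le> t" "t \<le> T n"
  shows "s n t w = (\<epsilon> n t w - e0 n t w) + (e0 n t w - d n t w)"
    and "ar_res (\<rho> n) (\<lambda>t. \<epsilon> n t w - e0 n t w) t = 0"
  using assms by (simp_all add: s ar_res_diff ar e0_ar)

lemma accurate_if_quiet:
  assumes w: "w \<in> space (M n)" and n: "2 * int CARD('k) \<le> int n"
    and \<theta>: "0 \<le> \<theta>" "\<theta> \<le> 1"
      "(3 * (c_end + 2 * R + B * (1 + R + c_end)) + 1 + R) * \<theta> \<le> e" "(2 + R + 1 + R)\<^sup>2 * \<theta> \<le> e"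
    and u: "(\<Sum>t = 1..T n. (u n t w)\<^sup>2) \<le> \<theta>\<^sup>2 * T n"
    and e0: "\<And>i. i \<in> {1 - int CARD('k)..int Tstar} \<Longrightarrow> \<bar>e0 n (int n + i) w\<bar> \<le> \<theta>"
    and d: "(\<Sum>t = 1..T n. (d n t w)\<^sup>2) \<le> \<theta>\<^sup>2 * T n"
    and d_end: "\<And>i. i \<in> {1 - int CARD('k)..int Tstar} \<Longrightarrow> \<bar>d n (int n + i) w\<bar> \<le> \<theta>"
    and ln: "(3 + R + b) / l ^ (2 * CARD('k)) * (l ^ n * sqrt (real n + real Tstar)) \<le> 1"
  shows "accurate e n w"
proof (rule accurateI[where c = "2 + R" and c' = "3 * (c_end + 2 * R + B * (1 + R + c_end))"])
  have T1: "1 \<le> T n" unfolding T using n card_ge_1 by linarith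
  have u_L2: "L2_set (\<lambda>t. u n t w) {1..T n} \<le> \<theta> * sqrt (T n)"
    using u \<theta>(1) by (rule L2_set_le_sqrt)
  show d_L2: "L2_set (\<lambda>t. d n t w) {1..T n} \<le> \<theta> * sqrt (T n)"
    using d \<theta>(1) by (rule L2_set_le_sqrt)
  have ar_s_L2: "L2_set (ar_res (\<rho> n) (\<lambda>t. s n t w)) {int CARD('k) + 1..T n} \<le> (2 + R) * \<theta> * sqrt (T n)"
  proof -
    have "L2_set (ar_res (\<rho> n) (\<lambda>t. s n t w)) {int CARD('k) + 1..T n}
        = L2_set (\<lambda>t. u n t w - ar_res (\<rho> n) (\<lambda>t. d n t w) t) {int CARD('k) + 1..T n}"
      using w by (intro L2_set_cong s_ar) auto
    also have "\<dots> \<le> L2_set (\<lambda>t. u n t w) {int CARD('k) + 1..T n} + L2_set (ar_res (\<rho> n) (\<lambda>t. d n t w)) {int CARD('k) + 1..T n}"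
      by (rule L2_set_diff_le)
    also have "\<dots> \<le> \<theta> * sqrt (T n) + (1 + R) * (\<theta> * sqrt (T n))"
      using R card_ge_1 by (intro add_mono order.trans[OF L2_set_subset u_L2] order.trans[OF d_ar_L2] mult_left_mono d_L2) auto
    finally show ?thesis by (simp add: algebra_simps)
  qed
  with fit_err_L2 show "L2_set (\<lambda>t. fit_err n t w) {int CARD('k) + 1..T n} \<le> (2 + R) * \<theta> * sqrt (T n)"
    by (rule order.trans)
  have e_L2: "L2_set (\<lambda>t. e0 n t w - d n t w) {1..T n} \<le> (b + 1) * \<theta> * sqrt (T n)"
  proof -
    have "L2_set (\<lambda>t. e0 n t w) {1..T n} \<le> b * (\<theta> * sqrt (T n))"
      using e0_L2[OF T1, of w] mult_left_mono[OF u_L2, of b] b by linarith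
    then show ?thesis
      using L2_set_diff_le[of "\<lambda>t. e0 n t w" "\<lambda>t. d n t w" "{1..T n}"] d_L2 by (simp add: algebra_simps)
  qed
  fix t assume t: "int n < t" "t \<le> T n"
  define Q where "Q = 2 * \<theta> + l ^ nat (int n - 2 * int CARD('k)) *
    (L2_set (ar_res (\<rho> n) (\<lambda>t. s n t w)) {int CARD('k) + 1..T n} + L2_set (\<lambda>t. e0 n t w - d n t w) {1..T n})"
  define C where "C = c_end + 2 * R + B * (1 + R + c_end)"
  have "0 \<le> c_end" using B R l by (simp add: c_end_def)
  then have C: "0 \<le> C" using B R by (simp add: C_def)
  have "\<bar>fit_err n t w\<bar> \<le> C * Q"
    unfolding fit_err_def C_def
  proof (rule fitted_error_end[OF decays B l \<rho> n _ decomposition(2)[OF w] decomposition(1)[OF w]])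
    fix t assume "int n + 1 - int CARD('k) \<le> t" "t \<le> T n"
    then show "\<bar>e0 n t w - d n t w\<bar> \<le> 2 * \<theta>"
      using e0[of "t - int n"] d_end[of "t - int n"] by (simp add: T)
  qed (use t \<theta>(1) in \<open>auto simp: T normal_solution_ar_ols R_def c_end_def Q_def\<close>)
  \<comment> \<open>2 \<theta> is the size of \<open>e0 - d\<close> at the end of the sample; the
    geometric term in \<open>Q\<close> is \<theta> times the quantity bounded by 1 in
    \<open>ln\<close>. Together 3 \<theta>.\<close>
  moreover have "Q \<le> 3 * \<theta>"
  proof -
    have "l ^ nat (int n - 2 * int CARD('k)) = l ^ n / l ^ (2 * CARD('k))"
    proof -
      have "n = nat (int n - 2 * int CARD('k)) + 2 * CARD('k)" using n by auto
      then have "l ^ n = l ^ nat (int n - 2 * int CARD('k)) * l ^ (2 * CARD('k))" by (metis power_add)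
      then show ?thesis using l by simp
    qed
    moreover have "L2_set (ar_res (\<rho> n) (\<lambda>t. s n t w)) {int CARD('k) + 1..T n} + L2_set (\<lambda>t. e0 n t w - d n t w) {1..T n}
        \<le> (3 + R + b) * \<theta> * sqrt (T n)"
      using ar_s_L2 e_L2 by (simp add: algebra_simps)
    ultimately have "Q \<le> 2 * \<theta> + l ^ n / l ^ (2 * CARD('k)) * ((3 + R + b) * \<theta> * sqrt (T n))"
      unfolding Q_def using l by (simp add: divide_right_mono mult_left_mono)
    also have "\<dots> = 2 * \<theta> + \<theta> * ((3 + R + b) / l ^ (2 * CARD('k)) * (l ^ n * sqrt (real n + real Tstar)))"
      by (simp add: T)
    also have "\<dots> \<le> 2 * \<theta> + \<theta> * 1" using \<theta>(1) ln by (intro add_left_mono mult_left_mono) auto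
    finally show ?thesis by simp
  qed
  ultimately have "\<bar>fit_err n t w\<bar> \<le> C * (3 * \<theta>)"
    using mult_left_mono[of Q "3 * \<theta>" C] C by linarith
  then show "\<bar>fit_err n t w\<bar> \<le> 3 * (c_end + 2 * R + B * (1 + R + c_end)) * \<theta>"
    unfolding C_def[symmetric] by (simp add: mult_ac)
qed (use \<theta> d_end R card_ge_1 in \<open>auto simp: T\<close>)

lemma accurate_if_noisy:
  assumes w: "w \<in> space (M n)" and n: "8 * int CARD('k) \<le> int n"
    and g: "0 < g" "4 * g\<^sup>2 \<le> v n"
    and \<theta>: "0 \<le> \<theta>" "\<theta> \<le> 1" "(real CARD('k))\<^sup>2 * \<theta> \<le> g\<^sup>2" "2 * (real CARD('k) * (1 + R) * \<theta>) \<le> g"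
      "(real CARD('k) * c1 * (H + 1) * c4 + c3 * c4 + 1 + R) * \<theta> \<le> e" "(c4 + 1 + R)\<^sup>2 * \<theta> \<le> e"
    and c1: "c1 = 2 * (1 + R) / g"
    and c3: "c3 = B * (1 + real CARD('k) * c1 * (H + 1)) / l ^ (2 * CARD('k))"
    and c4: "c4 = 1 + R + real CARD('k) * c1 + H * (real CARD('k) * c1) + c3"
    and H: "0 \<le> h" "h \<le> H" "b * h \<le> H"
    and u: "(\<Sum>t = 1..T n. (u n t w)\<^sup>2) \<le> h\<^sup>2 * T n"
    and e0: "\<And>i. i \<in> {1 - int CARD('k)..int Tstar} \<Longrightarrow> \<bar>e0 n (int n + i) w\<bar> \<le> H"
    and d: "(\<Sum>t = 1..T n. (d n t w)\<^sup>2) \<le> \<theta>\<^sup>2 * T n"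
    and d_end: "\<And>i. i \<in> {1 - int CARD('k)..int Tstar} \<Longrightarrow> \<bar>d n (int n + i) w\<bar> \<le> \<theta>"
    and diag: "\<And>j :: 'k. \<bar>\<Sum>t = 2 * int CARD('k) + 1 - int (lag j)..T n - int (lag j). (u n t w)\<^sup>2 - v n\<bar> \<le> g\<^sup>2 * T n"
    and off: "\<And>i j :: 'k. i \<noteq> j \<Longrightarrow>
      \<bar>\<Sum>t = 2 * int CARD('k) + 1..T n. u n (t - int (lag i)) w * u n (t - int (lag j)) w\<bar> \<le> \<theta> * T n"
    and cross: "\<And>j :: 'k. \<bar>\<Sum>t = int CARD('k) + 1..T n. u n t w * e0 n (t - int (lag j)) w\<bar> \<le> \<theta> * T n"
    and start: "(\<Sum>t = 1..T n. l ^ nat t * \<bar>u n t w\<bar>) \<le> \<theta> * sqrt (T n)"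
    and ln: "l ^ n * sqrt (real n + real Tstar) \<le> 1"
  shows "accurate e n w"
proof (rule accurateI[where \<theta> = \<theta> and c = c4 and c' = "real CARD('k) * c1 * (H + 1) * c4 + c3 * c4"])
  have T8: "8 * int CARD('k) \<le> T n" unfolding T using n by linarith
  then have T1: "1 \<le> T n" using card_ge_1 by linarith
  have c0: "0 \<le> c1" "0 \<le> c3" "0 \<le> c4" using R g(1) B l H by (auto simp: c1 c3 c4)
  then show "0 \<le> c4" by simp
  show d_L2: "L2_set (\<lambda>t. d n t w) {1..T n} \<le> \<theta> * sqrt (T n)"
    using d \<theta>(1) by (rule L2_set_le_sqrt)
  have u_L2: "L2_set (\<lambda>t. u n t w) {1..T n} \<le> h * sqrt (T n)"
    using u H(1) by (rule L2_set_le_sqrt)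
  have e0_L2': "L2_set (\<lambda>t. e0 n t w) {1..T n} \<le> H * sqrt (T n)"
  proof -
    have "L2_set (\<lambda>t. e0 n t w) {1..T n} \<le> b * (h * sqrt (T n))"
      using e0_L2[OF T1, of w] mult_left_mono[OF u_L2, of b] b by linarith
    also have "\<dots> \<le> H * sqrt (T n)" using mult_right_mono[OF H(3), of "sqrt (T n)"] T1 by simp
    finally show ?thesis .
  qed
  have "h * sqrt (T n) \<le> H * sqrt (T n)" using H(2) T1 by (intro mult_right_mono) auto
  with u_L2 have u_L2': "L2_set (\<lambda>t. u n t w) {1..T n} \<le> H * sqrt (T n)" by linarith
  \<comment> \<open>T >= 8K leaves at least three quarters of the sample, so 4 g^2 <= v makes the
    mean at least 3 g^2 T; the deviation takes away at most g^2 T.\<close>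
  have diag': "2 * g\<^sup>2 * T n \<le> (\<Sum>t = 2 * int CARD('k) + 1..T n. (u n (t - int (lag j)) w)\<^sup>2)" for j :: 'k
  proof -
    let ?J = "{2 * int CARD('k) + 1 - int (lag j)..T n - int (lag j)}"
    have "(\<Sum>t = 2 * int CARD('k) + 1..T n. (u n (t - int (lag j)) w)\<^sup>2) = (\<Sum>t\<in>?J. (u n t w)\<^sup>2)"
      by (rule sum.reindex_bij_witness[of _ "\<lambda>t. t + int (lag j)" "\<lambda>t. t - int (lag j)"]) auto
    moreover have "(\<Sum>t\<in>?J. (u n t w)\<^sup>2 - v n) = (\<Sum>t\<in>?J. (u n t w)\<^sup>2) - (real_of_int (T n) - 2 * real CARD('k)) * v n"
      using T8 by (simp add: sum_subtractf)
    moreover have "3 * g\<^sup>2 * T n \<le> (real_of_int (T n) - 2 * real CARD('k)) * v n"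
    proof -
      have T8': "8 * real CARD('k) \<le> real_of_int (T n)" using T8 by linarith
      then have "3 * real_of_int (T n) * g\<^sup>2 \<le> 4 * (real_of_int (T n) - 2 * real CARD('k)) * g\<^sup>2"
        by (intro mult_right_mono) auto
      also have "\<dots> = (real_of_int (T n) - 2 * real CARD('k)) * (4 * g\<^sup>2)" by simp
      also have "\<dots> \<le> (real_of_int (T n) - 2 * real CARD('k)) * v n"
        using T8' g(2) by (intro mult_left_mono) auto
      finally show ?thesis by (simp add: mult_ac)
    qed
    ultimately show ?thesis using diag[of j] by linarith
  qed
  have e0_end: "\<bar>e0 n t w\<bar> \<le> H" and d_end': "\<bar>d n t w\<bar> \<le> \<theta>"
    if "int n + 1 - int CARD('k) \<le> t" "t \<le> T n" for t
    using that e0[of "t - int n"] d_end[of "t - int n"] by (auto simp: T)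
  have n': "2 * int CARD('k) \<le> int n" "int n \<le> T n" using n by (auto simp: T)
  have H0: "0 \<le> H" using H by linarith
  note noisy = fitted_error_noisy[OF decays B l \<rho> n' decomposition(2)[OF w] e0_ar decomposition(1)[OF w]
      normal_solution_ar_ols R_def g(1) \<theta>(1,2) H0 \<theta>(3,4) u_L2' e0_L2' d_L2 diag' off cross start
      e0_end d_end' c1 c3 c4]
  show "L2_set (\<lambda>t. fit_err n t w) {int CARD('k) + 1..T n} \<le> c4 * \<theta> * sqrt (T n)"
    unfolding fit_err_def by (rule noisy(1))
  fix t assume t: "int n < t" "t \<le> T n"
  have "\<bar>fit_err n t w\<bar> \<le> real CARD('k) * c1 * (H + 1) * (c4 * \<theta>) + c3 * (c4 * \<theta> * sqrt (T n)) * l ^ nat (int n)"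
    unfolding fit_err_def by (rule noisy(2)) (simp_all add: t)
  also have "\<dots> = real CARD('k) * c1 * (H + 1) * c4 * \<theta> + c3 * c4 * \<theta> * (l ^ n * sqrt (real n + real Tstar))"
    by (simp add: T)
  also have "\<dots> \<le> real CARD('k) * c1 * (H + 1) * c4 * \<theta> + c3 * c4 * \<theta> * 1"
    using c0 \<theta>(1) ln by (intro add_left_mono mult_left_mono) auto
  finally show "\<bar>fit_err n t w\<bar> \<le> (real CARD('k) * c1 * (H + 1) * c4 + c3 * c4) * \<theta>"
    by (simp add: algebra_simps)
qed (use \<theta> d_end card_ge_1 in \<open>auto simp: T\<close>)

section \<open>Probabilities of the required events\<close>

lemma eventually_le_sqrt_T: "\<forall>\<^sub>F n in sequentially. c \<le> sqrt (T n)"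
  using eventually_ge_at_top[of "nat \<lceil>c\<^sup>2\<rceil>"]
proof eventually_elim
  case (elim n)
  then have "c\<^sup>2 \<le> real n" by linarith
  also have "\<dots> \<le> T n" by (simp add: T)
  finally show ?case by (rule real_le_rsqrt)
qed

lemma likely_d_sum:
  fixes \<theta> :: real
  assumes "0 < \<theta>" "0 < p"
  shows "likely M p (\<lambda>n w. (\<Sum>t = 1..T n. (d n t w)\<^sup>2) \<le> \<theta>\<^sup>2 * T n)"
  using assms
  by (intro likely_mono[OF likely_small_oP[OF d_sum, of "\<theta>\<^sup>2" p]] always_eventually) (auto simp: sum_nonneg)

lemma likely_d_end:
  fixes \<theta> :: real
  assumes "0 < \<theta>" "0 < p"
  shows "likely M p (\<lambda>n w. \<forall>i\<in>{1 - int CARD('k)..int Tstar}. \<bar>d n (int n + i) w\<bar> \<le> \<theta>)"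
proof (rule likely_ball[OF prob])
  fix i assume i: "i \<in> {1 - int CARD('k)..int Tstar}"
  show "likely M (p / real (card {1 - int CARD('k)..int Tstar})) (\<lambda>n w. \<bar>d n (int n + i) w\<bar> \<le> \<theta>)"
    using likely_small_oP[OF d_end[OF i], of \<theta> "p / real (card {1 - int CARD('k)..int Tstar})"] assms card_ends by simp
qed (use assms in auto)

lemma likely_u_sum:
  fixes h :: real
  assumes "0 < h" "0 \<le> p" and G: "\<And>n. 1 \<le> T n \<Longrightarrow> G n \<Longrightarrow> v n \<le> p * h\<^sup>2"
  shows "likely M p (\<lambda>n w. G n \<longrightarrow> (\<Sum>t = 1..T n. (u n t w)\<^sup>2) \<le> h\<^sup>2 * T n)"
proof (rule likely_markov[OF prob assms(2)])
  show "\<forall>\<^sub>F n in sequentially. G n \<longrightarrow> integrable (M n) (\<lambda>w. \<Sum>t = 1..T n. (u n t w)\<^sup>2) \<and>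
      (\<forall>w. 0 \<le> (\<Sum>t = 1..T n. (u n t w)\<^sup>2)) \<and>
      (\<integral>w. (\<Sum>t = 1..T n. (u n t w)\<^sup>2) \<partial>M n) \<le> p * (h\<^sup>2 * T n) \<and> 0 < h\<^sup>2 * T n"
    using eventually_ge_at_top[of 1]
  proof eventually_elim
    case (elim n)
    then have T1: "1 \<le> T n" by (simp add: T)
    interpret iid_innovations "M n" "u n" "T n" B4 by (rule innovations[OF T1])
    have "T n * v n \<le> T n * (p * h\<^sup>2)" if "G n" using G[OF T1 that] T1 by (intro mult_left_mono) auto
    then show ?case
      using expectation_sum_sq T1 assms(1) by (simp add: sum_nonneg v_def mult_ac)
  qed
qed

lemma likely_e0_end:
  fixes h :: real
  assumes "0 < h" "0 \<le> p" "0 < a"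
    and G: "\<And>n. 1 \<le> T n \<Longrightarrow> G n \<Longrightarrow>
      b * ((v n / a + a) / 2) \<le> p / real (card {1 - int CARD('k)..int Tstar}) * h"
  shows "likely M p (\<lambda>n w. \<forall>i\<in>{1 - int CARD('k)..int Tstar}. G n \<longrightarrow> \<bar>e0 n (int n + i) w\<bar> \<le> h)"
proof (rule likely_ball[OF prob])
  fix i
  show "likely M (p / real (card {1 - int CARD('k)..int Tstar})) (\<lambda>n w. G n \<longrightarrow> \<bar>e0 n (int n + i) w\<bar> \<le> h)"
  proof (rule likely_markov[OF prob])
    show "\<forall>\<^sub>F n in sequentially. G n \<longrightarrow> integrable (M n) (\<lambda>w. \<bar>e0 n (int n + i) w\<bar>) \<and>
      (\<forall>w. 0 \<le> \<bar>e0 n (int n + i) w\<bar>) \<and>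
      (\<integral>w. \<bar>e0 n (int n + i) w\<bar> \<partial>M n) \<le> p / real (card {1 - int CARD('k)..int Tstar}) * h \<and> 0 < h"
      using eventually_ge_at_top[of 1]
    proof eventually_elim
      case (elim n)
      then have T1: "1 \<le> T n" by (simp add: T)
      interpret iid_innovations "M n" "u n" "T n" B4 by (rule innovations[OF T1])
      have B0: "0 \<le> B" using B by simp
      have e0_abs: "integrable (M n) (\<lambda>w. \<bar>e0 n t w\<bar>)"
        "expectation (\<lambda>w. \<bar>e0 n t w\<bar>) \<le> b * ((var / a + a) / 2)" for t
        unfolding e0_def b_def
        by (rule moving_avg_abs[OF _ _ l B0 assms(3)]; simp add: impulse_response_le)+
      show ?case
        by (intro impI conjI allI e0_abs(1) abs_ge_zero assms(1)
            order.trans[OF e0_abs(2) G[OF T1, unfolded v_def]])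
    qed
  qed (use assms in auto)
qed (use assms in auto)

lemma likely_accurate_quiet:
  assumes e: "0 < e" and p: "0 < p"
  obtains \<kappa> where "0 < \<kappa>" "likely M p (\<lambda>n w. v n < \<kappa> \<longrightarrow> accurate e n w)"
proof -
  define C where "C = 3 * (c_end + 2 * R + B * (1 + R + c_end)) + 1 + R"
  define N where "N = real (card {1 - int CARD('k)..int Tstar})"
  have N: "0 < N" using card_ends by (simp add: N_def)
  obtain \<theta> where "0 < \<theta>" "\<theta> \<le> 1"
    and le: "\<And>c x. (c, x) \<in> set [(C, e), ((2 + R + 1 + R)\<^sup>2, e)] \<Longrightarrow> c * \<theta> \<le> x"
    by (rule small_parameter_exists[of "[(C, e), ((2 + R + 1 + R)\<^sup>2, e)]"]) (use e in auto)
  then have \<theta>: "0 < \<theta>" "\<theta> \<le> 1" "C * \<theta> \<le> e" "(2 + R + 1 + R)\<^sup>2 * \<theta> \<le> e" by auto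
  \<comment> \<open>The first bound makes a^2 <= (p / 4) \<theta>^2, as Markov's inequality needs
    for the sum of squares. The second does the same for each of the \<open>N\<close> end values of
    \<open>e0\<close>, whose mean modulus is at most b a once the variance is below a^2. The
    threshold is therefore a^2.\<close>
  define a where "a = min (\<theta> * sqrt (p / 4)) (p / 4 / N * \<theta> / b)"
  have a: "0 < a" using \<theta>(1) p N b by (simp add: a_def)
  have "a\<^sup>2 \<le> (\<theta> * sqrt (p / 4))\<^sup>2" using a by (intro power_mono) (auto simp: a_def)
  then have a_sq: "a\<^sup>2 \<le> p / 4 * \<theta>\<^sup>2" using p by (simp add: power_mult_distrib mult.commute)
  have "a \<le> p / 4 / N * \<theta> / b" by (simp add: a_def)
  then have "a * b \<le> p / 4 / N * \<theta>" by (simp only: pos_le_divide_eq[OF b])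
  then have a_b: "b * a \<le> p / 4 / N * \<theta>" by (simp only: mult.commute)
  have quiet_e0: "b * ((v n / a + a) / 2) \<le> p / 4 / N * \<theta>" if "v n < a\<^sup>2" for n
  proof -
    have "v n / a \<le> a" using that a by (simp add: pos_divide_le_eq power2_eq_square)
    then have "b * ((v n / a + a) / 2) \<le> b * a" using b by (intro mult_left_mono) auto
    with a_b show ?thesis by linarith
  qed
  let ?I = "{1 - int CARD('k)..int Tstar}"
  have "likely M (p / 4 + (p / 4 + (p / 4 + p / 4))) (\<lambda>n w.
      (v n < a\<^sup>2 \<longrightarrow> (\<Sum>t = 1..T n. (u n t w)\<^sup>2) \<le> \<theta>\<^sup>2 * T n) \<and>
      (\<forall>i\<in>?I. v n < a\<^sup>2 \<longrightarrow> \<bar>e0 n (int n + i) w\<bar> \<le> \<theta>) \<and>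
      (\<Sum>t = 1..T n. (d n t w)\<^sup>2) \<le> \<theta>\<^sup>2 * T n \<and>
      (\<forall>i\<in>?I. \<bar>d n (int n + i) w\<bar> \<le> \<theta>))"
    (is "likely M _ ?Q")
    using p \<theta>(1) a a_sq quiet_e0
    by (intro likely_conj[OF prob] likely_u_sum likely_e0_end[where a = a] likely_d_sum likely_d_end) (auto simp: N_def)
  then have "likely M (p / 4 + (p / 4 + (p / 4 + p / 4))) (\<lambda>n w. v n < a\<^sup>2 \<longrightarrow> accurate e n w)"
  proof (rule likely_mono)
    show "\<forall>\<^sub>F n in sequentially. \<forall>w\<in>space (M n). ?Q n w \<longrightarrow> (v n < a\<^sup>2 \<longrightarrow> accurate e n w)"
      using eventually_ge_at_top[of "2 * CARD('k)"]
        geometric_beats_sqrt[OF l zero_less_one, of "(3 + R + b) / l ^ (2 * CARD('k))" Tstar]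
    proof eventually_elim
      case (elim n)
      show ?case
        using elim \<theta> by (intro ballI impI accurate_if_quiet[where \<theta> = \<theta>]) (auto simp: C_def)
    qed
  qed
  then show ?thesis using a by (intro that[of "a\<^sup>2"]) auto
qed

text \<open>Expectations of order sqrt T against a threshold of order T: Markov's inequality gives a
  probability that tends to 0, so any budget suffices eventually.\<close>

lemma likely_scaled:
  fixes c :: real
  assumes p: "0 < p" and c: "0 < c" and I: "finite I"
    and X: "\<And>n i. 1 \<le> T n \<Longrightarrow> i \<in> I \<Longrightarrow> integrable (M n) (\<lambda>w. \<bar>X i n w\<bar>)"
      "\<And>n i. 1 \<le> T n \<Longrightarrow> i \<in> I \<Longrightarrow> (\<integral>w. \<bar>X i n w\<bar> \<partial>M n) \<le> sqrt (T n) * C"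
  shows "likely M p (\<lambda>n w. \<forall>i\<in>I. \<bar>X i n w\<bar> \<le> c * T n)"
proof (rule likely_ball[OF prob I])
  fix i assume i: "i \<in> I"
  then have card: "0 < real (card I)" using I by (simp add: card_gt_0_iff) blast
  have "likely M (p / real (card I)) (\<lambda>n w. True \<longrightarrow> \<bar>X i n w\<bar> \<le> c * T n)"
  proof (rule likely_markov[OF prob])
    show "\<forall>\<^sub>F n in sequentially. True \<longrightarrow> integrable (M n) (\<lambda>w. \<bar>X i n w\<bar>) \<and> (\<forall>w. 0 \<le> \<bar>X i n w\<bar>) \<and>
      (\<integral>w. \<bar>X i n w\<bar> \<partial>M n) \<le> p / real (card I) * (c * T n) \<and> 0 < c * T n"
      using eventually_ge_at_top[of 1] eventually_le_sqrt_T[of "C / (p / real (card I) * c)"]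
    proof eventually_elim
      case (elim n)
      then have T1: "1 \<le> T n" by (simp add: T)
      have "C \<le> sqrt (T n) * (p / real (card I) * c)"
        using elim(2) p c card by (subst (asm) pos_divide_le_eq) auto
      then have "sqrt (T n) * C \<le> sqrt (T n) * (sqrt (T n) * (p / real (card I) * c))"
        using T1 by (intro mult_left_mono) auto
      also have "\<dots> = (sqrt (T n) * sqrt (T n)) * (p / real (card I) * c)" by (simp only: mult.assoc)
      also have "\<dots> = p / real (card I) * (c * T n)" using T1 by simp
      finally show ?case using X[OF T1 i] T1 c by auto
    qed
  qed (use p in auto)
  then show "likely M (p / real (card I)) (\<lambda>n w. \<bar>X i n w\<bar> \<le> c * T n)" by simp
qed (use p in simp)

lemma likely_start:
  fixes \<theta> :: real
  assumes p: "0 < p" and \<theta>: "0 < \<theta>"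
  shows "likely M p (\<lambda>n w. (\<Sum>t = 1..T n. l ^ nat t * \<bar>u n t w\<bar>) \<le> \<theta> * sqrt (T n))"
proof -
  define C where "C = 1 / (1 - l) * ((1 + B4 + 1) / 2)"
  have "likely M p (\<lambda>n w. True \<longrightarrow> (\<Sum>t = 1..T n. l ^ nat t * \<bar>u n t w\<bar>) \<le> \<theta> * sqrt (T n))"
  proof (rule likely_markov[OF prob])
    show "\<forall>\<^sub>F n in sequentially. True \<longrightarrow> integrable (M n) (\<lambda>w. \<Sum>t = 1..T n. l ^ nat t * \<bar>u n t w\<bar>) \<and>
      (\<forall>w. 0 \<le> (\<Sum>t = 1..T n. l ^ nat t * \<bar>u n t w\<bar>)) \<and>
      (\<integral>w. (\<Sum>t = 1..T n. l ^ nat t * \<bar>u n t w\<bar>) \<partial>M n) \<le> p * (\<theta> * sqrt (T n)) \<and> 0 < \<theta> * sqrt (T n)"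
      using eventually_ge_at_top[of 1] eventually_le_sqrt_T[of "C / (p * \<theta>)"]
    proof eventually_elim
      case (elim n)
      then have T1: "1 \<le> T n" by (simp add: T)
      interpret iid_innovations "M n" "u n" "T n" B4 by (rule innovations[OF T1])
      have "(\<Sum>t = 1..T n. l ^ nat t) = (\<Sum>t = 1..T n. if 0 \<le> t then l ^ nat t else 0)"
        by (intro sum.cong) auto
      also have "\<dots> \<le> 1 / (1 - l)" by (intro sum_geometric_int_le l) simp
      finally have sum_l: "(\<Sum>t = 1..T n. l ^ nat t) \<le> 1 / (1 - l)" .
      have l_nonneg: "0 \<le> l ^ nat t" for t :: int using l by simp
      note * = weighted_abs_sum[OF l_nonneg sum_l zero_less_one]
      have "1 / (1 - l) * ((var / 1 + 1) / 2) \<le> C"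
        unfolding C_def using var_le l by (intro mult_left_mono) auto
      also have "C \<le> p * (\<theta> * sqrt (T n))"
        using elim(2) p \<theta> by (subst (asm) pos_divide_le_eq) (auto simp: mult_ac)
      finally show ?case using * l T1 \<theta> by (auto intro: sum_nonneg)
    qed
  qed (use p in auto)
  then show ?thesis by simp
qed

lemma likely_autocovariance:
  fixes \<theta> :: real
  assumes p: "0 < p" and \<theta>: "0 < \<theta>"
  shows "likely M p (\<lambda>n w. \<forall>(i, j)\<in>{(i :: 'k, j :: 'k). i \<noteq> j}.
    \<bar>\<Sum>t = 2 * int CARD('k) + 1..T n. u n (t - int (lag i)) w * u n (t - int (lag j)) w\<bar> \<le> \<theta> * T n)"
proof -
  define X where "X = (\<lambda>(i :: 'k, j :: 'k) n w.
    \<Sum>t = 2 * int CARD('k) + 1..T n. u n (t - int (lag i)) w * u n (t - int (lag j)) w)"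
  have X: "integrable (M n) (\<lambda>w. \<bar>X q n w\<bar>) \<and> (\<integral>w. \<bar>X q n w\<bar> \<partial>M n) \<le> sqrt (T n) * (((1 + B4)\<^sup>2 + 1) / 2)"
    (is "?P q") if T1: "1 \<le> T n" and q: "q \<in> {(i :: 'k, j :: 'k). i \<noteq> j}" for n q
  proof -
    interpret iid_innovations "M n" "u n" "T n" B4 by (rule innovations[OF T1])
    \<comment> \<open>Shifting time by \<open>lag i\<close> produces the autocovariance at lag ?m.
      Starting the sum at 2K + 1 keeps both periods inside the sample.\<close>
    have ordered: "?P (i, j)" if ij: "lag i < lag j" for i j :: 'k
    proof -
      let ?m = "int (lag j) - int (lag i)" and ?J = "{2 * int CARD('k) + 1 - int (lag i)..T n - int (lag i)}"
      have shift: "X (i, j) n w = (\<Sum>t\<in>?J. u n t w * u n (t - ?m) w)" for w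
        unfolding X_def prod.case
        by (rule sum.reindex_bij_witness[of _ "\<lambda>t. t + int (lag i)" "\<lambda>t. t - int (lag i)"]) auto
      have m: "1 \<le> ?m" "?J \<subseteq> {?m + 1..T n}"
        using ij lag_ge_1[of i] lag_le_card[of i] lag_le_card[of j] by auto
      have "var\<^sup>2 \<le> (1 + B4)\<^sup>2" using var_le var_nonneg by (intro power_mono) auto
      then have "sqrt (T n) * ((var\<^sup>2 + 1) / 2) \<le> sqrt (T n) * (((1 + B4)\<^sup>2 + 1) / 2)"
        using T1 by (intro mult_left_mono) auto
      then show ?thesis
        unfolding shift using autocovariance[OF m] by auto
    qed
    obtain i j where q_eq: "q = (i, j)" by (cases q)
    have "lag i \<noteq> lag j" using q q_eq inj_lag by (auto dest: injD)
    then consider "lag i < lag j" | "lag j < lag i" by linarith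
    then show ?thesis
    proof cases
      case 1
      then show ?thesis unfolding q_eq by (rule ordered)
    next
      case 2
      have "X (i, j) n = X (j, i) n" by (simp add: X_def mult.commute)
      then show ?thesis unfolding q_eq using ordered[OF 2] by simp
    qed
  qed
  have "likely M p (\<lambda>n w. \<forall>q\<in>{(i :: 'k, j :: 'k). i \<noteq> j}. \<bar>X q n w\<bar> \<le> \<theta> * T n)"
    using p \<theta> finite X[THEN conjunct1] X[THEN conjunct2] by (rule likely_scaled)
  then show ?thesis by (rule likely_mono) (auto simp: X_def)
qed

lemma likely_variance:
  fixes c :: real
  assumes p: "0 < p" and c: "0 < c"
  shows "likely M p (\<lambda>n w. \<forall>j\<in>(UNIV :: 'k set).
    \<bar>\<Sum>t = 2 * int CARD('k) + 1 - int (lag j)..T n - int (lag j). (u n t w)\<^sup>2 - v n\<bar> \<le> c * T n)"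
    (is "likely M p (\<lambda>n w. \<forall>j\<in>UNIV. \<bar>?X j n w\<bar> \<le> _)")
proof (rule likely_scaled[OF p c finite])
  fix n and j :: 'k assume T1: "1 \<le> T n"
  interpret iid_innovations "M n" "u n" "T n" B4 by (rule innovations[OF T1])
  have J: "{2 * int CARD('k) + 1 - int (lag j)..T n - int (lag j)} \<subseteq> {1..T n}"
    using lag_le_card[of j] by auto
  show "integrable (M n) (\<lambda>w. \<bar>?X j n w\<bar>)" "(\<integral>w. \<bar>?X j n w\<bar> \<partial>M n) \<le> sqrt (T n) * ((B4 + 1) / 2)"
    unfolding v_def by (rule sq_deviation[OF J])+
qed

lemma likely_cross:
  fixes \<theta> :: real
  assumes p: "0 < p" and \<theta>: "0 < \<theta>"
  shows "likely M p (\<lambda>n w. \<forall>j\<in>(UNIV :: 'k set).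
    \<bar>\<Sum>t = int CARD('k) + 1..T n. u n t w * e0 n (t - int (lag j)) w\<bar> \<le> \<theta> * T n)"
    (is "likely M p (\<lambda>n w. \<forall>j\<in>UNIV. \<bar>?X j n w\<bar> \<le> _)")
proof (rule likely_scaled[OF p \<theta> finite])
  fix n and j :: 'k assume T1: "1 \<le> T n"
  interpret iid_innovations "M n" "u n" "T n" B4 by (rule innovations[OF T1])
  have B0: "0 \<le> B" using B by simp
  have j: "1 \<le> int (lag j)" "0 \<le> int CARD('k)" using lag_ge_1[of j] by auto
  show "integrable (M n) (\<lambda>w. \<bar>?X j n w\<bar>)"
    unfolding e0_def by (rule moving_avg_cross[OF _ _ l B0 j]; simp add: impulse_response_le)
  have "(\<integral>w. \<bar>?X j n w\<bar> \<partial>M n) \<le> b * (sqrt (T n) * ((var\<^sup>2 + 1) / 2))"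
    unfolding e0_def b_def by (rule moving_avg_cross[OF _ _ l B0 j]; simp add: impulse_response_le)
  also have "var\<^sup>2 \<le> (1 + B4)\<^sup>2" using var_le var_nonneg by (intro power_mono) auto
  then have "b * (sqrt (T n) * ((var\<^sup>2 + 1) / 2)) \<le> b * (sqrt (T n) * (((1 + B4)\<^sup>2 + 1) / 2))"
    using T1 b by (intro mult_left_mono) auto
  also have "\<dots> = sqrt (T n) * (b * (((1 + B4)\<^sup>2 + 1) / 2))" by simp
  finally show "(\<integral>w. \<bar>?X j n w\<bar> \<partial>M n) \<le> sqrt (T n) * (b * (((1 + B4)\<^sup>2 + 1) / 2))" .
qed

lemma likely_accurate_noisy:
  assumes e: "0 < e" and p: "0 < p" and \<kappa>: "0 < \<kappa>"
  shows "likely M p (\<lambda>n w. \<kappa> \<le> v n \<longrightarrow> accurate e n w)"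
proof -
  let ?I = "{1 - int CARD('k)..int Tstar}"
  define N where "N = real (card ?I)"
  have N: "0 < N" using card_ends by (simp add: N_def)
  \<comment> \<open>The variance threshold is fixed before \<theta>, so \<open>g\<close>, and with
    it \<open>c1\<close>, \<open>c3\<close>, \<open>c4\<close>, are constants when \<theta> is
    chosen.\<close>
  define g where "g = sqrt \<kappa> / 2"
  have g: "0 < g" "4 * g\<^sup>2 = \<kappa>" using \<kappa> by (simp_all add: g_def power_divide)
  have B4: "0 \<le> 1 + B4"
  proof -
    interpret iid_innovations "M 1" "u 1" "T 1" B4 by (rule innovations) (simp add: T)
    show ?thesis using var_nonneg var_le by linarith
  qed
  \<comment> \<open>Makes (p / 8) h^2 exceed every variance, which is at most 1 + B4; the 2 keeps
    \<open>h\<close> positive.\<close>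
  define h where "h = sqrt ((2 + B4) / (p / 8))"
  have h: "0 < h" "p / 8 * h\<^sup>2 = 2 + B4" using B4 p by (simp_all add: h_def)
  \<comment> \<open>The summands bound, in this order, the norm of the innovations, the norm of
    \<open>e0\<close>, and its end values by Markov's inequality with \<open>a\<close> = 1 and
    budget p / 8 split over \<open>N\<close> periods.\<close>
  define H where "H = h + b * h + b * ((1 + B4 + 1) / 2) / (p / 8 / N)"
  have "0 \<le> b * ((1 + B4 + 1) / 2) / (p / 8 / N)" using b B4 p N by simp
  moreover have "0 < b * h" using b h by simp
  ultimately have H: "h \<le> H" "b * h \<le> H" "0 < H" "b * ((1 + B4 + 1) / 2) / (p / 8 / N) \<le> H"
    using h(1) unfolding H_def by linarith+
  then have H': "b * ((1 + B4 + 1) / 2) \<le> p / 8 / N * H"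
    using p N by (subst (asm) pos_divide_le_eq) (auto simp: mult.commute)
  define c1 where "c1 = 2 * (1 + R) / g"
  define c3 where "c3 = B * (1 + real CARD('k) * c1 * (H + 1)) / l ^ (2 * CARD('k))"
  define c4 where "c4 = 1 + R + real CARD('k) * c1 + H * (real CARD('k) * c1) + c3"
  define C where "C = real CARD('k) * c1 * (H + 1) * c4 + c3 * c4 + 1 + R"
  obtain \<theta> where "0 < \<theta>" "\<theta> \<le> 1"
    and le: "\<And>c x. (c, x) \<in> set [((real CARD('k))\<^sup>2, g\<^sup>2), (2 * (real CARD('k) * (1 + R)), g), (C, e), ((c4 + 1 + R)\<^sup>2, e)]
      \<Longrightarrow> c * \<theta> \<le> x"
    by (rule small_parameter_exists[of "[((real CARD('k))\<^sup>2, g\<^sup>2), (2 * (real CARD('k) * (1 + R)), g), (C, e), ((c4 + 1 + R)\<^sup>2, e)]"])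
       (use e g in auto)
  moreover have "(real CARD('k))\<^sup>2 * \<theta> \<le> g\<^sup>2" by (rule le) simp
  moreover have "2 * (real CARD('k) * (1 + R)) * \<theta> \<le> g" by (rule le) simp
  moreover have "C * \<theta> \<le> e" by (rule le) simp
  moreover have "(c4 + 1 + R)\<^sup>2 * \<theta> \<le> e" by (rule le) simp
  ultimately have \<theta>: "0 < \<theta>" "\<theta> \<le> 1" "(real CARD('k))\<^sup>2 * \<theta> \<le> g\<^sup>2"
      "2 * (real CARD('k) * (1 + R) * \<theta>) \<le> g" "C * \<theta> \<le> e" "(c4 + 1 + R)\<^sup>2 * \<theta> \<le> e"
    by (simp_all add: mult.assoc)
  have var_bound: "v n \<le> 1 + B4" if "1 \<le> T n" for n
    unfolding v_def by (rule iid_innovations.var_le[OF innovations[OF that]])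
  have p8: "0 < p / 8" using p by simp
  have likely_u: "likely M (p / 8) (\<lambda>n w. True \<longrightarrow> (\<Sum>t = 1..T n. (u n t w)\<^sup>2) \<le> h\<^sup>2 * T n)"
    using var_bound h p8 by (intro likely_u_sum) fastforce+
  have likely_e0: "likely M (p / 8) (\<lambda>n w. \<forall>i\<in>?I. True \<longrightarrow> \<bar>e0 n (int n + i) w\<bar> \<le> H)"
  proof (rule likely_e0_end[where a = 1])
    fix n assume "1 \<le> T n"
    have "b * ((v n / 1 + 1) / 2) \<le> b * ((1 + B4 + 1) / 2)"
      using var_bound[OF \<open>1 \<le> T n\<close>] b by (intro mult_left_mono) auto
    with H' show "b * ((v n / 1 + 1) / 2) \<le> p / 8 / real (card ?I) * H" unfolding N_def by linarith
  qed (use H p8 in auto)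
  have g2: "0 < g\<^sup>2" using g by simp
  have "likely M (p / 8 + (p / 8 + (p / 8 + (p / 8 + (p / 8 + (p / 8 + (p / 8 + p / 8))))))) (\<lambda>n w.
      (True \<longrightarrow> (\<Sum>t = 1..T n. (u n t w)\<^sup>2) \<le> h\<^sup>2 * T n) \<and>
      (\<forall>i\<in>?I. True \<longrightarrow> \<bar>e0 n (int n + i) w\<bar> \<le> H) \<and>
      (\<Sum>t = 1..T n. (d n t w)\<^sup>2) \<le> \<theta>\<^sup>2 * T n \<and>
      (\<forall>i\<in>?I. \<bar>d n (int n + i) w\<bar> \<le> \<theta>) \<and>
      (\<forall>j\<in>(UNIV :: 'k set). \<bar>\<Sum>t = 2 * int CARD('k) + 1 - int (lag j)..T n - int (lag j). (u n t w)\<^sup>2 - v n\<bar> \<le> g\<^sup>2 * T n) \<and>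
      (\<forall>(i, j)\<in>{(i :: 'k, j :: 'k). i \<noteq> j}.
        \<bar>\<Sum>t = 2 * int CARD('k) + 1..T n. u n (t - int (lag i)) w * u n (t - int (lag j)) w\<bar> \<le> \<theta> * T n) \<and>
      (\<forall>j\<in>(UNIV :: 'k set). \<bar>\<Sum>t = int CARD('k) + 1..T n. u n t w * e0 n (t - int (lag j)) w\<bar> \<le> \<theta> * T n) \<and>
      (\<Sum>t = 1..T n. l ^ nat t * \<bar>u n t w\<bar>) \<le> \<theta> * sqrt (T n))"
    (is "likely M _ ?Q")
    by (intro likely_conj[OF prob] likely_u likely_e0 likely_d_sum[OF \<theta>(1) p8] likely_d_end[OF \<theta>(1) p8]
        likely_variance[OF p8 g2] likely_autocovariance[OF p8 \<theta>(1)] likely_cross[OF p8 \<theta>(1)] likely_start[OF p8 \<theta>(1)])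
  then have "likely M (p / 8 + (p / 8 + (p / 8 + (p / 8 + (p / 8 + (p / 8 + (p / 8 + p / 8)))))))
      (\<lambda>n w. \<kappa> \<le> v n \<longrightarrow> accurate e n w)"
  proof (rule likely_mono)
    show "\<forall>\<^sub>F n in sequentially. \<forall>w\<in>space (M n). ?Q n w \<longrightarrow> (\<kappa> \<le> v n \<longrightarrow> accurate e n w)"
      using eventually_ge_at_top[of "8 * CARD('k)"] geometric_beats_sqrt[OF l zero_less_one, of 1 Tstar]
    proof eventually_elim
      case (elim n)
      show ?case
      proof (intro ballI impI)
        fix w assume w: "w \<in> space (M n)" and Q: "?Q n w" and v: "\<kappa> \<le> v n"
        show "accurate e n w"
          by (rule accurate_if_noisy[OF w _ g(1) _ _ \<theta>(2-4) \<theta>(5)[unfolded C_def] \<theta>(6) c1_def c3_def c4_def _ H(1,2)])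
             (use Q v elim \<theta>(1) h(1) g(2) in auto)
      qed
    qed
  qed
  then show ?thesis by simp
qed

text \<open>The variance is a number for each sample size, so one of the two implications is vacuous
  and the other gives accuracy. No limit of the variances has to exist.\<close>

lemma likely_accurate:
  assumes "0 < e" "0 < p"
  shows "likely M p (accurate e)"
proof -
  have p: "0 < p / 2" using assms(2) by simp
  obtain \<kappa> where \<kappa>: "0 < \<kappa>" "likely M (p / 2) (\<lambda>n w. v n < \<kappa> \<longrightarrow> accurate e n w)"
    using likely_accurate_quiet[OF assms(1) p] .
  have "likely M (p / 2 + p / 2)
      (\<lambda>n w. (v n < \<kappa> \<longrightarrow> accurate e n w) \<and> (\<kappa> \<le> v n \<longrightarrow> accurate e n w))"
    by (rule likely_conj[OF prob \<kappa>(2) likely_accurate_noisy[OF assms(1) p \<kappa>(1)]])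
  then have "likely M (p / 2 + p / 2) (accurate e)"
    by (rule likely_mono) (auto intro!: always_eventually simp: not_less)
  then show ?thesis by simp
qed

end

section \<open>Transfer to the counterfactual mean proxies\<close>

theorem lemma7:
  fixes M :: "nat \<Rightarrow> 'a measure"
    and T :: "nat \<Rightarrow> int" and Tstar :: nat
    and u \<epsilon> Y C Chat \<epsilon>hat P Phat :: "nat \<Rightarrow> int \<Rightarrow> 'a \<Rightarrow> real"
    and x xhat :: "nat \<Rightarrow> int \<Rightarrow> 'a \<Rightarrow> real ^ ('k::{finite,linorder})"
    and \<rho> :: "nat \<Rightarrow> real ^ ('k::{finite,linorder})" and \<rho>hat :: "nat \<Rightarrow> 'a \<Rightarrow> real ^ ('k::{finite,linorder})"
  assumes prob: "\<And>n. prob_space (M n)"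
    and T: "\<And>n. T n = int n + int Tstar"
    and meas_Y: "\<And>n t. t \<in> {1..T n} \<Longrightarrow> Y n t \<in> borel_measurable (M n)"
    and meas_C: "\<And>n t. t \<in> {1..T n} \<Longrightarrow> C n t \<in> borel_measurable (M n)"
    and meas_Chat: "\<And>n t. t \<in> {1..T n} \<Longrightarrow> Chat n t \<in> borel_measurable (M n)"
    \<comment> \<open>the model\<close>
    and x: "\<And>n t \<omega>. x n t \<omega> = lag_vec (\<lambda>s. \<epsilon> n s \<omega>) t"
    and Y: "\<And>n t \<omega>. t \<in> {1..T n} \<Longrightarrow> \<omega> \<in> space (M n) \<Longrightarrow> Y n t \<omega> = C n t \<omega> + \<epsilon> n t \<omega>"
    and AR: "\<And>n t \<omega>. t \<in> {1..T n} \<Longrightarrow> \<omega> \<in> space (M n) \<Longrightarrow> \<epsilon> n t \<omega> = x n t \<omega> \<bullet> \<rho> n + u n t \<omega>"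
    and u_indep: "\<And>n. prob_space.indep_vars (M n) (\<lambda>_. borel) (u n) {1..T n}"
    and u_ident: "\<And>n t. t \<in> {1..T n} \<Longrightarrow> distr (M n) borel (u n t) = distr (M n) borel (u n 1)"
    and u_mean: "\<And>n t. t \<in> {1..T n} \<Longrightarrow> integral\<^sup>L (M n) (u n t) = 0"
    and u_fourth: "\<exists>B. \<forall>n. integrable (M n) (\<lambda>\<omega>. u n 1 \<omega> ^ 4) \<and> (\<integral>\<omega>. u n 1 \<omega> ^ 4 \<partial>M n) \<le> B"
    and u_C_indep: "\<And>n. prob_space.indep_var (M n)
          (\<Pi>\<^sub>M t\<in>{1..T n}. borel) (\<lambda>\<omega>. \<lambda>t\<in>{1..T n}. u n t \<omega>)
          (\<Pi>\<^sub>M t\<in>{1..T n}. borel) (\<lambda>\<omega>. \<lambda>t\<in>{1..T n}. C n t \<omega>)"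
    and roots: "\<exists>\<eta>>0. \<forall>n. \<forall>z::complex.
          1 - (\<Sum>j\<in>UNIV. of_real (\<rho> n $ j) * z ^ lag j) = 0 \<longrightarrow> norm z \<ge> 1 + \<eta>"
    \<comment> \<open>the estimators\<close>
    and Chat_sum: "small_oP M (\<lambda>n \<omega>. \<Sum>t = 1..T n. (Chat n t \<omega> - C n t \<omega>)\<^sup>2) (\<lambda>n. of_int (T n))"
    and Chat_end: "\<And>i. i \<in> {1 - int CARD('k)..int Tstar} \<Longrightarrow>
          small_oP M (\<lambda>n \<omega>. Chat n (int n + i) \<omega> - C n (int n + i) \<omega>) (\<lambda>n. 1)"
    and \<epsilon>hat: "\<And>n t \<omega>. \<epsilon>hat n t \<omega> = Y n t \<omega> - Chat n t \<omega>"
    and xhat: "\<And>n t \<omega>. xhat n t \<omega> = lag_vec (\<lambda>s. \<epsilon>hat n s \<omega>) t"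
    and \<rho>hat: "\<And>n \<omega>. \<rho>hat n \<omega> = ar_ols (T n) (\<lambda>t. \<epsilon>hat n t \<omega>)"
    and P: "\<And>n t \<omega>. P n t \<omega> = C n t \<omega> + x n t \<omega> \<bullet> \<rho> n"
    and Phat: "\<And>n t \<omega>. Phat n t \<omega> = Chat n t \<omega> + xhat n t \<omega> \<bullet> \<rho>hat n \<omega>"
  shows "(\<forall>i \<in> {1..int Tstar}.
            small_oP M (\<lambda>n \<omega>. Phat n (int n + i) \<omega> - P n (int n + i) \<omega>) (\<lambda>n. 1)) \<and>
         small_oP M (\<lambda>n \<omega>. \<Sum>t = int CARD('k) + 1..T n. (Phat n t \<omega> - P n t \<omega>)\<^sup>2) (\<lambda>n. of_int (T n))"
proof -
  obtain \<eta> where \<eta>: "0 < \<eta>" "\<And>n. roots_beyond \<eta> (\<rho> n)"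
    using roots unfolding roots_beyond_def by blast
  obtain B l where Bl: "1 \<le> B" "0 < l" "l < 1"
    and decays: "\<And>r :: (real, 'k) vec. roots_beyond \<eta> r \<Longrightarrow> decays B l r"
    by (rule roots_beyond_decays[OF \<eta>(1), where 'k = 'k]) (rule that)
  obtain B4 where B4: "\<And>n. integrable (M n) (\<lambda>\<omega>. u n 1 \<omega> ^ 4)" "\<And>n. (\<integral>\<omega>. u n 1 \<omega> ^ 4 \<partial>M n) \<le> B4"
    using u_fourth by blast
  define d where "d n t \<omega> = Chat n t \<omega> - C n t \<omega>" for n t \<omega>
  define R where "R = real CARD('k) * 2 ^ CARD('k)"
  interpret ar_panel M T Tstar u \<epsilon> d \<epsilon>hat \<rho> B4 B l R "(B * (1 + R) + R / l ^ CARD('k)) / (1 - l)"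
  proof (rule ar_panel.intro)
    show "iid_innovations (M n) (u n) (T n) B4" if "1 \<le> T n" for n
      by (intro iid_innovations.intro iid_innovations_axioms.intro prob that u_indep u_ident u_mean B4)
    show "ar_res (\<rho> n) (\<lambda>s. \<epsilon> n s \<omega>) t = u n t \<omega>" if "t \<in> {1..T n}" "\<omega> \<in> space (M n)" for n t \<omega>
      using AR[OF that] by (simp add: ar_res_def x inner_commute)
    show "\<epsilon>hat n t \<omega> = \<epsilon> n t \<omega> - d n t \<omega>" if "t \<in> {1..T n}" "\<omega> \<in> space (M n)" for n t \<omega>
      using Y[OF that] by (simp add: \<epsilon>hat d_def)
    show "\<bar>\<rho> n $ j\<bar> \<le> 2 ^ CARD('k)" for n j by (rule roots_beyond_coeff_bound[OF \<eta>])
    show "small_oP M (\<lambda>n \<omega>. \<Sum>t = 1..T n. (d n t \<omega>)\<^sup>2) (\<lambda>n. of_int (T n))"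
      unfolding d_def by (rule Chat_sum)
    show "small_oP M (\<lambda>n \<omega>. d n (int n + i) \<omega>) (\<lambda>n. 1)" if "i \<in> {1 - int CARD('k)..int Tstar}" for i
      unfolding d_def by (rule Chat_end[OF that])
    show "decays B l (\<rho> n)" for n by (rule decays[OF \<eta>(2)])
    show "R = real CARD('k) * 2 ^ CARD('k)" by (rule R_def)
  qed (rule prob T Bl refl)+

  have lag_in: "t - int (lag j) \<in> {1..T n}" if "t \<in> {int CARD('k) + 1..T n}" for n t and j :: 'k
    using that lag_ge_1[of j] lag_le_card[of j] by auto
  \<comment> \<open>The identity needs all K lags inside the sample, since the estimated errors
    equal \<epsilon> - d only there; hence the start at K + 1.\<close>
  have err: "Phat n t \<omega> - P n t \<omega> = pred_err n t \<omega>"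
    if t: "t \<in> {int CARD('k) + 1..T n}" and \<omega>: "\<omega> \<in> space (M n)" for n t \<omega>
  proof -
    have "\<rho> n \<bullet> lag_vec (\<lambda>t. \<epsilon>hat n t \<omega>) t = \<rho> n \<bullet> lag_vec (\<lambda>t. \<epsilon> n t \<omega> - d n t \<omega>) t"
      using t Y[OF _ \<omega>] by (intro inner_lag_vec_cong) (auto simp: \<epsilon>hat d_def)
    then show ?thesis
      by (simp add: Phat P xhat x \<rho>hat pred_err_def fit_err_def ar_res_def d_def[of n t] inner_commute
          lag_vec_diff inner_diff_left inner_diff_right)
  qed
  have meas: "(\<lambda>\<omega>. Phat n t \<omega> - P n t \<omega>) \<in> borel_measurable (M n)"
    if t: "t \<in> {int CARD('k) + 1..T n}" for n t
  proof -
    have meas_\<epsilon>hat: "\<epsilon>hat n t \<in> borel_measurable (M n)" if "t \<in> {1..T n}" for t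
      unfolding \<epsilon>hat[abs_def] by (intro borel_measurable_diff meas_Y meas_Chat that)
    have meas_d: "d n t \<in> borel_measurable (M n)" if "t \<in> {1..T n}" for t
      unfolding d_def[abs_def] by (intro borel_measurable_diff meas_C meas_Chat that)
    have "(\<lambda>\<omega>. (ar_ols (T n) (\<lambda>t. \<epsilon>hat n t \<omega>) :: (real, 'k) vec) \<bullet> lag_vec (\<lambda>t. \<epsilon>hat n t \<omega>) t) \<in> borel_measurable (M n)"
      using t by (intro borel_measurable_fitted_value[where T = "T n"] meas_\<epsilon>hat normal_solution_ar_ols)
    moreover have "(\<lambda>\<omega>. \<rho> n \<bullet> lag_vec (\<lambda>t. \<epsilon>hat n t \<omega>) t) \<in> borel_measurable (M n)"
      "(\<lambda>\<omega>. \<rho> n \<bullet> lag_vec (\<lambda>t. d n t \<omega>) t) \<in> borel_measurable (M n)"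
      unfolding inner_lag_vec
      by (intro borel_measurable_sum borel_measurable_times borel_measurable_const meas_\<epsilon>hat meas_d lag_in t)+
    moreover have "d n t \<in> borel_measurable (M n)" using t by (intro meas_d) auto
    ultimately have "pred_err n t \<in> borel_measurable (M n)"
      unfolding pred_err_def[abs_def] fit_err_def ar_res_def inner_diff_left
      by (intro borel_measurable_add borel_measurable_diff)
    then show ?thesis using err[OF t] by (subst measurable_cong)
  qed

  show ?thesis
  proof (intro conjI ballI)
    fix i assume i: "i \<in> {1..int Tstar}"
    have in_sample: "\<forall>\<^sub>F n in sequentially. int n + i \<in> {int CARD('k) + 1..T n}"
      using eventually_ge_at_top[of "CARD('k)"] by eventually_elim (use i in \<open>auto simp: T\<close>)
    show "small_oP M (\<lambda>n \<omega>. Phat n (int n + i) \<omega> - P n (int n + i) \<omega>) (\<lambda>n. 1)"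
    proof (rule small_oP_likely[OF prob])
      show "\<forall>\<^sub>F n in sequentially. (\<lambda>\<omega>. Phat n (int n + i) \<omega> - P n (int n + i) \<omega>) \<in> borel_measurable (M n)"
        using in_sample by eventually_elim (rule meas)
      fix e p :: real assume "0 < e" "0 < p"
      then have "likely M p (accurate e)" by (rule likely_accurate)
      then show "likely M p (\<lambda>n \<omega>. \<bar>Phat n (int n + i) \<omega> - P n (int n + i) \<omega>\<bar> \<le> e * 1)"
      proof (rule likely_mono)
        show "\<forall>\<^sub>F n in sequentially. \<forall>\<omega>\<in>space (M n).
            accurate e n \<omega> \<longrightarrow> \<bar>Phat n (int n + i) \<omega> - P n (int n + i) \<omega>\<bar> \<le> e * 1"
          using in_sample by eventually_elim (use i err in \<open>auto simp: accurate_def\<close>)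
      qed
    qed
  next
    let ?S = "\<lambda>n \<omega>. \<Sum>t = int CARD('k) + 1..T n. (Phat n t \<omega> - P n t \<omega>)\<^sup>2"
    show "small_oP M ?S (\<lambda>n. of_int (T n))"
    proof (rule small_oP_likely[OF prob])
      show "\<forall>\<^sub>F n in sequentially. ?S n \<in> borel_measurable (M n)"
        by (intro always_eventually allI borel_measurable_sum borel_measurable_power meas)
      fix e p :: real assume "0 < e" "0 < p"
      then have "likely M p (accurate e)" by (rule likely_accurate)
      then show "likely M p (\<lambda>n \<omega>. \<bar>?S n \<omega>\<bar> \<le> e * of_int (T n))"
        by (rule likely_mono) (auto intro!: always_eventually simp: accurate_def err sum_nonneg)
    qed
  qed
qed

end
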